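(* Let $K$ be a field and let $\mathcal{G}$ be an ultragraph such that $L_K(\mathcal{G})$ is unital and such that there is an infinite number of hereditary saturated subsets in $\mathcal{G}^0$. Then $L_K(\mathcal{G})$ is not isomorphic (as a $K$-algebra) to the Leavitt path algebra $L_K(E)$ of any directed graph $E$.
   Context: An ultragraph $\mathcal{G}=(G^0,\mathcal{G}^1,r,s)$ consists of a countable set $G^0$ of vertices, a countable set $\mathcal{G}^1$ of edges, and maps $s:\mathcal{G}^1\to G^0$, $r:\mathcal{G}^1\to\mathcal{P}(G^0)\setminus\{\varnothing\}$. A vertex $v$ is regular if $0<|s^{-1}(v)|<\infty$. $\mathcal{G}^0$ denotes the smallest subset of $\mathcal{P}(G^0)$ that contains $\{v\}$ for all $v\in G^0$, contains $r(e)$ for all $e\in\mathcal{G}^1$, and is closed under relative complements, finite unions and finite intersections. For a field $K$, $L_K(\mathcal{G})$ is the (associative, not necessarily unital) $K$-algebra generated by $\{s_e,s_e^*\mid e\in\mathcal{G}^1\}\cup\{p_A\mid A\in\mathcal{G}^0\}$ subject to the relations, for all $A,B\in\mathcal{G}^0$, $e,f\in\mathcal{G}^1$: (1) $p_\varnothing=0$, $p_Ap_B=p_{A\cap B}$, $p_{A\cup B}=p_A+p_B-p_{A\cap B}$; (2) $p_{s(e)}s_e=s_e=s_ep_{r(e)}$ and $p_{r(e)}s_e^*=s_e^*=s_e^*p_{s(e)}$; (3) $s_e^*s_f=\delta_{e,f}p_{r(e)}$; (4) $p_v=\sum_{s(e)=v}s_es_e^*$ for every regular vertex $v$, where $p_v:=p_{\{v\}}$.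 A subset $\mathcal{H}\subseteq\mathcal{G}^0$ is hereditary if: (1) $\{s(e)\}\in\mathcal{H}$ implies $r(e)\in\mathcal{H}$ for every edge $e$; (2) $A\cup B\in\mathcal{H}$ for all $A,B\in\mathcal{H}$; (3) $A\in\mathcal{H}$, $B\in\mathcal{G}^0$, $B\subseteq A$ imply $B\in\mathcal{H}$. It is saturated if for every regular vertex $v$, $\{r(e)\mid s(e)=v\}\subseteq\mathcal{H}$ implies $\{v\}\in\mathcal{H}$. For a directed graph $E=(E^0,E^1,r,s)$ the Leavitt path algebra $L_K(E)$ is the $K$-algebra generated by pairwise orthogonal idempotents $p_v$ ($v\in E^0$) and elements $s_e,s_e^*$ ($e\in E^1$) with $p_{s(e)}s_e=s_e=s_ep_{r(e)}$, $p_{r(e)}s_e^*=s_e^*=s_e^*p_{s(e)}$, $s_e^*s_f=\delta_{e,f}p_{r(e)}$, and $p_v=\sum_{s(e)=v}s_es_e^*$ whenever $0<|s^{-1}(v)|<\infty$. *)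

theory Defs
  imports
    "HOL-Library.Countable_Set"
    "HOL-Library.Poly_Mapping"
    "Graph_Theory.Digraph"
begin

section \<open>Non-unital algebras presented by generators and relations\<close>

text \<open>The type class for fields supplies the ground field; an algebra is a structure on an
  explicit carrier, and no unit is part of the data.\<close>

record ('k, 'a) nu_algebra =
  alg_carrier :: "'a set"
  alg_add :: "'a \<Rightarrow> 'a \<Rightarrow> 'a"
  alg_mult :: "'a \<Rightarrow> 'a \<Rightarrow> 'a"
  alg_scale :: "'k \<Rightarrow> 'a \<Rightarrow> 'a"

definition unital :: "('k, 'a) nu_algebra \<Rightarrow> bool" where
  "unital A \<longleftrightarrow>
     (\<exists>u \<in> alg_carrier A. \<forall>x \<in> alg_carrier A. alg_mult A u x = x \<and> alg_mult A x u = x)"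

definition alg_iso :: "('k, 'a) nu_algebra \<Rightarrow> ('k, 'b) nu_algebra \<Rightarrow> ('a \<Rightarrow> 'b) \<Rightarrow> bool" where
  "alg_iso A B h \<longleftrightarrow>
     bij_betw h (alg_carrier A) (alg_carrier B) \<and>
     (\<forall>x \<in> alg_carrier A. \<forall>y \<in> alg_carrier A. h (alg_add A x y) = alg_add B (h x) (h y)) \<and>
     (\<forall>x \<in> alg_carrier A. \<forall>y \<in> alg_carrier A. h (alg_mult A x y) = alg_mult B (h x) (h y)) \<and>
     (\<forall>c. \<forall>x \<in> alg_carrier A. h (alg_scale A c x) = alg_scale B c (h x))"

definition alg_isomorphic :: "('k, 'a) nu_algebra \<Rightarrow> ('k, 'b) nu_algebra \<Rightarrow> bool" where
  "alg_isomorphic A B \<longleftrightarrow> (\<exists>h. alg_iso A B h)"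

text \<open>Words under concatenation.  The free unital algebra is the monoid algebra over words,
  which \<open>Poly_Mapping\<close> turns into a ring; the free non-unital algebra on a set \<open>X\<close> of letters
  consists of the linear combinations of non-empty words over \<open>X\<close>.\<close>

datatype 'x fword = FWord (letters: "'x list")

instantiation fword :: (type) monoid_add
begin

definition zero_fword :: "'a fword" where
  "0 = FWord []"

definition plus_fword :: "'a fword \<Rightarrow> 'a fword \<Rightarrow> 'a fword" where
  "u + w = FWord (letters u @ letters w)"

instance
  by standard (simp_all add: zero_fword_def plus_fword_def)

end

type_synonym ('x, 'k) falg = "'x fword \<Rightarrow>\<^sub>0 'k"

definition gen :: "'x \<Rightarrow> ('x, 'k::field) falg" where
  "gen x = Poly_Mapping.single (FWord [x]) 1"

definition fscale :: "'k::field \<Rightarrow> ('x, 'k) falg \<Rightarrow> ('x, 'k) falg" where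
  "fscale c a = Poly_Mapping.map (\<lambda>t. c * t) a"

definition free_nu :: "'x set \<Rightarrow> ('x, 'k::field) falg set" where
  "free_nu X = {a. \<forall>w \<in> Poly_Mapping.keys a. letters w \<noteq> [] \<and> set (letters w) \<subseteq> X}"

inductive_set rel_ideal ::
    "'x set \<Rightarrow> (('x, 'k::field) falg \<Rightarrow> ('x, 'k) falg \<Rightarrow> bool) \<Rightarrow> ('x, 'k) falg set"
  for X :: "'x set" and R :: "('x, 'k) falg \<Rightarrow> ('x, 'k) falg \<Rightarrow> bool"
where
  zero: "0 \<in> rel_ideal X R"
| relator: "R a b \<Longrightarrow> a - b \<in> rel_ideal X R"
| add: "a \<in> rel_ideal X R \<Longrightarrow> b \<in> rel_ideal X R \<Longrightarrow> a + b \<in> rel_ideal X R"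
| scale: "a \<in> rel_ideal X R \<Longrightarrow> fscale c a \<in> rel_ideal X R"
| mult_left: "a \<in> rel_ideal X R \<Longrightarrow> b \<in> free_nu X \<Longrightarrow> b * a \<in> rel_ideal X R"
| mult_right: "a \<in> rel_ideal X R \<Longrightarrow> b \<in> free_nu X \<Longrightarrow> a * b \<in> rel_ideal X R"

definition rel_cong ::
    "'x set \<Rightarrow> (('x, 'k::field) falg \<Rightarrow> ('x, 'k) falg \<Rightarrow> bool) \<Rightarrow> (('x, 'k) falg \<times> ('x, 'k) falg) set"
where
  "rel_cong X R = {(a, b). a \<in> free_nu X \<and> b \<in> free_nu X \<and> a - b \<in> rel_ideal X R}"

definition presented_algebra ::
    "'x set \<Rightarrow> (('x, 'k::field) falg \<Rightarrow> ('x, 'k) falg \<Rightarrow> bool) \<Rightarrow> ('k, ('x, 'k) falg set) nu_algebra"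
where
  "presented_algebra X R =
     (let \<theta> = rel_cong X R in
      \<lparr> alg_carrier = free_nu X // \<theta>,
        alg_add = (\<lambda>S T. \<Union>a \<in> S. \<Union>b \<in> T. \<theta> `` {a + b}),
        alg_mult = (\<lambda>S T. \<Union>a \<in> S. \<Union>b \<in> T. \<theta> `` {a * b}),
        alg_scale = (\<lambda>c S. \<Union>a \<in> S. \<theta> `` {fscale c a}) \<rparr>)"

section \<open>Ultragraphs\<close>

record ('v, 'e) ultragraph =
  uverts :: "'v set"
  uedges :: "'e set"
  usource :: "'e \<Rightarrow> 'v"
  urange :: "'e \<Rightarrow> 'v set"

locale ultragraph =
  fixes G :: "('v, 'e) ultragraph"
  assumes countable_verts: "countable (uverts G)"
    and countable_edges: "countable (uedges G)"
    and source_in_verts: "e \<in> uedges G \<Longrightarrow> usource G e \<in> uverts G"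
    and range_subset_verts: "e \<in> uedges G \<Longrightarrow> urange G e \<subseteq> uverts G"
    and range_nonempty: "e \<in> uedges G \<Longrightarrow> urange G e \<noteq> {}"

definition out_edges :: "('v, 'e) ultragraph \<Rightarrow> 'v \<Rightarrow> 'e set" where
  "out_edges G v = {e \<in> uedges G. usource G e = v}"

definition regular_vertex :: "('v, 'e) ultragraph \<Rightarrow> 'v \<Rightarrow> bool" where
  "regular_vertex G v \<longleftrightarrow> v \<in> uverts G \<and> out_edges G v \<noteq> {} \<and> finite (out_edges G v)"

text \<open>The empty set is the empty union; listing it matters only if there are no vertices.\<close>

inductive_set gen_verts :: "('v, 'e) ultragraph \<Rightarrow> 'v set set"
  for G :: "('v, 'e) ultragraph"
where
  empty: "{} \<in> gen_verts G"
| vertex: "v \<in> uverts G \<Longrightarrow> {v} \<in> gen_verts G"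
| range: "e \<in> uedges G \<Longrightarrow> urange G e \<in> gen_verts G"
| diff: "A \<in> gen_verts G \<Longrightarrow> B \<in> gen_verts G \<Longrightarrow> A - B \<in> gen_verts G"
| union: "A \<in> gen_verts G \<Longrightarrow> B \<in> gen_verts G \<Longrightarrow> A \<union> B \<in> gen_verts G"
| inter: "A \<in> gen_verts G \<Longrightarrow> B \<in> gen_verts G \<Longrightarrow> A \<inter> B \<in> gen_verts G"

definition hereditary :: "('v, 'e) ultragraph \<Rightarrow> 'v set set \<Rightarrow> bool" where
  "hereditary G H \<longleftrightarrow>
     H \<subseteq> gen_verts G \<and>
     (\<forall>e \<in> uedges G. {usource G e} \<in> H \<longrightarrow> urange G e \<in> H) \<and>
     (\<forall>A \<in> H. \<forall>B \<in> H. A \<union> B \<in> H) \<and>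
     (\<forall>A \<in> H. \<forall>B \<in> gen_verts G. B \<subseteq> A \<longrightarrow> B \<in> H)"

definition saturated :: "('v, 'e) ultragraph \<Rightarrow> 'v set set \<Rightarrow> bool" where
  "saturated G H \<longleftrightarrow> (\<forall>v. regular_vertex G v \<and> urange G ` out_edges G v \<subseteq> H \<longrightarrow> {v} \<in> H)"

section \<open>Leavitt path algebras\<close>

datatype ('p, 'e) leavitt_gen = Proj 'p | Edge 'e | Ghost 'e

abbreviation pj :: "'p \<Rightarrow> (('p, 'e) leavitt_gen, 'k::field) falg" where
  "pj A \<equiv> gen (Proj A)"

abbreviation ed :: "'e \<Rightarrow> (('p, 'e) leavitt_gen, 'k::field) falg" where
  "ed e \<equiv> gen (Edge e)"

abbreviation gh :: "'e \<Rightarrow> (('p, 'e) leavitt_gen, 'k::field) falg" where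
  "gh e \<equiv> gen (Ghost e)"

inductive ultragraph_rel ::
    "('v, 'e) ultragraph \<Rightarrow> (('v set, 'e) leavitt_gen, 'k::field) falg \<Rightarrow>
     (('v set, 'e) leavitt_gen, 'k) falg \<Rightarrow> bool"
  for G :: "('v, 'e) ultragraph"
where
  empty: "ultragraph_rel G (pj {}) 0"
| inter: "A \<in> gen_verts G \<Longrightarrow> B \<in> gen_verts G \<Longrightarrow> ultragraph_rel G (pj A * pj B) (pj (A \<inter> B))"
| union: "A \<in> gen_verts G \<Longrightarrow> B \<in> gen_verts G \<Longrightarrow>
    ultragraph_rel G (pj (A \<union> B)) (pj A + pj B - pj (A \<inter> B))"
| source_edge: "e \<in> uedges G \<Longrightarrow> ultragraph_rel G (pj {usource G e} * ed e) (ed e)"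
| edge_range: "e \<in> uedges G \<Longrightarrow> ultragraph_rel G (ed e * pj (urange G e)) (ed e)"
| range_ghost: "e \<in> uedges G \<Longrightarrow> ultragraph_rel G (pj (urange G e) * gh e) (gh e)"
| ghost_source: "e \<in> uedges G \<Longrightarrow> ultragraph_rel G (gh e * pj {usource G e}) (gh e)"
| ghost_edge: "e \<in> uedges G \<Longrightarrow> f \<in> uedges G \<Longrightarrow>
    ultragraph_rel G (gh e * ed f) (if e = f then pj (urange G e) else 0)"
| regular: "regular_vertex G v \<Longrightarrow>
    ultragraph_rel G (pj {v}) (\<Sum>e \<in> out_edges G v. ed e * gh e)"

text \<open>The argument of type \<open>'k itself\<close> names the ground field.\<close>

definition ultragraph_lpa ::
    "'k::field itself \<Rightarrow> ('v, 'e) ultragraph \<Rightarrow>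
     ('k, (('v set, 'e) leavitt_gen, 'k) falg set) nu_algebra"
where
  "ultragraph_lpa K G =
     presented_algebra (Proj ` gen_verts G \<union> Edge ` uedges G \<union> Ghost ` uedges G) (ultragraph_rel G)"

inductive digraph_rel ::
    "('v, 'e) pre_digraph \<Rightarrow> (('v, 'e) leavitt_gen, 'k::field) falg \<Rightarrow>
     (('v, 'e) leavitt_gen, 'k) falg \<Rightarrow> bool"
  for E :: "('v, 'e) pre_digraph"
where
  vertices: "v \<in> verts E \<Longrightarrow> w \<in> verts E \<Longrightarrow>
    digraph_rel E (pj v * pj w) (if v = w then pj v else 0)"
| source_edge: "e \<in> arcs E \<Longrightarrow> digraph_rel E (pj (tail E e) * ed e) (ed e)"
| edge_range: "e \<in> arcs E \<Longrightarrow> digraph_rel E (ed e * pj (head E e)) (ed e)"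
| range_ghost: "e \<in> arcs E \<Longrightarrow> digraph_rel E (pj (head E e) * gh e) (gh e)"
| ghost_source: "e \<in> arcs E \<Longrightarrow> digraph_rel E (gh e * pj (tail E e)) (gh e)"
| ghost_edge: "e \<in> arcs E \<Longrightarrow> f \<in> arcs E \<Longrightarrow>
    digraph_rel E (gh e * ed f) (if e = f then pj (head E e) else 0)"
| regular: "v \<in> verts E \<Longrightarrow> out_arcs E v \<noteq> {} \<Longrightarrow> finite (out_arcs E v) \<Longrightarrow>
    digraph_rel E (pj v) (\<Sum>e \<in> out_arcs E v. ed e * gh e)"

definition digraph_lpa ::
    "'k::field itself \<Rightarrow> ('v, 'e) pre_digraph \<Rightarrow>
     ('k, (('v, 'e) leavitt_gen, 'k) falg set) nu_algebra"
where
  "digraph_lpa K E =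
     presented_algebra (Proj ` verts E \<union> Edge ` arcs E \<union> Ghost ` arcs E) (digraph_rel E)"

end

theory Submission
  imports Defs "Graph_Theory.Arc_Walk" "HOL-Library.Sublist" "HOL-Computational_Algebra.Polynomial"
begin

text \<open>The invariant is the number of ideals \<open>I\<close> with \<open>I\<^sup>2 = I\<close>.  Every hereditary saturated \<open>H\<close>
  gives such an ideal in the ultragraph algebra, generated by the idempotents \<open>p\<^sub>A\<close> with \<open>A \<in> H\<close>, and
  \<open>p\<^sub>A\<close> lies in it only if \<open>A \<in> H\<close>: the algebra acts on a space in which exactly the members of \<open>H\<close>
  act as zero.  So there are infinitely many.

  A unital Leavitt path algebra of a graph involves only finitely many vertices.  There an idempotent
  ideal \<open>I\<close> is generated by the vertices in \<open>I\<close> and by the elements \<open>v - \<Sum> e e\<^sup>*\<close> in \<open>I\<close> where \<open>e\<close>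
  ranges over the edges from \<open>v\<close> to a vertex outside \<open>I\<close>, so there are finitely many.  To see this,
  divide by these generators.  A non-zero element of what is left of \<open>I\<close> can be reduced to
  \<open>v + \<Sum> k\<^sub>i \<gamma>\<^sub>i\<close> with closed walks \<open>\<gamma>\<^sub>i\<close> at \<open>v\<close>.  If the number of the \<open>\<gamma>\<^sub>i\<close> is minimal, then \<open>v\<close>
  lies on a cycle without exits, whose corner is the ring of Laurent polynomials in the cycle.  That
  ring has no idempotent ideals except zero and itself, so \<open>v\<close> is in \<open>I\<close>, a contradiction.  (The
  powers of the cycle remain independent in the quotient because the generators are homogeneous.)\<close>

section \<open>Elements of Leavitt path algebras modulo an ideal\<close>

text \<open>Counting all ideals would fail: the algebra of one vertex with one loop is the ring of
  Laurent polynomials and has infinitely many. Counting graded ideals would fail too, because an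
  isomorphism need not respect degrees.

  The unit is exploited on the graph side: only finitely many vertices occur at the beginning of the
  words of a unit, and these already sum to a unit. In an ultragraph a single
  \<open>p\<^sub>A\<close> can cover infinitely many vertices, which is why a unit there does not
  bound the number of hereditary saturated sets.

  A formal obstacle shapes the development. The algebras are non-unital quotients of free algebras,
  and the ideals to divide by vary, whereas the computations are best done with equations in a ring.
  So an ideal is first extended to the whole free unital ring, and the quotient is then realised by
  linear endomorphisms of one fixed space. The locales below therefore speak about elements of an
  arbitrary ring that satisfy the relations.\<close>

locale leavitt_quotient = wf_digraph E
  for E :: "('w, 'f) pre_digraph" +
  fixes \<kappa> :: "'k::field \<Rightarrow> 'r::ring_1"
    and p :: "'w \<Rightarrow> 'r"
    and s t :: "'f \<Rightarrow> 'r"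
  assumes kappa_add: "\<kappa> (a + b) = \<kappa> a + \<kappa> b"
    and kappa_mult: "\<kappa> (a * b) = \<kappa> a * \<kappa> b"
    and kappa_one [simp]: "\<kappa> 1 = 1"
    and kappa_comm: "\<kappa> a * x = x * \<kappa> a"
    and finite_verts: "finite (verts E)"
    and p_p: "v \<in> verts E \<Longrightarrow> w \<in> verts E \<Longrightarrow> p v * p w = (if v = w then p v else 0)"
    and p_s [simp]: "e \<in> arcs E \<Longrightarrow> p (tail E e) * s e = s e"
    and s_p [simp]: "e \<in> arcs E \<Longrightarrow> s e * p (head E e) = s e"
    and p_t [simp]: "e \<in> arcs E \<Longrightarrow> p (head E e) * t e = t e"
    and t_p [simp]: "e \<in> arcs E \<Longrightarrow> t e * p (tail E e) = t e"
    and t_s: "e \<in> arcs E \<Longrightarrow> f \<in> arcs E \<Longrightarrow> t e * s f = (if e = f then p (head E e) else 0)"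
begin

lemma kappa_zero [simp]: "\<kappa> 0 = 0"
  using kappa_add[of 0 0] by simp

lemma kappa_uminus: "\<kappa> (- a) = - \<kappa> a"
  using kappa_add[of a "- a"] by (simp add: eq_neg_iff_add_eq_0 add.commute)

lemma kappa_left: "x * (\<kappa> a * y) = \<kappa> a * (x * y)"
  by (metis kappa_comm mult.assoc)

lemma kappa_inverse: "a \<noteq> 0 \<Longrightarrow> \<kappa> (inverse a) * (\<kappa> a * x) = x"
  by (simp flip: kappa_mult mult.assoc)

declare awalk_append_iff [simp del]

lemma awalk_appendE:
  assumes "awalk u (\<alpha> @ \<beta>) w"
  obtains v where "awalk u \<alpha> v" "awalk v \<beta> w"
  using assms awalk_append_iff by blast

lemma p_p_same [simp]: "v \<in> verts E \<Longrightarrow> p v * p v = p v"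
  by (simp add: p_p)

text \<open>The end vertex is an argument so that the empty walk stands for the idempotent
  \<open>p w\<close> and not for \<open>1\<close>. The ghost is the adjoint of the path, hence the
  reversed order.\<close>

primrec path :: "'f list \<Rightarrow> 'w \<Rightarrow> 'r" where
  "path [] w = p w"
| "path (e # \<alpha>) w = s e * path \<alpha> w"

primrec ghost :: "'w \<Rightarrow> 'f list \<Rightarrow> 'r" where
  "ghost w [] = p w"
| "ghost w (e # \<beta>) = ghost w \<beta> * t e"

section \<open>Multiplication rules for paths and ghosts\<close>

lemma p_path: "awalk u \<alpha> w \<Longrightarrow> v \<in> verts E \<Longrightarrow> p v * path \<alpha> w = (if u = v then path \<alpha> w else 0)"
proof (cases \<alpha>)
  case (Cons e \<beta>)
  assume a: "awalk u \<alpha> w" and v: "v \<in> verts E"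
  then have e: "e \<in> arcs E" "u = tail E e"
    by (auto simp: Cons awalk_Cons_iff)
  have "p v * s e = p v * (p u * s e)" using e by simp
  also have "\<dots> = (p v * p u) * s e" by (simp add: mult.assoc)
  also have "\<dots> = (if u = v then s e else 0)"
    using p_p[OF v, of u] e by auto
  finally show ?thesis by (auto simp: Cons simp flip: mult.assoc)
qed (auto simp: awalk_Nil_iff p_p)

lemma path_p: "awalk u \<alpha> w \<Longrightarrow> v \<in> verts E \<Longrightarrow> path \<alpha> w * p v = (if w = v then path \<alpha> w else 0)"
proof (induction \<alpha> arbitrary: u)
  case (Cons e \<beta>)
  then show ?case by (auto simp: awalk_Cons_iff mult.assoc split: if_splits)
qed (auto simp: awalk_Nil_iff p_p)

lemma ghost_p: "awalk u \<alpha> w \<Longrightarrow> v \<in> verts E \<Longrightarrow> ghost w \<alpha> * p v = (if u = v then ghost w \<alpha> else 0)"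
proof (cases \<alpha>)
  case (Cons e \<beta>)
  assume a: "awalk u \<alpha> w" and v: "v \<in> verts E"
  then have e: "e \<in> arcs E" "u = tail E e"
    by (auto simp: Cons awalk_Cons_iff)
  have "t e * p v = t e * p u * p v" using e by simp
  also have "\<dots> = t e * (p u * p v)" by (simp add: mult.assoc)
  also have "\<dots> = (if u = v then t e else 0)"
    using p_p[OF _ v, of u] e by auto
  finally show ?thesis by (auto simp: Cons mult.assoc)
qed (auto simp: awalk_Nil_iff p_p)

lemma p_ghost: "awalk u \<alpha> w \<Longrightarrow> v \<in> verts E \<Longrightarrow> p v * ghost w \<alpha> = (if w = v then ghost w \<alpha> else 0)"
proof (induction \<alpha> arbitrary: u)
  case (Cons e \<beta>)
  then show ?case by (auto simp: awalk_Cons_iff simp flip: mult.assoc split: if_splits)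
qed (auto simp: awalk_Nil_iff p_p)

lemma path_append: "awalk u \<alpha> v \<Longrightarrow> awalk v \<beta> w \<Longrightarrow> path \<alpha> v * path \<beta> w = path (\<alpha> @ \<beta>) w"
proof (induction \<alpha> arbitrary: u)
  case Nil
  then show ?case using p_path[of v \<beta> w v] by (auto simp: awalk_Nil_iff)
qed (auto simp: awalk_Cons_iff mult.assoc)

lemma ghost_append: "awalk u \<alpha> v \<Longrightarrow> awalk v \<beta> w \<Longrightarrow> ghost w \<beta> * ghost v \<alpha> = ghost w (\<alpha> @ \<beta>)"
proof (induction \<alpha> arbitrary: u)
  case Nil
  then show ?case using ghost_p[of v \<beta> w v] by (auto simp: awalk_Nil_iff)
next
  case (Cons e \<alpha>)
  then show ?case by (auto simp: awalk_Cons_iff simp flip: mult.assoc)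
qed

lemma ghost_path: "awalk u \<alpha> v \<Longrightarrow> awalk v \<beta> w \<Longrightarrow> ghost v \<alpha> * path (\<alpha> @ \<beta>) w = path \<beta> w"
proof (induction \<alpha> arbitrary: u)
  case Nil
  then show ?case using p_path[of v \<beta> w v] by (auto simp: awalk_Nil_iff)
next
  case (Cons e \<alpha>)
  have "awalk (head E e) (\<alpha> @ \<beta>) w" "e \<in> arcs E"
    using Cons.prems by (auto simp: awalk_Cons_iff intro: awalk_appendI)
  then have "t e * (s e * path (\<alpha> @ \<beta>) w) = path (\<alpha> @ \<beta>) w"
    by (simp add: t_s p_path flip: mult.assoc)
  then show ?case using Cons by (auto simp: mult.assoc awalk_Cons_iff)
qed

lemma ghost_path_self: "awalk u \<alpha> v \<Longrightarrow> ghost v \<alpha> * path \<alpha> v = p v"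
  using ghost_path[of u \<alpha> v "[]" v] by (auto simp: awalk_Nil_iff)

text \<open>After the common part is cancelled, \<open>t e * s f\<close> with
  \<open>e \<noteq> f\<close> appears.\<close>

lemma ghost_path_parallel:
  "awalk u \<alpha> v \<Longrightarrow> awalk u' \<beta> w \<Longrightarrow> \<alpha> \<parallel> \<beta> \<Longrightarrow> ghost v \<alpha> * path \<beta> w = 0"
proof (induction \<alpha> arbitrary: u u' \<beta>)
  case (Cons e \<alpha>)
  then obtain f \<beta>' where \<beta>: "\<beta> = f # \<beta>'" by (cases \<beta>) auto
  have ef: "e \<in> arcs E" "f \<in> arcs E" "awalk (head E e) \<alpha> v" "awalk (head E f) \<beta>' w"
    using Cons.prems \<beta> by (auto simp: awalk_Cons_iff)
  have *: "ghost v (e # \<alpha>) * path \<beta> w = ghost v \<alpha> * (t e * s f * path \<beta>' w)"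
    by (simp add: \<beta> mult.assoc)
  show ?case
  proof (cases "e = f")
    case True
    then have "t e * s f * path \<beta>' w = path \<beta>' w"
      using ef by (simp add: t_s p_path)
    moreover have "\<alpha> \<parallel> \<beta>'" using Cons.prems(3) True \<beta> by (auto simp: parallel_def)
    ultimately show ?thesis using Cons.IH ef * by simp
  next
    case False
    then show ?thesis using * ef by (simp add: t_s)
  qed
qed auto

lemma t_path: "e \<in> arcs E \<Longrightarrow> awalk u (f # \<alpha>) w \<Longrightarrow> t e * path (f # \<alpha>) w = (if e = f then path \<alpha> w else 0)"
  by (auto simp: t_s p_path awalk_Cons_iff simp flip: mult.assoc)

lemma ghost_s: "e \<in> arcs E \<Longrightarrow> awalk u (f # \<alpha>) w \<Longrightarrow> ghost w (f # \<alpha>) * s e = (if e = f then ghost w \<alpha> else 0)"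
  by (auto simp: t_s ghost_p awalk_Cons_iff mult.assoc)

text \<open>The ring \<open>'r\<close> is larger than the algebra under study (it will consist of
  all linear endomorphisms of a space), so the subalgebra generated by the letters has to be
  named.\<close>

inductive_set alg :: "'r set" where
  alg_zero [simp, intro]: "0 \<in> alg"
| alg_p [simp, intro]: "v \<in> verts E \<Longrightarrow> p v \<in> alg"
| alg_s [simp, intro]: "e \<in> arcs E \<Longrightarrow> s e \<in> alg"
| alg_t [simp, intro]: "e \<in> arcs E \<Longrightarrow> t e \<in> alg"
| alg_add [intro]: "x \<in> alg \<Longrightarrow> y \<in> alg \<Longrightarrow> x + y \<in> alg"
| alg_mult [intro]: "x \<in> alg \<Longrightarrow> y \<in> alg \<Longrightarrow> x * y \<in> alg"
| alg_scale [intro]: "x \<in> alg \<Longrightarrow> \<kappa> a * x \<in> alg"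

lemma alg_sum: "(\<And>i. i \<in> M \<Longrightarrow> f i \<in> alg) \<Longrightarrow> sum f M \<in> alg"
  by (induction M rule: infinite_finite_induct) auto

lemma alg_uminus: "x \<in> alg \<Longrightarrow> - x \<in> alg"
  using alg_scale[of x "- 1"] by (simp add: kappa_uminus)

lemma alg_diff: "x \<in> alg \<Longrightarrow> y \<in> alg \<Longrightarrow> x - y \<in> alg"
  using alg_add[of x "- y"] alg_uminus by simp

lemma alg_path: "awalk u \<alpha> w \<Longrightarrow> path \<alpha> w \<in> alg"
  by (induction \<alpha> arbitrary: u) (auto simp: awalk_simps)

lemma alg_ghost: "awalk u \<alpha> w \<Longrightarrow> ghost w \<alpha> \<in> alg"
  by (induction \<alpha> arbitrary: u) (auto simp: awalk_simps)

section \<open>The sum of the vertices as a unit, and spanning monomials\<close>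

definition unit_elt :: 'r where "unit_elt = (\<Sum>v\<in>verts E. p v)"

lemma p_mult_unit: "v \<in> verts E \<Longrightarrow> p v * unit_elt = p v"
  by (simp add: unit_elt_def sum_distrib_left p_p finite_verts cong: sum.cong)

lemma mult_unit: "x \<in> alg \<Longrightarrow> x * unit_elt = x"
proof (induction rule: alg.induct)
  case (alg_s e)
  then show ?case using p_mult_unit[of "head E e"] by (metis s_p mult.assoc head_in_verts)
next
  case (alg_t e)
  then show ?case using p_mult_unit[of "tail E e"] by (metis t_p mult.assoc tail_in_verts)
qed (auto simp: p_mult_unit distrib_right mult.assoc)

lemma mult_p_decomp: "x \<in> alg \<Longrightarrow> x = (\<Sum>v\<in>verts E. x * p v)"
  using mult_unit by (simp add: unit_elt_def sum_distrib_left)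

text \<open>The span of the monomials \<open>\<alpha> \<beta>*\<close>, filtered by ghost length;
  the bound \<open>n\<close> is the induction measure in \<open>reduction\<close>.\<close>

inductive_set ghost_span :: "nat \<Rightarrow> 'r set" for n where
  zero: "0 \<in> ghost_span n"
| monom: "awalk u \<alpha> w \<Longrightarrow> awalk u' \<beta> w \<Longrightarrow> length \<beta> \<le> n \<Longrightarrow> path \<alpha> w * ghost w \<beta> \<in> ghost_span n"
| add: "x \<in> ghost_span n \<Longrightarrow> y \<in> ghost_span n \<Longrightarrow> x + y \<in> ghost_span n"
| scale: "x \<in> ghost_span n \<Longrightarrow> \<kappa> a * x \<in> ghost_span n"

lemma ghost_span_mono: "x \<in> ghost_span m \<Longrightarrow> m \<le> n \<Longrightarrow> x \<in> ghost_span n"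
  by (induction rule: ghost_span.induct) (auto intro: ghost_span.intros)

lemma ghost_span_p_left: "x \<in> ghost_span n \<Longrightarrow> v \<in> verts E \<Longrightarrow> p v * x \<in> ghost_span n"
  by (induction rule: ghost_span.induct)
    (auto simp: p_path distrib_left kappa_left simp flip: mult.assoc[of "p v" "path _ _"] intro: ghost_span.intros)

end

context leavitt_quotient begin

lemma ghost_span_s_left:
  assumes "x \<in> ghost_span n" "e \<in> arcs E"
  shows "s e * x \<in> ghost_span n"
  using assms(1)
proof (induction rule: ghost_span.induct)
  case (monom u \<alpha> w u' \<beta>)
  have *: "s e * (path \<alpha> w * ghost w \<beta>) = s e * (p (head E e) * path \<alpha> w) * ghost w \<beta>"
    using assms(2) by (simp flip: mult.assoc)
  show ?case
  proof (cases "u = head E e")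
    case True
    then have "awalk (tail E e) (e # \<alpha>) w"
      using monom assms(2) by (simp add: awalk_Cons_iff)
    from ghost_span.monom[OF this monom(2,3)] show ?thesis by (simp add: mult.assoc)
  next
    case False
    then show ?thesis using * monom assms(2) by (simp add: p_path ghost_span.zero)
  qed
qed (auto simp: distrib_left kappa_left intro: ghost_span.intros)

lemma ghost_span_t_left:
  assumes "x \<in> ghost_span n" "e \<in> arcs E"
  shows "t e * x \<in> ghost_span (Suc n)"
  using assms(1)
proof (induction rule: ghost_span.induct)
  case (monom u \<alpha> w u' \<beta>)
  show ?case
  proof (cases \<alpha>)
    \<comment> \<open>With no edge left to cancel, \<open>t e\<close> joins the ghost part; this is
      why the bound rises to \<open>Suc n\<close>.\<close>
    case Nil
    have w: "w \<in> verts E" using monom(2) by auto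
    have *: "t e * (path \<alpha> w * ghost w \<beta>) = t e * (p (tail E e) * p w) * ghost w \<beta>"
      using Nil w monom assms(2) by (simp flip: mult.assoc)
    show ?thesis
    proof (cases "w = tail E e")
      case True
      have "awalk w [e] (head E e)" using True assms(2) by (simp add: arc_implies_awalk)
      then have b: "awalk u' (\<beta> @ [e]) (head E e)" "ghost (head E e) (\<beta> @ [e]) = t e * ghost w \<beta>"
        using monom(2) ghost_append[OF monom(2), of "[e]" "head E e"] assms(2)
        by (auto intro: awalk_appendI)
      have h: "awalk (head E e) [] (head E e)" using assms(2) by (simp add: awalk_Nil_iff)
      have "path [] (head E e) * ghost (head E e) (\<beta> @ [e]) = t e * (path \<alpha> w * ghost w \<beta>)"
        unfolding * using b p_ghost[OF b(1), of "head E e"] assms(2) True w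
        by (simp add: mult.assoc)
      moreover have "path [] (head E e) * ghost (head E e) (\<beta> @ [e]) \<in> ghost_span (Suc n)"
        by (rule ghost_span.monom[OF h b(1)]) (use monom in simp)
      ultimately show ?thesis by simp
    next
      case False
      then have "t e * (path \<alpha> w * ghost w \<beta>) = 0"
        unfolding * using w assms(2) by (simp add: p_p)
      then show ?thesis by (simp add: ghost_span.zero)
    qed
  next
    case (Cons f \<alpha>')
    have "t e * (path \<alpha> w * ghost w \<beta>) = (if e = f then path \<alpha>' w * ghost w \<beta> else 0)"
      using t_path[OF assms(2)] monom(1) Cons by (simp flip: mult.assoc)
    then show ?thesis using monom Cons
      by (auto simp: awalk_Cons_iff intro!: ghost_span.zero ghost_span.monom)
  qed
qed (auto simp: distrib_left kappa_left intro: ghost_span.intros)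

text \<open>Induction on the left factor replaces a multiplication table for monomials: each letter
  sends a monomial to a monomial or to zero. Applied to \<open>unit_elt\<close> it shows that the
  monomials span \<open>alg\<close>.\<close>

lemma alg_mult_ghost_span: "x \<in> alg \<Longrightarrow> y \<in> ghost_span n \<Longrightarrow> \<exists>m. x * y \<in> ghost_span m"
proof (induction arbitrary: y n rule: alg.induct)
  case (alg_add x1 x2)
  then obtain m1 m2 where "x1 * y \<in> ghost_span m1" "x2 * y \<in> ghost_span m2" by blast
  then have "x1 * y + x2 * y \<in> ghost_span (max m1 m2)"
    by (meson ghost_span.add ghost_span_mono max.cobounded1 max.cobounded2)
  then show ?case by (auto simp: distrib_right)
next
  case (alg_mult x1 x2)
  then show ?case by (metis mult.assoc)
next
  case (alg_scale x a)
  then show ?case by (metis mult.assoc ghost_span.scale)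
qed (auto intro: ghost_span.zero ghost_span_p_left ghost_span_s_left ghost_span_t_left)

lemma ghost_span_sum: "(\<And>i. i \<in> M \<Longrightarrow> f i \<in> ghost_span n) \<Longrightarrow> sum f M \<in> ghost_span n"
  by (induction M rule: infinite_finite_induct) (auto intro: ghost_span.intros)

lemma p_in_ghost_span: "v \<in> verts E \<Longrightarrow> p v \<in> ghost_span 0"
  using ghost_span.monom[of v "[]" v v "[]" 0] by (simp add: awalk_Nil_iff)

lemma alg_ghost_span: "x \<in> alg \<Longrightarrow> \<exists>n. x \<in> ghost_span n"
  using alg_mult_ghost_span[of x unit_elt 0] mult_unit[of x] ghost_span_sum[of "verts E" p 0]
    p_in_ghost_span by (simp add: unit_elt_def)

text \<open>An edge on the right strips one ghost edge, or lengthens the path when there is none;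
  hence the truncated \<open>n - 1\<close>, which stays \<open>0\<close> at
  \<open>0\<close>.\<close>

lemma ghost_span_s_right:
  assumes "x \<in> ghost_span n" "e \<in> arcs E"
  shows "x * s e \<in> ghost_span (n - 1)"
  using assms(1)
proof (induction rule: ghost_span.induct)
  case (monom u \<alpha> w u' \<beta>)
  show ?case
  proof (cases \<beta>)
    case Nil
    have w: "w \<in> verts E" using monom(2) by auto
    have *: "path \<alpha> w * ghost w \<beta> * s e = path \<alpha> w * (p w * p (tail E e)) * s e"
      using Nil assms(2) by (simp add: mult.assoc)
    show ?thesis
    proof (cases "w = tail E e")
      case True
      have "awalk w [e] (head E e)" using True assms(2) by (simp add: arc_implies_awalk)
      then have b: "awalk u (\<alpha> @ [e]) (head E e)" "path (\<alpha> @ [e]) (head E e) = path \<alpha> w * s e"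
        using monom(1) path_append[OF monom(1), of "[e]" "head E e"] assms(2)
        by (auto intro: awalk_appendI)
      have h: "awalk (head E e) [] (head E e)" using assms(2) by (simp add: awalk_Nil_iff)
      have "path (\<alpha> @ [e]) (head E e) * ghost (head E e) [] = path \<alpha> w * ghost w \<beta> * s e"
        unfolding * using b path_p[OF b(1), of "head E e"] path_p[OF monom(1) w] assms(2) True w
        by (simp add: mult.assoc)
      moreover have "path (\<alpha> @ [e]) (head E e) * ghost (head E e) [] \<in> ghost_span (n - 1)"
        by (rule ghost_span.monom[OF b(1) h]) simp
      ultimately show ?thesis by simp
    next
      case False
      then have "path \<alpha> w * ghost w \<beta> * s e = 0"
        unfolding * using w assms(2) by (simp add: p_p)
      then show ?thesis by (simp add: ghost_span.zero)
    qed
  next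
    case (Cons f \<beta>')
    have "path \<alpha> w * ghost w \<beta> * s e = (if e = f then path \<alpha> w * ghost w \<beta>' else 0)"
      using ghost_s[OF assms(2)] monom(2) Cons by (simp add: mult.assoc)
    then show ?thesis using monom Cons
      by (auto simp: awalk_Cons_iff intro!: ghost_span.zero ghost_span.monom)
  qed
qed (auto simp: distrib_right mult.assoc intro: ghost_span.intros)

text \<open>The coefficients vanish outside \<open>C\<close> so that two expansions can be added
  over the union of their index sets.\<close>

lemma ghost_span_0_mult_p:
  assumes "x \<in> ghost_span 0" "v \<in> verts E"
  shows "\<exists>C k. finite C \<and> (\<forall>\<alpha>\<in>C. \<exists>u. awalk u \<alpha> v) \<and> (\<forall>\<alpha>. \<alpha> \<notin> C \<longrightarrow> k \<alpha> = 0) \<and>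
    x * p v = (\<Sum>\<alpha>\<in>C. \<kappa> (k \<alpha>) * path \<alpha> v)"
  using assms(1)
proof (induction rule: ghost_span.induct)
  case zero
  show ?case by (intro exI[of _ "{}"] exI[of _ "\<lambda>_. 0"]) simp
next
  case (monom u \<alpha> w u' \<beta>)
  have w: "w \<in> verts E" using monom(2) by auto
  have *: "path \<alpha> w * ghost w \<beta> * p v = (if w = v then path \<alpha> w else 0)"
    using monom path_p[OF monom(1) w] path_p[OF monom(1) assms(2)] by simp
  show ?case
  proof (cases "w = v")
    case True
    then show ?thesis unfolding * using monom
      by (intro exI[of _ "{\<alpha>}"] exI[of _ "\<lambda>\<beta>. if \<beta> = \<alpha> then 1 else 0"]) auto
  next
    case False
    then show ?thesis unfolding * by (intro exI[of _ "{}"] exI[of _ "\<lambda>_. 0"]) simp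
  qed
next
  case (add x y)
  from add.IH(1) obtain C k where C: "finite C" "\<forall>\<alpha>\<in>C. \<exists>u. awalk u \<alpha> v"
    "\<forall>\<alpha>. \<alpha> \<notin> C \<longrightarrow> k \<alpha> = 0" "x * p v = (\<Sum>\<alpha>\<in>C. \<kappa> (k \<alpha>) * path \<alpha> v)"
    by blast
  from add.IH(2) obtain C' k' where C': "finite C'" "\<forall>\<alpha>\<in>C'. \<exists>u. awalk u \<alpha> v"
    "\<forall>\<alpha>. \<alpha> \<notin> C' \<longrightarrow> k' \<alpha> = 0" "y * p v = (\<Sum>\<alpha>\<in>C'. \<kappa> (k' \<alpha>) * path \<alpha> v)"
    by blast
  have "x * p v = (\<Sum>\<alpha>\<in>C \<union> C'. \<kappa> (k \<alpha>) * path \<alpha> v)"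
    unfolding C(4) using C C' by (intro sum.mono_neutral_left) auto
  moreover have "y * p v = (\<Sum>\<alpha>\<in>C \<union> C'. \<kappa> (k' \<alpha>) * path \<alpha> v)"
    unfolding C'(4) using C C' by (intro sum.mono_neutral_left) auto
  ultimately have "(x + y) * p v = (\<Sum>\<alpha>\<in>C \<union> C'. \<kappa> (k \<alpha> + k' \<alpha>) * path \<alpha> v)"
    by (simp add: distrib_right sum.distrib kappa_add)
  moreover have "finite (C \<union> C')" "\<forall>\<alpha>\<in>C \<union> C'. \<exists>u. awalk u \<alpha> v"
    "\<forall>\<alpha>. \<alpha> \<notin> C \<union> C' \<longrightarrow> k \<alpha> + k' \<alpha> = 0"
    using C(1-3) C'(1-3) by auto
  ultimately show ?case by (intro exI conjI)
next
  case (scale x a)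
  then obtain C k where C: "finite C" "\<forall>\<alpha>\<in>C. \<exists>u. awalk u \<alpha> v" "\<forall>\<alpha>. \<alpha> \<notin> C \<longrightarrow> k \<alpha> = 0"
    "x * p v = (\<Sum>\<alpha>\<in>C. \<kappa> (k \<alpha>) * path \<alpha> v)" by metis
  have "\<kappa> a * x * p v = (\<Sum>\<alpha>\<in>C. \<kappa> (a * k \<alpha>) * path \<alpha> v)"
    by (simp add: C(4) mult.assoc sum_distrib_left kappa_mult)
  then show ?case using C by (intro exI[of _ C] exI[of _ "\<lambda>\<alpha>. a * k \<alpha>"]) auto
qed

section \<open>Monic elements \<open>v + \<Sum> k\<^sub>i \<gamma>\<^sub>i\<close>, and cuts at a
  vertex\<close>

definition closed_walks :: "'w \<Rightarrow> 'f list set" where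
  "closed_walks v = {\<gamma>. \<gamma> \<noteq> [] \<and> awalk v \<gamma> v}"

definition monic_elt :: "'w \<Rightarrow> 'f list set \<Rightarrow> ('f list \<Rightarrow> 'k) \<Rightarrow> 'r" where
  "monic_elt v C k = p v + (\<Sum>\<gamma>\<in>C. \<kappa> (k \<gamma>) * path \<gamma> v)"

text \<open>The hypothesis on lengths rules out that \<open>\<beta>\<close> is a prefix of
  \<open>\<alpha>\<close>, so no ghost edge survives: what is left of \<open>\<beta>\<close> is a
  closed walk at \<open>w\<close> or is killed.\<close>

lemma ghost_mult_path:
  assumes \<alpha>: "awalk u \<alpha> w" and \<beta>: "awalk u' \<beta> w"
    and len: "length \<alpha> < length \<beta> \<or> \<beta> \<parallel> \<alpha>"
  shows "(\<exists>\<gamma> \<in> closed_walks w. \<beta> = \<alpha> @ \<gamma> \<and> ghost w \<alpha> * path \<beta> w = path \<gamma> w) \<or>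
    (\<forall>\<gamma> \<in> closed_walks w. \<beta> \<noteq> \<alpha> @ \<gamma>) \<and> ghost w \<alpha> * path \<beta> w = 0"
proof (cases "\<alpha> \<parallel> \<beta>")
  case True
  then show ?thesis using ghost_path_parallel[OF \<alpha> \<beta>] by auto
next
  case False
  then have "prefix \<alpha> \<beta>"
    using len by (auto simp: parallel_def prefix_def)
  then obtain \<gamma> where \<gamma>: "\<beta> = \<alpha> @ \<gamma>" by (auto simp: prefix_def)
  with len have \<gamma>0: "\<gamma> \<noteq> []" by auto
  obtain v where v: "awalk u' \<alpha> v" "awalk v \<gamma> w" using \<gamma> \<beta> by (auto elim: awalk_appendE)
  show ?thesis
  proof (cases "v = w")
    case True
    then show ?thesis using ghost_path[OF \<alpha>, of \<gamma> w] \<gamma> \<gamma>0 v by (auto simp: closed_walks_def)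
  next
    case False
    \<comment> \<open>The vertex reached by \<open>\<alpha>\<close> is determined unless
      \<open>\<alpha>\<close> is empty. Then the ghost is \<open>p w\<close>, which kills a walk
      that starts at another vertex.\<close>
    with awalk_ends[OF v(1) \<alpha>] have "\<alpha> = []" by auto
    moreover have "w \<in> verts E" "v \<in> verts E" using v by auto
    moreover have "\<not> awalk w \<gamma> w" using awalk_ends[OF v(2)] False \<gamma>0 by auto
    ultimately show ?thesis
      using False v p_path[OF v(2), of w] \<gamma> by (auto simp: closed_walks_def)
  qed
qed

lemma ghost_mult_path_sum:
  assumes \<alpha>: "awalk u \<alpha> w" and C: "finite C" "\<And>\<beta>. \<beta> \<in> C \<Longrightarrow> \<exists>u. awalk u \<beta> w"
    and len: "\<And>\<beta>. \<beta> \<in> C \<Longrightarrow> length \<alpha> < length \<beta> \<or> \<beta> \<parallel> \<alpha>"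
  shows "ghost w \<alpha> * (\<Sum>\<beta>\<in>C. \<kappa> (k \<beta>) * path \<beta> w) =
    (\<Sum>\<gamma>\<in>{\<gamma> \<in> closed_walks w. \<alpha> @ \<gamma> \<in> C}. \<kappa> (k (\<alpha> @ \<gamma>)) * path \<gamma> w)"
proof -
  define D where "D = {\<gamma> \<in> closed_walks w. \<alpha> @ \<gamma> \<in> C}"
  have D: "(@) \<alpha> ` D \<subseteq> C" "inj_on ((@) \<alpha>) D" by (auto simp: D_def inj_on_def)
  have a: "ghost w \<alpha> * path \<beta> w = 0" if "\<beta> \<in> C - (@) \<alpha> ` D" for \<beta>
    using ghost_mult_path[OF \<alpha> _ len] C(2) that unfolding D_def by blast
  have b: "ghost w \<alpha> * path (\<alpha> @ \<gamma>) w = path \<gamma> w" if "\<gamma> \<in> D" for \<gamma>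
  proof -
    have "\<alpha> @ \<gamma> \<in> C" using that by (simp add: D_def)
    then obtain u' where "awalk u' (\<alpha> @ \<gamma>) w" using C(2) by blast
    from ghost_mult_path[OF \<alpha> this len] that \<open>\<alpha> @ \<gamma> \<in> C\<close> show ?thesis unfolding D_def by auto
  qed
  have "ghost w \<alpha> * (\<Sum>\<beta>\<in>C. \<kappa> (k \<beta>) * path \<beta> w) = (\<Sum>\<beta>\<in>C. \<kappa> (k \<beta>) * (ghost w \<alpha> * path \<beta> w))"
    by (simp add: sum_distrib_left kappa_left)
  also have "\<dots> = (\<Sum>\<beta>\<in>(@) \<alpha> ` D. \<kappa> (k \<beta>) * (ghost w \<alpha> * path \<beta> w))"
    using C(1) D(1) a by (intro sum.mono_neutral_right) auto
  also have "\<dots> = (\<Sum>\<gamma>\<in>D. \<kappa> (k (\<alpha> @ \<gamma>)) * (ghost w \<alpha> * path (\<alpha> @ \<gamma>) w))"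
    by (rule sum.reindex[OF D(2), unfolded comp_def])
  also have "\<dots> = (\<Sum>\<gamma>\<in>D. \<kappa> (k (\<alpha> @ \<gamma>)) * path \<gamma> w)"
    by (intro sum.cong) (simp_all add: b)
  finally show ?thesis by (simp add: D_def)
qed

text \<open>Among the walks with non-zero coefficient take a shortest one, \<open>\<alpha>\<close>.
  No other is a prefix of it, so its ghost turns the term of \<open>\<alpha>\<close> into a multiple
  of \<open>p v\<close> and every other term into a closed walk or zero.\<close>

lemma leading_walk:
  assumes x: "x \<in> ghost_span 0" and v: "v \<in> verts E" and nz: "x * p v \<noteq> 0"
  shows "\<exists>y\<in>alg. \<exists>C k. finite C \<and> C \<subseteq> closed_walks v \<and> y * x * p v = monic_elt v C k"
proof -
  obtain C0 k where C0: "finite C0" "\<forall>\<alpha>\<in>C0. \<exists>u. awalk u \<alpha> v"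
    "x * p v = (\<Sum>\<alpha>\<in>C0. \<kappa> (k \<alpha>) * path \<alpha> v)"
    using ghost_span_0_mult_p[OF x v] by blast
  define C where "C = {\<alpha> \<in> C0. k \<alpha> \<noteq> 0}"
  have C: "finite C" "\<And>\<alpha>. \<alpha> \<in> C \<Longrightarrow> \<exists>u. awalk u \<alpha> v" "\<And>\<alpha>. \<alpha> \<in> C \<Longrightarrow> k \<alpha> \<noteq> 0"
    "x * p v = (\<Sum>\<alpha>\<in>C. \<kappa> (k \<alpha>) * path \<alpha> v)"
    using C0 unfolding C_def by (auto intro!: sum.mono_neutral_right)
  have "C \<noteq> {}" using C(4) nz by auto
  then obtain \<alpha> where \<alpha>: "\<alpha> \<in> C" "\<And>\<beta>. \<beta> \<in> C \<Longrightarrow> length \<alpha> \<le> length \<beta>"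
    using ex_min_if_finite[of "length ` C"] C(1) by (metis arg_min_least arg_min_if_finite(1))
  obtain u where u: "awalk u \<alpha> v" using C(2) \<alpha>(1) by blast
  define y where "y = \<kappa> (inverse (k \<alpha>)) * ghost v \<alpha>"
  define D where "D = {\<gamma> \<in> closed_walks v. \<alpha> @ \<gamma> \<in> C - {\<alpha>}}"
  have "finite D"
    by (rule finite_subset[OF _ finite_vimageI[OF C(1), of "(@) \<alpha>"]]) (auto simp: D_def inj_on_def)
  have len: "length \<alpha> < length \<beta> \<or> \<beta> \<parallel> \<alpha>" if "\<beta> \<in> C - {\<alpha>}" for \<beta>
    using \<alpha>(2)[of \<beta>] that by (auto simp: parallel_def prefix_def)
  have "y * x * p v = \<kappa> (inverse (k \<alpha>)) * (ghost v \<alpha> * (x * p v))"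
    by (simp add: y_def mult.assoc)
  also have "x * p v = \<kappa> (k \<alpha>) * path \<alpha> v + (\<Sum>\<beta>\<in>C - {\<alpha>}. \<kappa> (k \<beta>) * path \<beta> v)"
    using C(1,4) \<alpha>(1) by (simp add: sum.remove)
  also have "ghost v \<alpha> * \<dots> = \<kappa> (k \<alpha>) * p v + ghost v \<alpha> * (\<Sum>\<beta>\<in>C - {\<alpha>}. \<kappa> (k \<beta>) * path \<beta> v)"
    by (simp add: distrib_left kappa_left ghost_path_self[OF u])
  also have "ghost v \<alpha> * (\<Sum>\<beta>\<in>C - {\<alpha>}. \<kappa> (k \<beta>) * path \<beta> v) = (\<Sum>\<gamma>\<in>D. \<kappa> (k (\<alpha> @ \<gamma>)) * path \<gamma> v)"
    unfolding D_def using C len by (intro ghost_mult_path_sum[OF u]) auto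
  also have "\<kappa> (inverse (k \<alpha>)) * (\<kappa> (k \<alpha>) * p v + \<dots>) =
    monic_elt v D (\<lambda>\<gamma>. inverse (k \<alpha>) * k (\<alpha> @ \<gamma>))"
    using C(3)[OF \<alpha>(1)]
    by (simp add: monic_elt_def distrib_left kappa_inverse sum_distrib_left kappa_mult mult.assoc)
  finally show ?thesis
    using \<open>finite D\<close> alg_ghost[OF u] by (intro bexI[of _ y]) (auto simp: D_def y_def)
qed

text \<open>\<open>cut v (out_arcs E v) = 0\<close> is the relation at a regular vertex. For finite
  \<open>F\<close> among the edges from \<open>v\<close>, the cut is the part of \<open>p v\<close>
  orthogonal to all \<open>s e * t e\<close> with \<open>e \<in> F\<close>.\<close>

definition cut :: "'w \<Rightarrow> 'f set \<Rightarrow> 'r" where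
  "cut v F = p v - (\<Sum>e\<in>F. s e * t e)"

lemma
  assumes "v \<in> verts E" "finite F" "F \<subseteq> out_arcs E v"
  shows alg_cut: "cut v F \<in> alg"
    and p_cut: "p v * cut v F = cut v F"
    and cut_p: "cut v F * p v = cut v F"
    and cut_s: "e \<in> F \<Longrightarrow> cut v F * s e = 0"
    and t_cut: "e \<in> F \<Longrightarrow> t e * cut v F = 0"
proof -
  have F: "\<And>e. e \<in> F \<Longrightarrow> e \<in> arcs E \<and> tail E e = v" using assms by auto
  show "cut v F \<in> alg" using F assms(1) by (auto simp: cut_def intro!: alg_diff alg_sum)
  have "(\<Sum>e\<in>F. p v * (s e * t e)) = (\<Sum>e\<in>F. s e * t e)"
    using F by (intro sum.cong refl) (metis p_s mult.assoc)
  then show "p v * cut v F = cut v F"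
    using assms(1) by (simp add: cut_def right_diff_distrib sum_distrib_left)
  have "(\<Sum>e\<in>F. s e * t e * p v) = (\<Sum>e\<in>F. s e * t e)"
    using F by (intro sum.cong refl) (metis t_p mult.assoc)
  then show "cut v F * p v = cut v F"
    using assms(1) by (simp add: cut_def left_diff_distrib sum_distrib_right)
  assume e: "e \<in> F"
  have "(\<Sum>f\<in>F. s f * t f * s e) = (\<Sum>f\<in>F. if f = e then s e else 0)"
    using F e by (intro sum.cong) (auto simp: mult.assoc t_s)
  then show "cut v F * s e = 0"
    using F[OF e] e assms by (simp add: cut_def left_diff_distrib sum_distrib_right) (metis p_s)
  have "(\<Sum>f\<in>F. t e * (s f * t f)) = (\<Sum>f\<in>F. if f = e then t e else 0)"
    using F e by (intro sum.cong) (auto simp: t_s simp flip: mult.assoc)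
  then show "t e * cut v F = 0"
    using F[OF e] e assms by (simp add: cut_def right_diff_distrib sum_distrib_left) (metis t_p)
qed

text \<open>These idempotents decrease as the set of edges grows. So a given cut can be refined
  until it kills any given finite set of walks.\<close>

lemma cut_cut:
  assumes "v \<in> verts E" "finite F'" "F' \<subseteq> out_arcs E v" "F \<subseteq> F'"
  shows "cut v F * cut v F' = cut v F'" "cut v F' * cut v F = cut v F'"
proof -
  have "(\<Sum>e\<in>F. s e * t e * cut v F') = 0"
    using t_cut[OF assms(1,2,3)] assms(4) by (intro sum.neutral) (auto simp: mult.assoc)
  moreover have "(\<Sum>e\<in>F. s e * t e) * cut v F' = (\<Sum>e\<in>F. s e * t e * cut v F')"
    by (simp add: sum_distrib_right)
  ultimately show "cut v F * cut v F' = cut v F'"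
    using p_cut[OF assms(1,2,3)] by (simp add: cut_def[of v F] left_diff_distrib)
  have "(\<Sum>e\<in>F. cut v F' * (s e * t e)) = 0"
    using cut_s[OF assms(1,2,3)] assms(4) by (intro sum.neutral) (auto simp flip: mult.assoc)
  moreover have "cut v F' * (\<Sum>e\<in>F. s e * t e) = (\<Sum>e\<in>F. cut v F' * (s e * t e))"
    by (simp add: sum_distrib_left)
  ultimately show "cut v F' * cut v F = cut v F'"
    using cut_p[OF assms(1,2,3)] by (simp add: cut_def[of v F] right_diff_distrib)
qed

lemma cut_monic_elt:
  assumes "v \<in> verts E" "finite F" "F \<subseteq> out_arcs E v" "C \<subseteq> closed_walks v" "hd ` C \<subseteq> F"
  shows "cut v F * monic_elt v C k = cut v F"
proof -
  have "cut v F * path \<gamma> v = 0" if "\<gamma> \<in> C" for \<gamma>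
    using that assms(4,5) cut_s[OF assms(1-3), of "hd \<gamma>"]
    by (cases \<gamma>) (force simp: closed_walks_def simp flip: mult.assoc)+
  then show ?thesis
    by (simp add: monic_elt_def distrib_left sum_distrib_left kappa_left cut_p[OF assms(1-3)])
qed

lemma hd_closed_walks: "C \<subseteq> closed_walks v \<Longrightarrow> hd ` C \<subseteq> out_arcs E v"
proof
  fix e assume "C \<subseteq> closed_walks v" "e \<in> hd ` C"
  then obtain \<gamma> where "\<gamma> \<in> closed_walks v" "e = hd \<gamma>" by auto
  then show "e \<in> out_arcs E v" by (cases \<gamma>) (auto simp: closed_walks_def awalk_Cons_iff)
qed

text \<open>Multiplying by a cut that contains the first edges of all ghost parts annihilates every
  monomial with a non-trivial ghost part.\<close>

lemma ghost_span_mult_cut: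
  assumes "x \<in> ghost_span n" and v: "v \<in> verts E"
  shows "\<exists>y\<in>ghost_span 0. \<exists>F. finite F \<and> F \<subseteq> out_arcs E v \<and>
    (\<forall>F'. finite F' \<longrightarrow> F \<subseteq> F' \<longrightarrow> F' \<subseteq> out_arcs E v \<longrightarrow> x * cut v F' = y * cut v F')"
  using assms(1)
proof (induction rule: ghost_span.induct)
  case zero
  show ?case by (intro bexI[of _ 0] exI[of _ "{}"]) (auto intro: ghost_span.zero)
next
  case (monom u \<alpha> w u' \<beta>)
  show ?case
  proof (cases \<beta>)
    case Nil
    then have "path \<alpha> w * ghost w \<beta> \<in> ghost_span 0"
      using ghost_span.monom[OF monom(1,2), of 0] by simp
    then show ?thesis by (intro bexI exI[of _ "{}"]) auto
  next
    case (Cons e \<beta>')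
    have e: "e \<in> arcs E" using monom(2) Cons by (simp add: awalk_Cons_iff)
    \<comment> \<open>The witness has to stay inside \<open>out_arcs E v\<close>. If
      \<open>e\<close> starts elsewhere, the intersection is empty and \<open>t e * p v = 0\<close>
      does the work.\<close>
    have 0: "t e * cut v F' = 0"
      if F': "finite F'" "{e} \<inter> out_arcs E v \<subseteq> F'" "F' \<subseteq> out_arcs E v" for F'
    proof (cases "tail E e = v")
      case True
      then show ?thesis using t_cut[OF v F'(1,3)] F' e by auto
    next
      case False
      have "t e * cut v F' = t e * p (tail E e) * (p v * cut v F')"
        using e p_cut[OF v F'(1,3)] by simp
      also have "\<dots> = t e * (p (tail E e) * p v) * cut v F'" by (simp add: mult.assoc)
      also have "\<dots> = 0" using False v e by (simp add: p_p)
      finally show ?thesis .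
    qed
    then show ?thesis using Cons
      by (intro bexI[of _ 0] exI[of _ "{e} \<inter> out_arcs E v"])
        (auto simp: mult.assoc intro: ghost_span.zero)
  qed
next
  case (add x1 x2)
  from add.IH(1) obtain y1 F1 where
    1: "y1 \<in> ghost_span 0" "finite F1" "F1 \<subseteq> out_arcs E v"
    "\<And>F'. finite F' \<Longrightarrow> F1 \<subseteq> F' \<Longrightarrow> F' \<subseteq> out_arcs E v \<Longrightarrow> x1 * cut v F' = y1 * cut v F'"
    by blast
  from add.IH(2) obtain y2 F2 where
    2: "y2 \<in> ghost_span 0" "finite F2" "F2 \<subseteq> out_arcs E v"
    "\<And>F'. finite F' \<Longrightarrow> F2 \<subseteq> F' \<Longrightarrow> F' \<subseteq> out_arcs E v \<Longrightarrow> x2 * cut v F' = y2 * cut v F'"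
    by blast
  show ?case
    using 1(1-3) 2(1-3) by (intro bexI[of _ "y1 + y2"] exI[of _ "F1 \<union> F2"])
      (auto simp: distrib_right 1(4) 2(4) intro: ghost_span.add)
next
  case (scale x a)
  from scale.IH obtain y F where 1: "y \<in> ghost_span 0" "finite F" "F \<subseteq> out_arcs E v"
    "\<And>F'. finite F' \<Longrightarrow> F \<subseteq> F' \<Longrightarrow> F' \<subseteq> out_arcs E v \<Longrightarrow> x * cut v F' = y * cut v F'"
    by blast
  show ?case
    using 1(1-3) by (intro bexI[of _ "\<kappa> a * y"] exI[of _ F])
      (auto simp: mult.assoc 1(4) intro: ghost_span.scale)
qed

end

text \<open>The relation at regular vertices is not among the assumptions of
  \<open>leavitt_quotient\<close>, since in a quotient graph it may hold at a vertex or fail. Once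
  the generators have been divided out, \<open>vertex_cases\<close> is the dichotomy that remains:
  the relation holds at \<open>v\<close>, or \<open>I\<close> contains no cut at \<open>v\<close> at
  all.\<close>

locale leavitt_ideal = leavitt_quotient +
  fixes I :: "'d set"
  assumes I_alg: "I \<subseteq> alg"
    and I_add: "x \<in> I \<Longrightarrow> y \<in> I \<Longrightarrow> x + y \<in> I"
    and I_left: "x \<in> alg \<Longrightarrow> y \<in> I \<Longrightarrow> x * y \<in> I"
    and I_right: "x \<in> I \<Longrightarrow> y \<in> alg \<Longrightarrow> x * y \<in> I"
    and p_notin_I: "v \<in> verts E \<Longrightarrow> p v \<notin> I"
    and vertex_cases: "v \<in> verts E \<Longrightarrow>
      finite (out_arcs E v) \<and> cut v (out_arcs E v) = 0 \<or>
      (\<forall>F. finite F \<longrightarrow> F \<subseteq> out_arcs E v \<longrightarrow> cut v F \<notin> I)"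
begin

text \<open>Multiply by a cut over \<open>F\<close> and the first edges of all walks in
  \<open>C\<close>, in the second claim from both sides. The closed walks vanish and only that
  larger cut remains, which is not in \<open>I\<close>.\<close>

lemma monic_elt_notin_singular:
  assumes "v \<in> verts E" "\<forall>F. finite F \<longrightarrow> F \<subseteq> out_arcs E v \<longrightarrow> cut v F \<notin> I"
    and "finite C" "C \<subseteq> closed_walks v" "finite F" "F \<subseteq> out_arcs E v"
  shows "cut v F * monic_elt v C k \<notin> I" "monic_elt v C k * cut v F \<notin> I"
proof -
  define F' where "F' = F \<union> hd ` C"
  have F': "finite F'" "F' \<subseteq> out_arcs E v" "F \<subseteq> F'" "hd ` C \<subseteq> F'"
    using hd_closed_walks[OF assms(4)] assms(3,5,6) by (auto simp: F'_def)
  have nin: "cut v F' \<notin> I" using assms F' by auto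
  have alg: "cut v F' \<in> alg" using alg_cut assms(1) F' by auto
  have "cut v F' * (cut v F * monic_elt v C k) = cut v F'"
    using cut_cut[OF assms(1) F'(1,2,3)] cut_monic_elt[OF assms(1) F'(1,2) assms(4) F'(4)]
    by (simp flip: mult.assoc)
  then show "cut v F * monic_elt v C k \<notin> I" using I_left[OF alg] nin by metis
  have "cut v F' * (monic_elt v C k * cut v F) * cut v F' = cut v F'"
    using cut_cut[OF assms(1) F'(1,2,3)] cut_cut[OF assms(1) F'(1,2), of F']
      cut_monic_elt[OF assms(1) F'(1,2) assms(4) F'(4)]
    by (metis order_refl mult.assoc)
  then show "monic_elt v C k * cut v F \<notin> I" using I_left[OF alg] I_right[OF _ alg] nin by metis
qed

text \<open>Right multiplication by an edge shortens the ghosts. If all these products vanish,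
  \<open>x\<close> does not distinguish \<open>p v\<close> from a cut at \<open>v\<close>. Where the
  relation holds this gives \<open>x * p v = 0\<close>; otherwise a fine enough cut removes all
  ghosts, and \<open>monic_elt_notin_singular\<close> applies.\<close>

lemma reduction:
  assumes "x \<in> I" "x \<noteq> 0"
  shows "\<exists>v\<in>verts E. \<exists>C k. finite C \<and> C \<subseteq> closed_walks v \<and> monic_elt v C k \<in> I"
proof -
  have "x \<in> ghost_span n \<Longrightarrow> x \<in> I \<Longrightarrow> x \<noteq> 0 \<Longrightarrow> ?thesis" for n x
  proof (induction n arbitrary: x)
    case 0
    then obtain v where v: "v \<in> verts E" "x * p v \<noteq> 0"
      using mult_p_decomp[of x] I_alg by (metis subsetD sum.neutral)
    from leading_walk[OF 0(1) v] obtain y C k where y: "y \<in> alg" "finite C" "C \<subseteq> closed_walks v"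
      "y * x * p v = monic_elt v C k" by blast
    have "y * x * p v \<in> I" using 0 y(1) v(1) by (intro I_right[OF I_left]) auto
    then show ?case using y v by auto
  next
    case (Suc n)
    obtain v where v: "v \<in> verts E" "x * p v \<noteq> 0"
      using Suc mult_p_decomp[of x] I_alg by (metis subsetD sum.neutral)
    show ?case
    proof (cases "\<exists>e\<in>arcs E. x * s e \<noteq> 0")
      case True
      then obtain e where e: "e \<in> arcs E" "x * s e \<noteq> 0" by auto
      then show ?thesis
        using Suc.IH[of "x * s e"] ghost_span_s_right[OF Suc.prems(1)] I_right[OF Suc.prems(2)] by auto
    next
      case False
      then have xcut: "x * cut v F = x * p v" if "F \<subseteq> out_arcs E v" for F
      proof -
        have "x * (\<Sum>e\<in>F. s e * t e) = (\<Sum>e\<in>F. x * s e * t e)"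
          by (simp add: sum_distrib_left mult.assoc)
        also have "\<dots> = 0" using that False by (intro sum.neutral) auto
        finally show ?thesis by (simp add: cut_def right_diff_distrib)
      qed
      from vertex_cases[OF v(1)] show ?thesis
      proof
        assume "finite (out_arcs E v) \<and> cut v (out_arcs E v) = 0"
        then show ?thesis using xcut[of "out_arcs E v"] v by simp
      next
        assume sing: "\<forall>F. finite F \<longrightarrow> F \<subseteq> out_arcs E v \<longrightarrow> cut v F \<notin> I"
        from ghost_span_mult_cut[OF Suc.prems(1) v(1)] obtain y F where y: "y \<in> ghost_span 0"
          "finite F" "F \<subseteq> out_arcs E v" "x * cut v F = y * cut v F" by blast
        have *: "y * cut v F = y * p v * cut v F"
          using p_cut[OF v(1) y(2,3)] by (simp add: mult.assoc)
        then have "y * p v \<noteq> 0" using y xcut v by auto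
        from leading_walk[OF y(1) v(1) this] obtain z C k where z: "z \<in> alg" "finite C"
          "C \<subseteq> closed_walks v" "z * y * p v = monic_elt v C k" by blast
        have "monic_elt v C k * cut v F = z * (x * cut v F)"
          unfolding y(4) * z(4)[symmetric] by (simp add: mult.assoc)
        then have "monic_elt v C k * cut v F \<in> I"
          using z(1) Suc.prems(2) alg_cut[OF v(1) y(2,3)] by (metis I_left I_right)
        then show ?thesis using monic_elt_notin_singular[OF v(1) sing z(2,3) y(2,3)] by blast
      qed
    qed
  qed
  moreover obtain n where "x \<in> ghost_span n"
    using alg_ghost_span[of x] I_alg assms(1) by auto
  ultimately show ?thesis using assms by metis
qed

end

section \<open>Periodic walks, squares of ideals, and polynomials evaluated in a corner\<close>

abbreviation "walk_power n \<gamma> \<equiv> concat (replicate n \<gamma>)"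

text \<open>Iterating the hypothesis makes \<open>\<mu>\<close> a prefix of
  \<open>walk_power n \<gamma> @ \<mu>\<close> for every \<open>n\<close>, and
  \<open>length \<mu>\<close> copies of the non-empty \<open>\<gamma>\<close> are long enough to
  contain it.\<close>

lemma prefix_replicate_append:
  assumes "prefix \<mu> (\<gamma> @ \<mu>)" "\<gamma> \<noteq> []"
  shows "prefix \<mu> (walk_power (length \<mu>) \<gamma>)"
proof -
  have *: "prefix \<mu> (walk_power n \<gamma> @ \<mu>)" for n
  proof (induction n)
    case (Suc n)
    then have "prefix (\<gamma> @ \<mu>) (\<gamma> @ walk_power n \<gamma> @ \<mu>)" by simp
    from prefix_order.trans[OF assms(1) this] show ?case by simp
  qed simp
  have "length \<mu> \<le> length (walk_power (length \<mu>) \<gamma>)"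
    using assms(2) by (cases \<gamma>) (simp_all add: length_concat sum_list_replicate)
  from prefix_length_prefix[OF *[of "length \<mu>"] _ this] show ?thesis by simp
qed

text \<open>This is \<open>N + I\<^sup>2\<close> for ideals \<open>N\<close> and \<open>I\<close>,
  so \<open>I \<subseteq> prod_sum N I\<close> says that \<open>I\<close> is idempotent modulo
  \<open>N\<close>.\<close>

inductive_set prod_sum :: "'a::ring set \<Rightarrow> 'a set \<Rightarrow> 'a set" for N I where
  base: "x \<in> N \<Longrightarrow> x \<in> prod_sum N I"
| product: "x \<in> I \<Longrightarrow> y \<in> I \<Longrightarrow> x * y \<in> prod_sum N I"
| add: "x \<in> prod_sum N I \<Longrightarrow> y \<in> prod_sum N I \<Longrightarrow> x + y \<in> prod_sum N I"

context leavitt_quotient begin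

lemma awalk_concat_replicate: "awalk v \<gamma> v \<Longrightarrow> awalk v (walk_power n \<gamma>) v"
  by (induction n) (auto simp: awalk_Nil_iff intro: awalk_appendI)

lemma path_power: "awalk v c v \<Longrightarrow> path (walk_power n c) v = path c v ^ n * p v"
proof (induction n)
  case (Suc n)
  then show ?case
    using path_append[OF Suc.prems awalk_concat_replicate[OF Suc.prems], of n]
    by (simp add: mult.assoc)
qed simp

text \<open>The constant polynomial 1 goes to \<open>p v\<close>, the unit of the corner at
  \<open>v\<close>, and not to \<open>1\<close>. This makes \<open>eval\<close> multiplicative when
  \<open>z\<close> lies in the corner.\<close>

definition eval :: "'w \<Rightarrow> 'r \<Rightarrow> 'k poly \<Rightarrow> 'r" where
  "eval v z g = fold_coeffs (\<lambda>a x. \<kappa> a * p v + z * x) g 0"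

lemma eval_0 [simp]: "eval v z 0 = 0"
  by (simp add: eval_def)

lemma eval_pCons: "eval v z (pCons a g) = \<kappa> a * p v + z * eval v z g"
  by (cases "a = 0 \<and> g = 0") (auto simp: eval_def)

lemma eval_eq_sum: "eval v z g = (\<Sum>i\<le>degree g. \<kappa> (coeff g i) * (z ^ i * p v))"
proof (induction g)
  case (pCons a g)
  show ?case
  proof (cases "g = 0")
    case False
    have "(\<Sum>i\<le>degree g. \<kappa> (coeff g i) * (z ^ Suc i * p v)) = z * (\<Sum>i\<le>degree g. \<kappa> (coeff g i) * (z ^ i * p v))"
      by (simp add: sum_distrib_left kappa_left mult.assoc)
    with False pCons show ?thesis
      by (simp add: eval_pCons sum.atMost_Suc_shift del: sum.atMost_Suc)
  qed (simp add: eval_pCons)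
qed simp

lemma eval_add: "eval v z (g + h) = eval v z g + eval v z h"
proof (induction g arbitrary: h)
  case (pCons a g)
  obtain b q where h: "h = pCons b q" by (cases h)
  show ?case
    by (simp only: h add_pCons eval_pCons pCons.IH kappa_add distrib_left distrib_right add.assoc)
      (simp only: add.left_commute)
qed simp

lemma eval_smult: "eval v z (smult a g) = \<kappa> a * eval v z g"
  by (induction g) (simp_all add: eval_pCons kappa_mult distrib_left kappa_left[of z] mult.assoc)

lemma eval_diff: "eval v z (g - h) = eval v z g - eval v z h"
  using eval_add[of v z "g - h" h] by simp

context
  fixes v :: 'w and z :: 'r
  assumes v: "v \<in> verts E" and z: "p v * z = z" "z * p v = z"
begin

lemma p_eval: "p v * eval v z g = eval v z g"
  using v by (induction g) (simp_all add: eval_pCons distrib_left kappa_left[of "p v"] z(1) mult.assoc flip: mult.assoc[of "p v" z])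

lemma eval_p: "eval v z g * p v = eval v z g"
  using v by (induction g) (simp_all add: eval_pCons distrib_right mult.assoc)

lemma eval_mult: "eval v z (g * h) = eval v z g * eval v z h"
  by (induction g)
    (simp_all add: eval_pCons eval_add eval_smult distrib_right mult.assoc p_eval)

lemma eval_commute: "z * eval v z g = eval v z g * z"
proof (induction g)
  case (pCons a g)
  have "z * (\<kappa> a * p v + z * eval v z g) = \<kappa> a * (p v * z) + z * (eval v z g * z)"
    by (simp add: distrib_left kappa_left[of z] z pCons.IH)
  then show ?case by (simp add: eval_pCons distrib_right mult.assoc)
qed simp

lemma eval_mult_power: "eval v z g * z ^ m = eval v z (monom 1 m * g)"
proof (induction m)
  case (Suc m)
  have "eval v z g * z ^ Suc m = z * (eval v z g * z ^ m)"
    by (simp add: eval_commute flip: mult.assoc)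
  also have "\<dots> = eval v z (pCons 0 (monom 1 m * g))" by (simp add: Suc eval_pCons)
  finally show ?case by (simp add: monom_Suc)
qed simp

end

end

text \<open>That walks from \<open>v\<close> are prefix-comparable says that every vertex reachable from \<open>v\<close> emits at
  most one edge.\<close>

locale no_exit_cycle = leavitt_ideal +
  fixes v c
  assumes c: "c \<in> closed_walks v"
    and shortest: "\<delta> \<in> closed_walks v \<Longrightarrow> length c \<le> length \<delta>"
    and comparable: "awalk v \<mu> w \<Longrightarrow> awalk v \<nu> x \<Longrightarrow> \<not> \<mu> \<parallel> \<nu>"
    and reach_regular: "awalk v \<mu> w \<Longrightarrow> finite (out_arcs E w) \<and> cut w (out_arcs E w) = 0"
begin

abbreviation "z \<equiv> path c v"
abbreviation "z' \<equiv> ghost v c"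

lemma c_walk: "awalk v c v" "c \<noteq> []"
  using c by (auto simp: closed_walks_def)

lemma v_vert [simp]: "v \<in> verts E"
  using c_walk by auto

lemma z_simps [simp]: "p v * z = z" "z * p v = z" "p v * z' = z'" "z' * p v = z'" "z' * z = p v"
  using p_path[OF c_walk(1), of v] path_p[OF c_walk(1), of v] p_ghost[OF c_walk(1), of v]
    ghost_p[OF c_walk(1), of v] ghost_path_self[OF c_walk(1)] by auto

lemma return_walk:
  assumes "awalk v \<mu> w"
  obtains \<eta> where "awalk w \<eta> v" "\<eta> \<noteq> []"
proof -
  \<comment> \<open>One copy more than \<open>length \<mu>\<close> makes the power strictly longer
    than \<open>\<mu>\<close>, so the way back is not empty.\<close>
  define N where "N = Suc (length \<mu>)"
  have N: "awalk v (walk_power N c) v" by (rule awalk_concat_replicate[OF c_walk(1)])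
  have "length \<mu> < length (walk_power N c)"
    using c_walk(2) by (cases c) (simp_all add: length_concat sum_list_replicate N_def)
  with comparable[OF assms N] have "strict_prefix \<mu> (walk_power N c)"
    by (auto simp: parallel_def strict_prefix_def dest: prefix_length_le)
  then obtain \<eta> where \<eta>: "walk_power N c = \<mu> @ \<eta>" "\<eta> \<noteq> []"
    by (auto simp: strict_prefix_def prefix_def)
  then obtain w' where w': "awalk v \<mu> w'" "awalk w' \<eta> v" using N by (auto elim: awalk_appendE)
  have "w' = w" using awalk_ends[OF w'(1) assms] by auto
  with w' \<eta> that show thesis by blast
qed

text \<open>Two edges from the same reachable vertex would give incomparable walks. So
  \<open>e\<close> is the only edge there and the relation at its tail has a single summand.\<close>

lemma s_t:
  assumes "awalk v \<mu> (tail E e)" "e \<in> arcs E"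
  shows "s e * t e = p (tail E e)"
proof -
  have "f = e" if "f \<in> out_arcs E (tail E e)" for f
  proof -
    have "awalk v (\<mu> @ [e]) (head E e)" "awalk v (\<mu> @ [f]) (head E f)"
      using assms that by (auto intro!: awalk_appendI[of v \<mu> "tail E e"] simp: awalk_Cons_iff awalk_Nil_iff)
    from comparable[OF this] show ?thesis by (auto simp: parallel_def prefix_def)
  qed
  then have "out_arcs E (tail E e) = {e}" using assms(2) by auto
  then show ?thesis using reach_regular[OF assms(1)] by (simp add: cut_def)
qed

text \<open>Beyond \<open>v\<close>, ghosts invert paths on both sides; in particular
  \<open>z\<close> is invertible in the corner.\<close>

lemma path_ghost:
  "awalk v \<mu> w \<Longrightarrow> awalk w \<eta> x \<Longrightarrow> path \<eta> x * ghost x \<eta> = p w"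
proof (induction \<eta> arbitrary: \<mu> w)
  case Nil
  then show ?case by (auto simp: awalk_Nil_iff)
next
  case (Cons e \<eta>)
  then have e: "e \<in> arcs E" "w = tail E e" "awalk (head E e) \<eta> x" by (auto simp: awalk_Cons_iff)
  have "awalk v (\<mu> @ [e]) (head E e)"
    using Cons.prems(1) e by (auto intro!: awalk_appendI[of v \<mu> w] simp: awalk_Cons_iff awalk_Nil_iff)
  from Cons.IH[OF this e(3)] have "path (e # \<eta>) x * ghost x (e # \<eta>) = s e * p (head E e) * t e"
    by (simp add: mult.assoc flip: mult.assoc[of "path \<eta> x"])
  also have "\<dots> = p w" using s_t Cons.prems(1) e by simp
  finally show ?case .
qed

lemma z_z' [simp]: "z * z' = p v"
  using path_ghost[of "[]" v c v] c_walk by (simp add: awalk_Nil_iff)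

text \<open>The walk \<open>c\<close> is comparable with \<open>\<delta>\<close> and not longer, so
  it can be split off the front.\<close>

lemma closed_walk_power:
  "awalk v \<delta> v \<Longrightarrow> \<exists>n. \<delta> = walk_power n c"
proof (induction "length \<delta>" arbitrary: \<delta> rule: less_induct)
  case less
  show ?case
  proof (cases "\<delta> = []")
    case False
    then have "prefix c \<delta>"
      using comparable[OF c_walk(1) less.prems] shortest[of \<delta>] less.prems
      by (auto simp: closed_walks_def parallel_def prefix_def)
    then obtain \<delta>' where \<delta>': "\<delta> = c @ \<delta>'" by (auto simp: prefix_def)
    then obtain w where "awalk v c w" "awalk w \<delta>' v" using less.prems by (auto elim: awalk_appendE)
    moreover have "w = v" using awalk_ends[OF \<open>awalk v c w\<close> c_walk(1)] by auto
    ultimately obtain n where "\<delta>' = walk_power n c"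
      using less.hyps[of \<delta>'] \<delta>' c_walk(2) by auto
    then show ?thesis using \<delta>' by (intro exI[of _ "Suc n"]) simp
  qed (auto intro: exI[of _ 0])
qed

lemma ghost_power: "ghost v (walk_power n c) = p v * z' ^ n"
proof (induction n)
  case (Suc n)
  then show ?case
    using ghost_append[OF c_walk(1) awalk_concat_replicate[OF c_walk(1)], of n]
    by (simp add: mult.assoc power_Suc2 del: power_Suc)
qed simp

lemma z_power_p: "z ^ n * p v = p v * z ^ n" "z' ^ n * p v = p v * z' ^ n"
  by (simp_all add: power_commuting_commutes)

lemma z'_z_power: "p v * z' ^ n * z ^ n = p v"
proof (induction n)
  case (Suc n)
  have "p v * z' ^ Suc n * z ^ Suc n = p v * z' ^ n * (z' * z) * z ^ n"
    unfolding power_Suc2[of z'] power_Suc[of z] by (simp only: mult.assoc)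
  also have "\<dots> = p v * (z' ^ n * p v) * z ^ n" by (simp add: mult.assoc)
  also have "\<dots> = p v * z' ^ n * z ^ n"
    unfolding z_power_p by (simp flip: mult.assoc)
  finally show ?case using Suc by simp
qed simp

text \<open>Insert \<open>p w = \<eta> \<eta>*\<close> with a walk \<open>\<eta>\<close> back to
  \<open>v\<close>. The ghost part becomes that of the closed walk \<open>\<beta> @ \<eta>\<close>,
  which is a power of \<open>c\<close>; so it is a power of \<open>z'\<close>, and
  \<open>z ^ n\<close> cancels it.\<close>

lemma monom_through_v:
  assumes "awalk u \<alpha> w" "awalk v \<beta> w"
  obtains \<alpha>' n where "awalk u \<alpha>' v" "path \<alpha> w * ghost w \<beta> = path \<alpha>' v * z' ^ n"
    "p v * z' ^ n * z ^ n = p v"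
proof -
  obtain \<eta> where \<eta>: "awalk w \<eta> v" using return_walk[OF assms(2)] by blast
  have w: "w \<in> verts E" using assms by auto
  obtain n where n: "\<beta> @ \<eta> = walk_power n c"
    using closed_walk_power[OF awalk_appendI[OF assms(2) \<eta>]] by blast
  have a: "awalk u (\<alpha> @ \<eta>) v" by (rule awalk_appendI[OF assms(1) \<eta>])
  have "path \<alpha> w * ghost w \<beta> = path \<alpha> w * p w * ghost w \<beta>"
    using path_p[OF assms(1) w] by simp
  also have "\<dots> = path \<alpha> w * (path \<eta> v * ghost v \<eta>) * ghost w \<beta>"
    using path_ghost[OF assms(2) \<eta>] by simp
  also have "\<dots> = (path \<alpha> w * path \<eta> v) * (ghost v \<eta> * ghost w \<beta>)"
    by (simp add: mult.assoc)
  also have "\<dots> = path (\<alpha> @ \<eta>) v * (p v * z' ^ n)"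
    using path_append[OF assms(1) \<eta>] ghost_append[OF assms(2) \<eta>] n ghost_power by simp
  also have "\<dots> = path (\<alpha> @ \<eta>) v * z' ^ n"
    using path_p[OF a, of v] by (simp flip: mult.assoc)
  finally show thesis using that a z'_z_power by blast
qed

abbreviation "ev \<equiv> eval v z"

lemma ev_simps: "p v * ev g = ev g" "ev g * p v = ev g" "ev (g * h) = ev g * ev h"
  "ev g * z ^ m = ev (monom 1 m * g)"
  using p_eval[of v z g] eval_p[of v z g] eval_mult[of v z] eval_mult_power[of v z] by auto

lemma ev_monom: "ev (monom 1 i) = p v * z ^ i"
  using ev_simps(4)[of 1 i] by (simp add: one_pCons eval_pCons)

lemma ev_alg: "ev g \<in> alg"
  by (induction g) (auto simp: eval_pCons intro!: alg.intros alg_path[OF c_walk(1)])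

text \<open>The corner consists of Laurent polynomials in \<open>z\<close>. A power of
  \<open>z\<close> clears the negative exponents, so that ordinary polynomials suffice.\<close>

lemma corner:
  assumes "x \<in> alg"
  shows "\<exists>m g. p v * x * p v * z ^ m = ev g"
proof -
  have "x \<in> ghost_span n \<Longrightarrow> ?thesis" for n
  proof (induction rule: ghost_span.induct)
    case zero
    show ?case by (auto intro: exI[of _ 0])
  next
    case (monom u \<alpha> w u' \<beta>)
    have *: "p v * (path \<alpha> w * ghost w \<beta>) * p v =
      (if u = v \<and> u' = v then path \<alpha> w * ghost w \<beta> else 0)"
      using p_path[OF monom(1) v_vert] ghost_p[OF monom(2) v_vert]
      by (simp add: mult.assoc) (simp flip: mult.assoc)
    show ?case
    proof (cases "u = v \<and> u' = v")
      case True
      then obtain \<alpha>' n where a: "awalk v \<alpha>' v" "path \<alpha> w * ghost w \<beta> = path \<alpha>' v * z' ^ n"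
        "p v * z' ^ n * z ^ n = p v"
        using monom monom_through_v by metis
      obtain i where "\<alpha>' = walk_power i c" using closed_walk_power a by blast
      then have "path \<alpha> w * ghost w \<beta> * z ^ n = z ^ i * (p v * z' ^ n * z ^ n)"
        using a path_power[OF c_walk(1)] by (simp add: mult.assoc)
      also have "\<dots> = ev (monom 1 i)" using a z_power_p by (simp add: ev_monom)
      finally show ?thesis using * True by auto
    next
      case False
      then show ?thesis using * by (auto intro!: exI[of _ 0])
    qed
  next
    case (add x y)
    then obtain m g m' g' where "p v * x * p v * z ^ m = ev g" "p v * y * p v * z ^ m' = ev g'"
      by blast
    then have "p v * x * p v * z ^ m * z ^ m' = ev (monom 1 m' * g)"
      "p v * y * p v * z ^ m' * z ^ m = ev (monom 1 m * g')"
      by (simp_all add: ev_simps)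
    then have "p v * (x + y) * p v * z ^ (m + m') = ev (monom 1 m' * g + monom 1 m * g')"
      by (simp add: eval_add distrib_left distrib_right power_add mult.assoc power_commutes
        flip: power_add) (simp add: add.commute)
    then show ?case by blast
  next
    case (scale x a)
    then obtain m g where "p v * x * p v * z ^ m = ev g" by blast
    then have "p v * (\<kappa> a * x) * p v * z ^ m = ev (smult a g)"
      by (simp add: eval_smult kappa_left mult.assoc)
    then show ?case by blast
  qed
  then show ?thesis using alg_ghost_span[OF assms] by blast
qed

text \<open>Walks that meet \<open>v\<close> only at their end. The elements
  \<open>path \<tau> v * ghost v \<tau>\<close> are the diagonal matrix units of the ideal generated
  by \<open>p v\<close>, which is a ring of finitary matrices over the corner.\<close>

definition first_returns :: "'b list set" where
  "first_returns = {\<tau>. (\<exists>u. awalk u \<tau> v) \<and> (\<forall>\<alpha> \<beta>. \<tau> = \<alpha> @ \<beta> \<longrightarrow> \<beta> \<notin> closed_walks v)}"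

lemma first_return_decomp:
  "awalk u \<alpha> v \<Longrightarrow> \<exists>\<tau> \<delta>. \<alpha> = \<tau> @ \<delta> \<and> \<tau> \<in> first_returns \<and> awalk u \<tau> v \<and> awalk v \<delta> v"
proof (induction "length \<alpha>" arbitrary: \<alpha> rule: less_induct)
  case less
  show ?case
  proof (cases "\<alpha> \<in> first_returns")
    case True
    then show ?thesis using less.prems by (intro exI[of _ \<alpha>] exI[of _ "[]"]) (simp add: awalk_Nil_iff)
  next
    case False
    then obtain \<beta> \<gamma> where \<beta>: "\<alpha> = \<beta> @ \<gamma>" "\<gamma> \<noteq> []" "awalk v \<gamma> v"
      using less.prems by (auto simp: first_returns_def closed_walks_def)
    then obtain w where w: "awalk u \<beta> w" "awalk w \<gamma> v" using less.prems by (auto elim: awalk_appendE)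
    have "w = v" using awalk_ends[OF w(2) \<beta>(3)] \<beta>(2) by auto
    then obtain \<tau> \<delta> where "\<beta> = \<tau> @ \<delta>" "\<tau> \<in> first_returns" "awalk u \<tau> v" "awalk v \<delta> v"
      using less.hyps[of \<beta>] \<beta> w by auto
    then show ?thesis using \<beta> by (intro exI[of _ \<tau>] exI[of _ "\<delta> @ \<gamma>"]) (auto intro: awalk_appendI)
  qed
qed

lemma ghost_path_first_returns:
  assumes "\<tau> \<in> first_returns" "\<tau>' \<in> first_returns"
  shows "ghost v \<tau> * path \<tau>' v = (if \<tau> = \<tau>' then p v else 0)"
proof -
  obtain u u' where u: "awalk u \<tau> v" "awalk u' \<tau>' v" using assms by (auto simp: first_returns_def)
  consider "\<tau> = \<tau>'" | "length \<tau> < length \<tau>' \<or> \<tau>' \<parallel> \<tau>" | \<beta> where "\<tau> = \<tau>' @ \<beta>" "\<beta> \<noteq> []"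
    by (fastforce simp: parallel_def prefix_def not_less)
  then show ?thesis
  proof cases
    case 1
    then show ?thesis using ghost_path_self[OF u(1)] by simp
  next
    case 2
    then show ?thesis using ghost_mult_path[OF u 2] assms(2) by (auto simp: first_returns_def)
  next
    \<comment> \<open>The rest \<open>\<beta>\<close> is not closed at \<open>v\<close>, which
      forces \<open>\<tau>'\<close> to be empty. Then \<open>\<tau>\<close> starts elsewhere and its
      ghost is killed by \<open>p v\<close>.\<close>
    case (3 \<beta>)
    then obtain w where w: "awalk u \<tau>' w" "awalk w \<beta> v" using u(1) by (auto elim: awalk_appendE)
    have "\<beta> \<notin> closed_walks v" using 3 assms(1) by (auto simp: first_returns_def)
    then have "w \<noteq> v" using w 3 by (auto simp: closed_walks_def)
    then have "\<tau>' = []" using awalk_ends[OF w(1) u(2)] by auto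
    moreover have "u \<noteq> v" using \<open>\<tau>' = []\<close> w(1) \<open>w \<noteq> v\<close> by (auto simp: awalk_Nil_iff)
    ultimately show ?thesis using 3 ghost_p[OF u(1), of v] by simp
  qed
qed

text \<open>Finitely many diagonal units together fix \<open>y * p v\<close>. This lets a product of
  two elements of \<open>I\<close> be factored through the corner at \<open>v\<close>.\<close>

lemma first_returns_expansion:
  assumes "y \<in> alg"
  shows "\<exists>T. finite T \<and> T \<subseteq> first_returns \<and> y * p v = (\<Sum>\<tau>\<in>T. path \<tau> v * (ghost v \<tau> * (y * p v)))"
proof -
  \<comment> \<open>Claiming the equation for all larger \<open>T'\<close> lets the case of a sum
    pass to the union of two index sets.\<close>
  have "y \<in> ghost_span n \<Longrightarrow> \<exists>T. finite T \<and> T \<subseteq> first_returns \<and>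
    (\<forall>T'. finite T' \<longrightarrow> T \<subseteq> T' \<longrightarrow> T' \<subseteq> first_returns \<longrightarrow>
      (\<Sum>\<tau>\<in>T'. path \<tau> v * (ghost v \<tau> * (y * p v))) = y * p v)" for n
  proof (induction rule: ghost_span.induct)
    case zero
    show ?case by (intro exI[of _ "{}"]) simp
  next
    case (monom u \<alpha> w u' \<beta>)
    have *: "path \<alpha> w * ghost w \<beta> * p v = (if u' = v then path \<alpha> w * ghost w \<beta> else 0)"
      using ghost_p[OF monom(2) v_vert] by (simp add: mult.assoc)
    show ?case
    proof (cases "u' = v")
      case True
      then obtain \<alpha>' n where a: "awalk u \<alpha>' v" "path \<alpha> w * ghost w \<beta> = path \<alpha>' v * z' ^ n"
        using monom monom_through_v by metis
      obtain \<tau> \<delta> where t: "\<alpha>' = \<tau> @ \<delta>" "\<tau> \<in> first_returns" "awalk u \<tau> v" "awalk v \<delta> v"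
        using first_return_decomp[OF a(1)] by blast
      have eq: "path \<alpha> w * ghost w \<beta> * p v = path \<tau> v * (path \<delta> v * z' ^ n)"
        using * True a(2) path_append[OF t(3,4)] t(1) by (simp flip: mult.assoc)
      have "(\<Sum>\<tau>'\<in>T'. path \<tau>' v * (ghost v \<tau>' * (path \<tau> v * (path \<delta> v * z' ^ n)))) =
        path \<tau> v * (path \<delta> v * z' ^ n)" if T': "finite T'" "{\<tau>} \<subseteq> T'" "T' \<subseteq> first_returns" for T'
      proof -
        have "(\<Sum>\<tau>'\<in>T'. path \<tau>' v * (ghost v \<tau>' * (path \<tau> v * (path \<delta> v * z' ^ n)))) =
          (\<Sum>\<tau>'\<in>T'. if \<tau>' = \<tau> then path \<tau> v * (p v * (path \<delta> v * z' ^ n)) else 0)"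
        proof (intro sum.cong refl)
          fix \<tau>' assume "\<tau>' \<in> T'"
          then have "ghost v \<tau>' * path \<tau> v = (if \<tau>' = \<tau> then p v else 0)"
            using ghost_path_first_returns[of \<tau>' \<tau>] t(2) T' by auto
          then show "path \<tau>' v * (ghost v \<tau>' * (path \<tau> v * (path \<delta> v * z' ^ n))) =
            (if \<tau>' = \<tau> then path \<tau> v * (p v * (path \<delta> v * z' ^ n)) else 0)"
            by (simp flip: mult.assoc[of "ghost v \<tau>'"])
        qed
        also have "\<dots> = path \<tau> v * (p v * (path \<delta> v * z' ^ n))" using T' by simp
        also have "p v * (path \<delta> v * z' ^ n) = path \<delta> v * z' ^ n"
          using p_path[OF t(4) v_vert] by (simp flip: mult.assoc)
        finally show ?thesis .
      qed
      then show ?thesis using t(2) unfolding eq by (intro exI[of _ "{\<tau>}"]) auto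
    next
      case False
      then show ?thesis using * by (intro exI[of _ "{}"]) simp
    qed
  next
    case (add x y)
    from add.IH(1) obtain T1 where 1: "finite T1" "T1 \<subseteq> first_returns"
      "\<And>T'. finite T' \<Longrightarrow> T1 \<subseteq> T' \<Longrightarrow> T' \<subseteq> first_returns \<Longrightarrow>
        (\<Sum>\<tau>\<in>T'. path \<tau> v * (ghost v \<tau> * (x * p v))) = x * p v" by blast
    from add.IH(2) obtain T2 where 2: "finite T2" "T2 \<subseteq> first_returns"
      "\<And>T'. finite T' \<Longrightarrow> T2 \<subseteq> T' \<Longrightarrow> T' \<subseteq> first_returns \<Longrightarrow>
        (\<Sum>\<tau>\<in>T'. path \<tau> v * (ghost v \<tau> * (y * p v))) = y * p v" by blast
    show ?case using 1(1,2) 2(1,2)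
      by (intro exI[of _ "T1 \<union> T2"]) (auto simp: distrib_left distrib_right sum.distrib 1(3) 2(3))
  next
    case (scale x a)
    from scale.IH obtain T1 where 1: "finite T1" "T1 \<subseteq> first_returns"
      "\<And>T'. finite T' \<Longrightarrow> T1 \<subseteq> T' \<Longrightarrow> T' \<subseteq> first_returns \<Longrightarrow>
        (\<Sum>\<tau>\<in>T'. path \<tau> v * (ghost v \<tau> * (x * p v))) = x * p v" by blast
    have "path \<tau> v * (ghost v \<tau> * (\<kappa> a * x * p v)) = \<kappa> a * (path \<tau> v * (ghost v \<tau> * (x * p v)))" for \<tau>
      by (simp add: mult.assoc kappa_left[of "path \<tau> v"] kappa_left[of "ghost v \<tau>"])
    then show ?case using 1(1,2)
      by (intro exI[of _ T1]) (auto simp: 1(3) mult.assoc simp flip: sum_distrib_left)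
  qed
  note span = this
  obtain n where "y \<in> ghost_span n" using alg_ghost_span[OF assms] by blast
  from span[OF this] obtain T where "finite T" "T \<subseteq> first_returns"
    "\<forall>T'. finite T' \<longrightarrow> T \<subseteq> T' \<longrightarrow> T' \<subseteq> first_returns \<longrightarrow>
      (\<Sum>\<tau>\<in>T'. path \<tau> v * (ghost v \<tau> * (y * p v))) = y * p v"
    by blast
  then show ?thesis by (intro exI[of _ T]) simp
qed

lemma monic_elt_eval:
  assumes "finite C" "C \<subseteq> closed_walks v"
  shows "\<exists>g. coeff g 0 = 1 \<and> monic_elt v C k = ev g"
  using assms
proof (induction C rule: finite_induct)
  case empty
  show ?case by (intro exI[of _ 1]) (simp add: monic_elt_def one_pCons eval_pCons)
next
  case (insert \<gamma> C)
  then obtain g where g: "coeff g 0 = 1" "monic_elt v C k = ev g" by auto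
  have "awalk v \<gamma> v" "\<gamma> \<noteq> []" using insert by (auto simp: closed_walks_def)
  with closed_walk_power obtain n where n: "\<gamma> = walk_power n c" "n \<noteq> 0" by fastforce
  then have "path \<gamma> v = ev (monom 1 n)"
    using path_power[OF c_walk(1)] z_power_p by (simp add: ev_monom)
  then have "monic_elt v (insert \<gamma> C) k = ev (g + smult (k \<gamma>) (monom 1 n))"
    using insert g by (simp add: monic_elt_def eval_add eval_smult add_ac)
  moreover have "coeff (g + smult (k \<gamma>) (monom 1 n)) 0 = 1" using g n by simp
  ultimately show ?case by blast
qed

end

locale idempotent_leavitt_ideal = leavitt_ideal +
  assumes idem: "I \<subseteq> prod_sum {0} I"
    and indep: "c \<in> closed_walks v \<Longrightarrow> eval v (path c v) g = 0 \<Longrightarrow> g = 0"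
begin

text \<open>The polynomials with value in \<open>I\<close> form a principal ideal, with generator
  \<open>g\<close> say, and \<open>g\<close> has non-zero constant term because \<open>z\<close> is
  invertible. Idempotence makes \<open>monom 1 m * g\<close> a multiple of \<open>g * g\<close> for
  some \<open>m\<close>. So \<open>g\<close> divides a power of \<open>X\<close>, hence is a unit,
  and \<open>p v \<in> I\<close>.\<close>

lemma no_exit_cycle_contradiction:
  assumes "no_exit_cycle E \<kappa> p s t I v c" "finite C" "C \<subseteq> closed_walks v" "monic_elt v C k \<in> I"
  shows False
proof -
  interpret no_exit_cycle E \<kappa> p s t I v c by fact
  define Pol where "Pol = {g. ev g \<in> I}"
  have Pol_mult: "f * g \<in> Pol" "g * f \<in> Pol" if "g \<in> Pol" for f g
    using that I_left[OF ev_alg] I_right[OF _ ev_alg] by (auto simp: Pol_def ev_simps)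
  have Pol_add: "f + g \<in> Pol" if "f \<in> Pol" "g \<in> Pol" for f g
    using that I_add by (auto simp: Pol_def eval_add)
  \<comment> \<open>Since \<open>z' * z = p v\<close>, a factor \<open>X\<close> can be removed
    without leaving \<open>Pol\<close>.\<close>
  have Pol_X: "g \<in> Pol" if "pCons 0 g \<in> Pol" for g
  proof -
    have "z' * ev (pCons 0 g) \<in> I"
      using that I_left alg_ghost[OF c_walk(1)] by (auto simp: Pol_def)
    moreover have "z' * ev (pCons 0 g) = ev g"
      by (simp add: eval_pCons ev_simps flip: mult.assoc)
    ultimately show ?thesis by (simp add: Pol_def)
  qed
  obtain f where f: "coeff f 0 = 1" "f \<in> Pol"
    using monic_elt_eval[OF assms(2,3)] assms(4) by (metis Pol_def mem_Collect_eq)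
  then have "f \<in> Pol \<and> f \<noteq> 0" by auto
  then obtain g where g: "g \<in> Pol" "g \<noteq> 0" "\<And>h. h \<in> Pol \<Longrightarrow> h \<noteq> 0 \<Longrightarrow> degree g \<le> degree h"
    using ex_has_least_nat[of "\<lambda>g. g \<in> Pol \<and> g \<noteq> 0" f degree] by blast
  have g_dvd: "g dvd h" if "h \<in> Pol" for h
  proof (rule ccontr)
    assume "\<not> g dvd h"
    then have "h mod g \<noteq> 0" by (simp add: dvd_eq_mod_eq_0)
    moreover have "h + (- (h div g)) * g \<in> Pol" using that g(1) by (intro Pol_add Pol_mult)
    then have "h mod g \<in> Pol" by (simp add: minus_div_mult_eq_mod)
    ultimately show False using g(3)[of "h mod g"] degree_mod_less[OF g(2), of h] by auto
  qed
  have g0: "coeff g 0 \<noteq> 0"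
  proof
    assume "coeff g 0 = 0"
    then obtain h where h: "g = pCons 0 h" by (cases g) auto
    then have "h \<in> Pol" "h \<noteq> 0" using Pol_X g by auto
    then show False using g(3)[of h] h by simp
  qed
  \<comment> \<open>The elements whose corner part lies in the ideal of Laurent polynomials
    generated by \<open>g * g\<close>; the exponent \<open>m\<close> clears denominators as in
    \<open>corner\<close>.\<close>
  define Q where "Q = {x. \<exists>m h. g * g dvd h \<and> p v * x * p v * z ^ m = ev h}"
  have Q_add: "x + y \<in> Q" if "x \<in> Q" "y \<in> Q" for x y
  proof -
    from that(1) obtain m h where h1: "g * g dvd h" "p v * x * p v * z ^ m = ev h"
      unfolding Q_def by blast
    from that(2) obtain m' h' where h2: "g * g dvd h'" "p v * y * p v * z ^ m' = ev h'"
      unfolding Q_def by blast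
    note h = h1 h2
    have "p v * x * p v * z ^ (m + m') = p v * x * p v * z ^ m * z ^ m'"
      by (simp add: mult.assoc power_add)
    moreover have "p v * y * p v * z ^ (m + m') = p v * y * p v * z ^ m' * z ^ m"
      by (simp add: mult.assoc add.commute flip: power_add)
    ultimately have "p v * x * p v * z ^ (m + m') = ev (monom 1 m' * h)"
      "p v * y * p v * z ^ (m + m') = ev (monom 1 m * h')"
      unfolding h(2,4) ev_simps(4) by blast+
    then have "p v * (x + y) * p v * z ^ (m + m') = ev (monom 1 m' * h + monom 1 m * h')"
      by (simp add: eval_add distrib_left distrib_right)
    then show ?thesis using h(1,3) unfolding Q_def by (blast intro: dvd_add dvd_mult)
  qed
  have Q0: "0 \<in> Q" by (auto simp: Q_def intro!: exI[of _ 0])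
  have Q_sum: "(\<Sum>i\<in>M. h i) \<in> Q" if "\<And>i. i \<in> M \<Longrightarrow> h i \<in> Q" for M and h :: "'b list \<Rightarrow> 'd"
    using that by (induction M rule: infinite_finite_induct) (auto intro: Q0 Q_add)
  have corner_mult: "p v * x * p v * (p v * y * p v) \<in> Q" if xy: "x \<in> I" "y \<in> I" for x y
  proof -
    obtain m h where h: "p v * x * p v * z ^ m = ev h"
      using corner[OF subsetD[OF I_alg xy(1)]] by blast
    obtain m' h' where h': "p v * y * p v * z ^ m' = ev h'"
      using corner[OF subsetD[OF I_alg xy(2)]] by blast
    have z_alg: "z ^ i * p v \<in> alg" for i
      using ev_alg[of "monom 1 i"] by (simp add: ev_monom z_power_p)
    have mem: "p v * x * p v * z ^ i \<in> I" if "x \<in> I" for x i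
    proof -
      have "p v * x * p v * z ^ i = p v * x * (z ^ i * p v)" by (simp add: z_power_p mult.assoc)
      then show ?thesis using I_left[OF alg_p that] I_right z_alg by simp
    qed
    have "h \<in> Pol" "h' \<in> Pol" using mem[OF xy(1), of m] mem[OF xy(2), of m'] h h' by (simp_all add: Pol_def)
    then have "g * g dvd h * h'" using g_dvd by (simp add: mult_dvd_mono)
    moreover have "p v * (p v * x * p v * (p v * y * p v)) * p v * z ^ (m' + m) = ev (h * h')"
    proof -
      have "p v * (p v * x * p v * (p v * y * p v)) * p v * z ^ (m' + m) =
        p v * x * p v * (p v * y * p v * z ^ m') * z ^ m"
        by (simp add: power_add mult.assoc) (simp flip: mult.assoc)
      also have "\<dots> = p v * x * p v * (ev h' * z ^ m)" unfolding h' by (simp only: mult.assoc)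
      also have "ev h' * z ^ m = p v * z ^ m * ev h'"
        by (simp add: ev_simps flip: ev_monom)
      also have "p v * x * p v * \<dots> = (p v * x * p v * z ^ m) * ev h'"
        by (simp add: mult.assoc) (simp flip: mult.assoc)
      finally show ?thesis using h by (simp add: ev_simps)
    qed
    ultimately show ?thesis unfolding Q_def by blast
  qed
  have "x \<in> prod_sum {0} I \<Longrightarrow> x \<in> Q" for x
  proof (induction rule: prod_sum.induct)
    case (product x y)
    obtain T where T: "finite T" "T \<subseteq> first_returns"
      "y * p v = (\<Sum>\<tau>\<in>T. path \<tau> v * (ghost v \<tau> * (y * p v)))"
      using first_returns_expansion[OF subsetD[OF I_alg product(2)]] by blast
    \<comment> \<open>Attaching the path to \<open>x\<close> and the ghost to \<open>y\<close> keeps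
      both factors in \<open>I\<close> and brings both into the corner.\<close>
    have "p v * (x * path \<tau> v) * p v * (p v * (ghost v \<tau> * y) * p v) \<in> Q" if \<tau>: "\<tau> \<in> T" for \<tau>
    proof -
      obtain u where "awalk u \<tau> v" using subsetD[OF T(2) \<tau>] by (auto simp: first_returns_def)
      then have "x * path \<tau> v \<in> I" "ghost v \<tau> * y \<in> I"
        using product alg_path alg_ghost I_left I_right by auto
      then show ?thesis by (rule corner_mult)
    qed
    then have "(\<Sum>\<tau>\<in>T. p v * (x * path \<tau> v) * p v * (p v * (ghost v \<tau> * y) * p v)) \<in> Q"
      by (rule Q_sum)
    also have "(\<Sum>\<tau>\<in>T. p v * (x * path \<tau> v) * p v * (p v * (ghost v \<tau> * y) * p v)) =
      (\<Sum>\<tau>\<in>T. p v * x * (path \<tau> v * (ghost v \<tau> * (y * p v))))"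
    proof (intro sum.cong refl)
      fix \<tau> assume "\<tau> \<in> T"
      from subsetD[OF T(2) this] obtain u where u: "awalk u \<tau> v" by (auto simp: first_returns_def)
      have "p v * (x * path \<tau> v) * p v * (p v * (ghost v \<tau> * y) * p v) =
        p v * x * (path \<tau> v * p v) * (p v * ghost v \<tau>) * y * p v"
        by (simp only: mult.assoc)
      then show "p v * (x * path \<tau> v) * p v * (p v * (ghost v \<tau> * y) * p v) =
        p v * x * (path \<tau> v * (ghost v \<tau> * (y * p v)))"
        using path_p[OF u v_vert] p_ghost[OF u v_vert] by (simp add: mult.assoc)
    qed
    also have "\<dots> = p v * x * (y * p v)"
      using T(3) by (simp flip: sum_distrib_left)
    finally have "p v * x * (y * p v) \<in> Q" .
    moreover have "p v * (p v * x * (y * p v)) * p v = p v * (x * y) * p v"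
      by (simp add: mult.assoc) (simp flip: mult.assoc)
    ultimately show ?case unfolding Q_def by simp
  qed (auto intro: Q0 Q_add)
  moreover have "ev g \<in> I" using g(1) by (simp add: Pol_def)
  ultimately have "ev g \<in> Q" using idem by blast
  then obtain m h where h: "g * g dvd h" "ev g * z ^ m = ev h"
    by (auto simp: Q_def ev_simps)
  then have "ev (monom 1 m * g - h) = 0" by (simp add: ev_simps eval_diff)
  from indep[OF c this] have "monom 1 m * g = h" by simp
  with h(1) g(2) have "g dvd monom 1 m" by (metis dvd_times_right_cancel_iff)
  \<comment> \<open>Factors \<open>X\<close> are cancelled one at a time: \<open>g\<close> has a
    constant term, so the cofactor is the one divisible by \<open>X\<close>.\<close>
  then have "g dvd 1"
  proof (induction m)
    case (Suc m)
    then obtain q where q: "monom 1 (Suc m) = g * q" by (auto elim: dvdE)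
    then have "coeff g 0 * coeff q 0 = 0" by (metis coeff_mult_0 coeff_monom nat.distinct(1))
    then obtain q' where "q = pCons 0 q'" using g0 by (cases q) auto
    then have "pCons 0 (monom 1 m) = pCons 0 (g * q')" using q by (simp add: monom_Suc)
    then show ?case using Suc.IH by simp
  qed (simp add: monom_0 flip: one_pCons)
  then obtain h where "1 = g * h" by (auto elim: dvdE)
  then have "1 \<in> Pol" using Pol_mult[OF g(1)] by metis
  then show False using p_notin_I[OF v_vert] by (simp add: Pol_def one_pCons eval_pCons)
qed

text \<open>Minimality is used through conjugation by a walk \<open>\<mu>\<close> from
  \<open>v\<close>. Multiplying the monic element by the ghost of \<open>\<mu>\<close> on the left
  and by its path on the right gives a monic element of \<open>I\<close> with at most as many terms.
  So no term may vanish, which means that every \<open>\<gamma> @ \<mu>\<close> begins with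
  \<open>\<mu>\<close>. Hence \<open>\<mu>\<close> is a prefix of a power of one fixed
  \<open>\<gamma>\<close>, and any two such walks are comparable.\<close>

theorem ideal_eq_zero: "I \<subseteq> {0}"
proof (rule ccontr)
  assume "\<not> I \<subseteq> {0}"
  then obtain x where "x \<in> I" "x \<noteq> 0" by auto
  define P where "P v C k \<longleftrightarrow> v \<in> verts E \<and> finite C \<and> C \<subseteq> closed_walks v \<and> monic_elt v C k \<in> I"
    for v C k
  have "\<exists>n v C k. card C = n \<and> P v C k"
    using reduction[OF \<open>x \<in> I\<close> \<open>x \<noteq> 0\<close>] unfolding P_def by blast
  then obtain n where n: "\<exists>v C k. card C = n \<and> P v C k"
    "\<And>m. m < n \<Longrightarrow> \<not> (\<exists>v C k. card C = m \<and> P v C k)"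
    using exists_least_iff[of "\<lambda>n. \<exists>v C k. card C = n \<and> P v C k"] by blast
  then obtain v C k where P: "P v C k" and min: "\<And>v' C' k'. P v' C' k' \<Longrightarrow> card C \<le> card C'"
    by (metis not_less)
  have v: "v \<in> verts E" and C: "finite C" "C \<subseteq> closed_walks v" "monic_elt v C k \<in> I"
    using P by (auto simp: P_def)
  have "C \<noteq> {}" using C(3) p_notin_I[OF v] by (auto simp: monic_elt_def)
  then obtain \<gamma> where \<gamma>: "\<gamma> \<in> C" by auto
  have conj: "prefix \<mu> (\<gamma> @ \<mu>) \<and> (\<exists>D k. P w D k)" if \<mu>: "awalk v \<mu> w" for \<mu> w
  proof -
    have w: "w \<in> verts E" using \<mu> by auto
    define B where "B = (\<lambda>\<gamma>. \<gamma> @ \<mu>) ` C"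
    \<comment> \<open>The coefficient of \<open>\<gamma>\<close> carried over to
      \<open>\<gamma> @ \<mu>\<close>.\<close>
    define l where "l \<beta> = k (take (length \<beta> - length \<mu>) \<beta>)" for \<beta>
    define D where "D = {\<delta> \<in> closed_walks w. \<mu> @ \<delta> \<in> B}"
    have inj: "inj_on (\<lambda>\<gamma>. \<gamma> @ \<mu>) C" by (auto simp: inj_on_def)
    have walkB: "awalk v (\<gamma> @ \<mu>) w" if "\<gamma> \<in> C" for \<gamma>
      using that C(2) \<mu> by (auto simp: closed_walks_def intro: awalk_appendI)
    have "ghost w \<mu> * monic_elt v C k * path \<mu> w =
      ghost w \<mu> * (p v * path \<mu> w) + ghost w \<mu> * (\<Sum>\<gamma>\<in>C. \<kappa> (k \<gamma>) * (path \<gamma> v * path \<mu> w))"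
      by (simp add: monic_elt_def distrib_left distrib_right sum_distrib_right mult.assoc)
    also have "p v * path \<mu> w = path \<mu> w" using p_path[OF \<mu> v] by simp
    also have "(\<Sum>\<gamma>\<in>C. \<kappa> (k \<gamma>) * (path \<gamma> v * path \<mu> w)) = (\<Sum>\<gamma>\<in>C. \<kappa> (l (\<gamma> @ \<mu>)) * path (\<gamma> @ \<mu>) w)"
      using C(2) \<mu> by (intro sum.cong) (auto simp: l_def closed_walks_def path_append)
    also have "\<dots> = (\<Sum>\<beta>\<in>B. \<kappa> (l \<beta>) * path \<beta> w)"
      unfolding B_def by (simp add: sum.reindex[OF inj])
    also have "ghost w \<mu> * \<dots> = (\<Sum>\<delta>\<in>D. \<kappa> (l (\<mu> @ \<delta>)) * path \<delta> w)"
      unfolding D_def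
    proof (rule ghost_mult_path_sum[OF \<mu>])
      show "length \<mu> < length \<beta> \<or> \<beta> \<parallel> \<mu>" if "\<beta> \<in> B" for \<beta>
        using that C(2) by (auto simp: B_def closed_walks_def)
    qed (use C walkB in \<open>auto simp: B_def\<close>)
    also have "ghost w \<mu> * path \<mu> w + \<dots> = monic_elt w D (\<lambda>\<delta>. l (\<mu> @ \<delta>))"
      by (simp add: monic_elt_def ghost_path_self[OF \<mu>])
    finally have "monic_elt w D (\<lambda>\<delta>. l (\<mu> @ \<delta>)) \<in> I"
      using I_left[OF alg_ghost[OF \<mu>] C(3)] I_right alg_path[OF \<mu>] by metis
    moreover have D: "(@) \<mu> ` D \<subseteq> B" "inj_on ((@) \<mu>) D" "finite B" "card B = card C"
      using C(1) card_image[OF inj] by (auto simp: D_def inj_on_def B_def)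
    moreover have "finite D" using D(1-3) by (metis finite_subset finite_imageD)
    ultimately have PD: "P w D (\<lambda>\<delta>. l (\<mu> @ \<delta>))" using w by (auto simp: P_def D_def)
    \<comment> \<open>Here minimality is applied: \<open>D\<close> indexes the terms that survive
      the conjugation, \<open>B\<close> all of them.\<close>
    have "card B \<le> card ((@) \<mu> ` D)" using min[OF PD] D card_image[OF D(2)] by simp
    then have "(@) \<mu> ` D = B" using D(1,3) card_seteq by blast
    moreover have "\<gamma> @ \<mu> \<in> B" using \<gamma> by (simp add: B_def)
    ultimately have "prefix \<mu> (\<gamma> @ \<mu>)" by (auto simp: prefix_def)
    then show ?thesis using PD by blast
  qed
  have "\<exists>c. c \<in> closed_walks v \<and> (\<forall>\<delta>. \<delta> \<in> closed_walks v \<longrightarrow> length c \<le> length \<delta>)"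
    using ex_has_least_nat[of "\<lambda>c. c \<in> closed_walks v" \<gamma> length] \<gamma> C(2) by blast
  then obtain c where c: "c \<in> closed_walks v" "\<And>\<delta>. \<delta> \<in> closed_walks v \<Longrightarrow> length c \<le> length \<delta>" by blast
  have "no_exit_cycle E \<kappa> p s t I v c"
  proof unfold_locales
    show "c \<in> closed_walks v" "\<And>\<delta>. \<delta> \<in> closed_walks v \<Longrightarrow> length c \<le> length \<delta>" using c by auto
  next
    fix \<mu> w \<nu> x assume "awalk v \<mu> w" "awalk v \<nu> x"
    moreover have "\<gamma> \<noteq> []" using \<gamma> C(2) by (auto simp: closed_walks_def)
    ultimately have *: "prefix \<mu> (walk_power (length \<mu>) \<gamma>)"
      "prefix \<nu> (walk_power (length \<nu>) \<gamma>)"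
      using conj prefix_replicate_append by blast+
    have le: "prefix (walk_power i \<gamma>) (walk_power (i + j) \<gamma>)" for i j
      by (simp add: replicate_add)
    have "prefix \<mu> (walk_power (length \<mu> + length \<nu>) \<gamma>)"
      "prefix \<nu> (walk_power (length \<mu> + length \<nu>) \<gamma>)"
      using prefix_order.trans[OF *(1) le, of "length \<nu>"]
        prefix_order.trans[OF *(2) le, of "length \<mu>"] by (auto simp: add.commute)
    then show "\<not> \<mu> \<parallel> \<nu>" using prefix_same_cases by (auto simp: parallel_def)
  next
    fix \<mu> w assume \<mu>: "awalk v \<mu> w"
    then have w: "w \<in> verts E" by auto
    obtain D l where D: "P w D l" using conj[OF \<mu>] by blast
    \<comment> \<open>Some monic element at \<open>w\<close> lies in \<open>I\<close>; with
      \<open>F = {}\<close> this excludes the second alternative of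
      \<open>vertex_cases\<close>.\<close>
    have "\<not> (\<forall>F. finite F \<longrightarrow> F \<subseteq> out_arcs E w \<longrightarrow> cut w F \<notin> I)"
    proof
      assume "\<forall>F. finite F \<longrightarrow> F \<subseteq> out_arcs E w \<longrightarrow> cut w F \<notin> I"
      from monic_elt_notin_singular(1)[OF w this, of D "{}" l] D I_left[of "cut w {}"] alg_cut[OF w, of "{}"]
      show False by (auto simp: P_def)
    qed
    then show "finite (out_arcs E w) \<and> cut w (out_arcs E w) = 0" using vertex_cases[OF w] by blast
  qed
  then show False using no_exit_cycle_contradiction C by blast
qed

end

section \<open>Free algebras and linear endomorphisms\<close>

abbreviation "sgl \<equiv> Poly_Mapping.single"
abbreviation "supp \<equiv> Poly_Mapping.keys"
abbreviation "coef \<equiv> Poly_Mapping.lookup"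

type_synonym ('p, 'e, 'k) leavitt_falg = "(('p, 'e) leavitt_gen, 'k) falg"

lemma poly_mapping_sum_single: "a = (\<Sum>k\<in>supp a. sgl k (coef a k))"
  by (rule poly_mapping_eqI)
    (simp add: lookup_sum lookup_single when_def in_keys_iff)

lemma poly_mapping_single_induct [case_names single add]:
  fixes a :: "'a \<Rightarrow>\<^sub>0 'b::comm_monoid_add"
  assumes "\<And>k c. P (sgl k c)" "\<And>a b. P a \<Longrightarrow> P b \<Longrightarrow> P (a + b)"
  shows "P a"
proof -
  have "P (\<Sum>k\<in>K. sgl k (f k))" if "finite K" for K f
    using that
  proof (induction K)
    case empty
    then show ?case using assms(1)[of undefined 0] by simp
  qed (simp add: assms)
  then show ?thesis using poly_mapping_sum_single[of a] by (metis finite_keys)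
qed

definition smul :: "'k::field \<Rightarrow> ('b \<Rightarrow>\<^sub>0 'k) \<Rightarrow> ('b \<Rightarrow>\<^sub>0 'k)" where
  "smul c = Poly_Mapping.map ((*) c)"

lemma lookup_smul [simp]: "coef (smul c a) k = c * coef a k"
  by (simp add: smul_def Poly_Mapping.map.rep_eq when_def)

lemma smul_single [simp]: "smul c (sgl k d) = sgl k (c * d)"
  by (rule poly_mapping_eqI) (simp add: lookup_single when_def)

interpretation pm: vector_space "smul :: 'k::field \<Rightarrow> ('b \<Rightarrow>\<^sub>0 'k) \<Rightarrow> _"
  by unfold_locales (auto intro!: poly_mapping_eqI simp: lookup_add algebra_simps)

interpretation pmp: vector_space_pair
  "smul :: 'k::field \<Rightarrow> ('b \<Rightarrow>\<^sub>0 'k) \<Rightarrow> _" "smul :: 'k::field \<Rightarrow> ('c \<Rightarrow>\<^sub>0 'k) \<Rightarrow> _" ..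

text \<open>A quotient by a variable ideal is not a type, so a ring type that does not mention the
  ideal is needed. Endomorphisms of a fixed space serve for all quotients, and again for the
  representation of the ultragraph algebra.\<close>

typedef (overloaded) ('b, 'k) lin_endo =
  "{f :: ('b \<Rightarrow>\<^sub>0 'k::field) \<Rightarrow> ('b \<Rightarrow>\<^sub>0 'k).
    (\<forall>x y. f (x + y) = f x + f y) \<and> (\<forall>c x. f (smul c x) = smul c (f x))}"
  by (rule exI[of _ id]) simp

definition app :: "('b, 'k::field) lin_endo \<Rightarrow> ('b \<Rightarrow>\<^sub>0 'k) \<Rightarrow> ('b \<Rightarrow>\<^sub>0 'k)" where
  "app = Rep_lin_endo"

lemma app_Abs:
  "(\<And>x y. f (x + y) = f x + f y) \<Longrightarrow> (\<And>c x. f (smul c x) = smul c (f x)) \<Longrightarrow> app (Abs_lin_endo f) = f"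
  unfolding app_def by (rule Abs_lin_endo_inverse) simp

lemma app_add [simp]: "app f (x + y) = app f x + app f y"
  and app_smul [simp]: "app f (smul c x) = smul c (app f x)"
  using Rep_lin_endo[of f] by (simp_all add: app_def)

lemma app_0 [simp]: "app f 0 = 0"
  using app_add[of f 0 0] by simp

lemma lin_endo_eqI: "(\<And>x. app f x = app g x) \<Longrightarrow> f = g"
  unfolding app_def by (rule Rep_lin_endo_inject[THEN iffD1], rule ext)

instantiation lin_endo :: (type, field) ring_1
begin

definition zero_lin_endo :: "('a, 'b) lin_endo" where
  "0 = Abs_lin_endo (\<lambda>_. 0)"
definition one_lin_endo :: "('a, 'b) lin_endo" where
  "1 = Abs_lin_endo (\<lambda>x. x)"
definition plus_lin_endo :: "('a, 'b) lin_endo \<Rightarrow> ('a, 'b) lin_endo \<Rightarrow> ('a, 'b) lin_endo" where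
  "f + g = Abs_lin_endo (\<lambda>x. app f x + app g x)"
definition minus_lin_endo :: "('a, 'b) lin_endo \<Rightarrow> ('a, 'b) lin_endo \<Rightarrow> ('a, 'b) lin_endo" where
  "f - g = Abs_lin_endo (\<lambda>x. app f x - app g x)"
definition uminus_lin_endo :: "('a, 'b) lin_endo \<Rightarrow> ('a, 'b) lin_endo" where
  "- f = Abs_lin_endo (\<lambda>x. - app f x)"
definition times_lin_endo :: "('a, 'b) lin_endo \<Rightarrow> ('a, 'b) lin_endo \<Rightarrow> ('a, 'b) lin_endo" where
  "f * g = Abs_lin_endo (\<lambda>x. app f (app g x))"

lemma app_ring [simp]:
  fixes f g :: "('a, 'b) lin_endo"
  shows "app (0 :: ('a, 'b) lin_endo) x = 0" "app (1 :: ('a, 'b) lin_endo) x = x"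
    "app (f + g) x = app f x + app g x" "app (f - g) x = app f x - app g x"
    "app (- f) x = - app f x" "app (f * g) x = app f (app g x)"
  unfolding zero_lin_endo_def one_lin_endo_def plus_lin_endo_def minus_lin_endo_def
    uminus_lin_endo_def times_lin_endo_def
  by (simp_all add: app_Abs pm.scale_right_distrib pm.scale_right_diff_distrib)

instance
proof
  show "(0 :: ('a, 'b) lin_endo) \<noteq> 1"
  proof
    assume "(0 :: ('a, 'b) lin_endo) = 1"
    then have "app (0 :: ('a, 'b) lin_endo) (sgl undefined 1) = sgl undefined 1"
      by simp
    then have "coef (0 :: 'a \<Rightarrow>\<^sub>0 'b) undefined = 1" by (metis app_ring(1) lookup_single_eq)
    then show False by simp
  qed
qed (rule lin_endo_eqI, simp add: algebra_simps)+

end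

lemma lin_endo_eq_singleI:
  assumes "\<And>k. app f (sgl k 1) = app g (sgl k 1)"
  shows "f = g"
proof (rule lin_endo_eqI)
  show "app f x = app g x" for x
  proof (induction x rule: poly_mapping_single_induct)
    case (single k c)
    have "sgl k c = smul c (sgl k 1)" by simp
    then show ?case using assms by (metis app_smul)
  qed simp
qed

definition scalar :: "'k::field \<Rightarrow> ('b, 'k) lin_endo" where
  "scalar c = Abs_lin_endo (smul c)"

lemma app_scalar [simp]: "app (scalar c) x = smul c x"
  unfolding scalar_def by (simp add: app_Abs pm.scale_right_distrib pm.scale_left_commute)

lemma scalar_simps: "scalar (a + b) = scalar a + scalar b" "scalar (a * b) = scalar a * scalar b"
  "scalar 1 = 1" "scalar a * x = x * scalar a"
  by (auto intro!: lin_endo_eqI simp: pm.scale_left_distrib)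

section \<open>Words, central scalars and the universal property of the free algebra\<close>

abbreviation word :: "'x list \<Rightarrow> ('x, 'k::field) falg" where
  "word xs \<equiv> sgl (FWord xs) 1"

definition scal :: "'k::field \<Rightarrow> ('x, 'k) falg" where
  "scal c = sgl 0 c"

lemma word_Nil: "word [] = 1"
  by (simp flip: zero_fword_def)

lemma word_append: "word (xs @ ys) = word xs * word ys"
  by (simp add: mult_single plus_fword_def)

lemma word_Cons: "word (x # xs) = gen x * word xs"
  using word_append[of "[x]" xs] by (simp add: gen_def)

lemma word_prod_list: "word xs = prod_list (map gen xs)"
  by (induction xs) (simp_all only: word_Nil word_Cons list.map prod_list.Nil prod_list.Cons)

lemma scal_mult: "scal c * a = smul c a"
  by (simp add: scal_def smul_def mult_map_scale_conv_mult)

lemma fscale_eq: "fscale c a = scal c * a"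
  by (simp add: fscale_def scal_mult smul_def)

lemma smul_mult: "smul c a * b = smul c (a * (b :: ('x, 'k::field) falg))"
  by (simp add: mult.assoc flip: scal_mult)

lemma mult_smul: "a * smul c b = smul c (a * (b :: ('x, 'k::field) falg))"
proof (induction a rule: poly_mapping_single_induct)
  case (single k d)
  show ?case
    by (induction b rule: poly_mapping_single_induct)
      (simp_all add: mult_single distrib_left pm.scale_right_distrib mult.left_commute)
qed (simp add: distrib_right pm.scale_right_distrib)

lemma scal_commute: "scal c * a = a * scal c"
proof -
  have "a * scal c = a * smul c 1" by (simp flip: scal_mult)
  then show ?thesis by (simp add: mult_smul scal_mult)
qed

lemma scal_simps: "scal (a + b) = scal a + scal b" "scal (a * b) = scal a * scal b" "scal 1 = 1"
  "scal 0 = 0" "scal (- a) = - scal a"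
  by (simp_all add: scal_def single_add mult_single single_uminus)

lemma single_eq_scal_word: "sgl w c = scal c * word (letters w)"
  by (simp add: scal_mult)

lemma falg_induct [case_names one gen add scale]:
  assumes "P 1" "\<And>x a. P a \<Longrightarrow> P (gen x * a)" "\<And>a b. P a \<Longrightarrow> P b \<Longrightarrow> P (a + b)"
    "\<And>c a. P a \<Longrightarrow> P (scal c * a)"
  shows "P a"
proof (induction a rule: poly_mapping_single_induct)
  case (single w c)
  have "P (word xs)" for xs
    by (induction xs) (simp_all only: word_Nil word_Cons assms)
  then have "P (scal c * word (letters w))" by (rule assms)
  then show ?case by (simp only: single_eq_scal_word[of w c])
qed (rule assms)

definition lift :: "('k::field \<Rightarrow> 'r::ring_1) \<Rightarrow> ('x \<Rightarrow> 'r) \<Rightarrow> ('x, 'k) falg \<Rightarrow> 'r" where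
  "lift \<kappa> \<phi> a = (\<Sum>w\<in>supp a. \<kappa> (coef a w) * prod_list (map \<phi> (letters w)))"

text \<open>A type class ring carries no scalars, so the field acts through a central homomorphism.
  Three targets of \<open>lift\<close> share this interface: the graded ring, the free algebra
  itself and linear endomorphisms.\<close>

locale scalar_hom =
  fixes \<kappa> :: "'k::field \<Rightarrow> 'r::ring_1"
  assumes add: "\<kappa> (a + b) = \<kappa> a + \<kappa> b"
    and mult: "\<kappa> (a * b) = \<kappa> a * \<kappa> b"
    and one: "\<kappa> 1 = 1"
    and commute: "\<kappa> a * x = x * \<kappa> a"
begin

lemma zero: "\<kappa> 0 = 0"
  using add[of 0 0] by simp

lemma lift_single: "lift \<kappa> \<phi> (sgl w c) = \<kappa> c * prod_list (map \<phi> (letters w))"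
  by (cases "c = 0") (simp_all add: lift_def zero)

lemma lift_add: "lift \<kappa> \<phi> (a + b) = lift \<kappa> \<phi> a + lift \<kappa> \<phi> b"
proof -
  let ?K = "supp a \<union> supp b"
  have *: "lift \<kappa> \<phi> c = (\<Sum>w\<in>?K. \<kappa> (coef c w) * prod_list (map \<phi> (letters w)))"
    if "supp c \<subseteq> ?K" for c
    unfolding lift_def using that
    by (intro sum.mono_neutral_left) (auto simp: zero in_keys_iff)
  show ?thesis
    using *[of a] *[of b] *[of "a + b"] keys_add[of a b]
    by (simp add: lookup_add add distrib_right sum.distrib)
qed

lemma lift_0: "lift \<kappa> \<phi> 0 = 0"
  by (simp add: lift_def)

lemma lift_uminus: "lift \<kappa> \<phi> (- a) = - lift \<kappa> \<phi> a"
  using lift_add[of \<phi> a "- a"] by (simp add: lift_0 eq_neg_iff_add_eq_0 add.commute)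

lemma lift_diff: "lift \<kappa> \<phi> (a - b) = lift \<kappa> \<phi> a - lift \<kappa> \<phi> b"
  using lift_add[of \<phi> a "- b"] by (simp add: lift_uminus)

lemma lift_sum: "lift \<kappa> \<phi> (sum f M) = (\<Sum>i\<in>M. lift \<kappa> \<phi> (f i))"
  by (induction M rule: infinite_finite_induct) (simp_all add: lift_0 lift_add)

lemma lift_mult: "lift \<kappa> \<phi> (a * b) = lift \<kappa> \<phi> a * lift \<kappa> \<phi> b"
proof (induction a rule: poly_mapping_single_induct)
  case (single u c)
  show ?case
  proof (induction b rule: poly_mapping_single_induct)
    case (single w d)
    have "\<kappa> c * (prod_list (map \<phi> (letters u)) * (\<kappa> d * prod_list (map \<phi> (letters w)))) =
      \<kappa> c * (\<kappa> d * (prod_list (map \<phi> (letters u)) * prod_list (map \<phi> (letters w))))"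
      by (metis commute mult.assoc)
    then show ?case by (simp add: mult_single lift_single mult plus_fword_def mult.assoc)
  qed (simp add: distrib_left lift_add)
qed (simp add: distrib_right lift_add)

lemma lift_gen: "lift \<kappa> \<phi> (gen x) = \<phi> x"
  by (simp add: gen_def lift_single one)

lemma lift_scal: "lift \<kappa> \<phi> (scal c) = \<kappa> c"
  by (simp add: scal_def lift_single zero_fword_def)

lemma lift_1: "lift \<kappa> \<phi> 1 = 1"
  using lift_scal[of \<phi> 1] by (simp add: one scal_simps)

lemmas lift_simps = lift_0 lift_1 lift_add lift_uminus lift_diff lift_sum lift_mult lift_gen lift_scal

end

section \<open>Two-sided ideals and quotients as rings of endomorphisms\<close>

definition two_sided_ideal :: "'a::ring_1 set \<Rightarrow> bool" where
  "two_sided_ideal J \<longleftrightarrow> 0 \<in> J \<and> (\<forall>x\<in>J. \<forall>y\<in>J. x + y \<in> J) \<and> (\<forall>x\<in>J. \<forall>a. a * x \<in> J \<and> x * a \<in> J)"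

lemma
  assumes "two_sided_ideal J"
  shows two_sided_ideal_zero: "0 \<in> J"
    and two_sided_ideal_add: "x \<in> J \<Longrightarrow> y \<in> J \<Longrightarrow> x + y \<in> J"
    and two_sided_ideal_left: "x \<in> J \<Longrightarrow> a * x \<in> J"
    and two_sided_ideal_right: "x \<in> J \<Longrightarrow> x * a \<in> J"
  using assms by (auto simp: two_sided_ideal_def)

lemma two_sided_ideal_sum: "two_sided_ideal J \<Longrightarrow> (\<And>i. i \<in> M \<Longrightarrow> f i \<in> J) \<Longrightarrow> sum f M \<in> J"
  by (induction M rule: infinite_finite_induct)
    (auto intro: two_sided_ideal_zero two_sided_ideal_add)

inductive_set ideal_gen :: "'a::ring_1 set \<Rightarrow> 'a set" for S where
  zero: "0 \<in> ideal_gen S"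
| base: "x \<in> S \<Longrightarrow> x \<in> ideal_gen S"
| add: "x \<in> ideal_gen S \<Longrightarrow> y \<in> ideal_gen S \<Longrightarrow> x + y \<in> ideal_gen S"
| left: "x \<in> ideal_gen S \<Longrightarrow> a * x \<in> ideal_gen S"
| right: "x \<in> ideal_gen S \<Longrightarrow> x * a \<in> ideal_gen S"

lemma two_sided_ideal_gen: "two_sided_ideal (ideal_gen S)"
  by (auto simp: two_sided_ideal_def intro: ideal_gen.intros)

lemma ideal_gen_least: "two_sided_ideal J \<Longrightarrow> S \<subseteq> J \<Longrightarrow> ideal_gen S \<subseteq> J"
proof
  fix x assume "two_sided_ideal J" "S \<subseteq> J" "x \<in> ideal_gen S"
  from this(3) show "x \<in> J"
    by (induction rule: ideal_gen.induct)
      (use \<open>two_sided_ideal J\<close> \<open>S \<subseteq> J\<close> in \<open>auto simp: two_sided_ideal_def\<close>)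
qed

text \<open>Extend a basis of \<open>J\<close> to a basis of the whole space, send the former to
  zero and fix the added vectors.\<close>

lemma subspace_projection:
  assumes "pm.subspace J"
  obtains \<pi> :: "('b, 'k::field) lin_endo" where "\<And>x. x - app \<pi> x \<in> J" "\<And>x. x \<in> J \<Longrightarrow> app \<pi> x = 0"
proof -
  obtain B where B: "B \<subseteq> J" "pm.independent B" "J \<subseteq> pm.span B"
    using pm.basis_exists by metis
  define B' where "B' = pm.extend_basis B"
  have B': "B \<subseteq> B'" "pm.independent B'" "pm.span B' = UNIV"
    using pm.extend_basis_superset[OF B(2)] pm.independent_extend_basis[OF B(2)]
      pm.span_extend_basis[OF B(2)] by (auto simp: B'_def)
  define f where "f = pmp.construct B' (\<lambda>b. if b \<in> B then 0 else b)"
  have lin: "Vector_Spaces.linear smul smul f"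
    unfolding f_def by (rule pmp.linear_construct[OF B'(2)])
  then have add: "f (x + y) = f x + f y" and scale: "f (smul c x) = smul c (f x)" for x y c
    by (auto simp: Vector_Spaces.linear_iff)
  have f0: "f 0 = 0" using add[of 0 0] by simp
  have basis: "f b = (if b \<in> B then 0 else b)" if "b \<in> B'" for b
    unfolding f_def using pmp.construct_basis[OF B'(2) that] .
  define \<pi> where "\<pi> = Abs_lin_endo f"
  have app: "app \<pi> x = f x" for x
    unfolding \<pi>_def by (simp add: app_Abs add scale)
  have "x - f x \<in> J" for x
  proof -
    have "x \<in> pm.span B'" using B' by simp
    then show ?thesis
    proof (induction rule: pm.span_induct_alt)
      case base
      then show ?case using assms by (simp add: f0 pm.subspace_def)
    next
      case (step c b y)
      have "b - f b \<in> J" using basis[OF step(1)] B(1) assms by (auto simp: pm.subspace_def)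
      then have "smul c (b - f b) + (y - f y) \<in> J" using step assms by (auto simp: pm.subspace_def)
      then show ?case by (simp add: add scale pm.scale_right_diff_distrib algebra_simps)
    qed
  qed
  moreover have "f x = 0" if "x \<in> J" for x
  proof -
    have "x \<in> pm.span B" using that B by auto
    then show ?thesis
      by (induction rule: pm.span_induct_alt)
        (use basis B' in \<open>auto simp: f0 add scale\<close>)
  qed
  ultimately show thesis using that[of \<pi>] by (simp add: app)
qed

text \<open>The quotient \<open>F/J\<close>, identified with a linear complement of \<open>J\<close>, acts on itself by left
  multiplication; this replaces congruences modulo \<open>J\<close> by equations in a ring.\<close>

lemma quotient_representation:
  fixes J :: "('x, 'k::field) falg set"
  assumes J: "two_sided_ideal J"
  obtains \<Psi> :: "('x, 'k) falg \<Rightarrow> ('x fword, 'k) lin_endo" where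
    "\<And>a b. \<Psi> (a + b) = \<Psi> a + \<Psi> b" "\<And>a b. \<Psi> (a * b) = \<Psi> a * \<Psi> b"
    "\<And>c a. \<Psi> (scal c * a) = scalar c * \<Psi> a" "\<And>a. \<Psi> a = 0 \<longleftrightarrow> a \<in> J"
proof -
  have "pm.subspace J"
    using J by (auto simp: pm.subspace_def two_sided_ideal_def simp flip: scal_mult)
  then obtain \<pi> :: "('x fword, 'k) lin_endo" where
    \<pi>: "\<And>x. x - app \<pi> x \<in> J" "\<And>x. x \<in> J \<Longrightarrow> app \<pi> x = 0"
    using subspace_projection by blast
  have diff: "app \<pi> (x - y) = app \<pi> x - app \<pi> y" for x y
    using app_add[of \<pi> "x - y" y] by simp
  have \<pi>_eq: "app \<pi> x = app \<pi> y" if "x - y \<in> J" for x y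
    using \<pi>(2)[OF that] by (simp add: diff)
  define \<Psi> where "\<Psi> a = \<pi> * Abs_lin_endo (\<lambda>x. a * x) * \<pi>" for a
  have "app (Abs_lin_endo (\<lambda>x. a * x)) y = a * y" for a y :: "('x, 'k) falg"
    by (simp add: app_Abs distrib_left mult_smul)
  then have app: "app (\<Psi> a) x = app \<pi> (a * app \<pi> x)" for a x
    by (simp add: \<Psi>_def)
  have mult: "\<Psi> (a * b) = \<Psi> a * \<Psi> b" for a b
  proof (rule lin_endo_eqI)
    fix x
    have "a * (b * app \<pi> x - app \<pi> (app \<pi> (b * app \<pi> x))) \<in> J"
    proof (rule two_sided_ideal_left[OF J])
      have "b * app \<pi> x - app \<pi> (b * app \<pi> x) \<in> J" by (rule \<pi>)
      moreover have "app \<pi> (b * app \<pi> x) - app \<pi> (app \<pi> (b * app \<pi> x)) \<in> J" by (rule \<pi>)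
      ultimately show "b * app \<pi> x - app \<pi> (app \<pi> (b * app \<pi> x)) \<in> J"
        using two_sided_ideal_add[OF J] by fastforce
    qed
    then show "app (\<Psi> (a * b)) x = app (\<Psi> a * \<Psi> b) x"
      unfolding app app_ring by (intro \<pi>_eq) (simp add: right_diff_distrib mult.assoc)
  qed
  \<comment> \<open>Evaluation at \<open>1\<close> recovers \<open>a\<close> modulo
    \<open>J\<close>, because \<open>app \<pi> 1\<close> differs from \<open>1\<close> by an element
    of \<open>J\<close>.\<close>
  have "a \<in> J" if "\<Psi> a = 0" for a
  proof -
    have "a * app \<pi> 1 - app \<pi> (a * app \<pi> 1) \<in> J" by (rule \<pi>)
    moreover have "app \<pi> (a * app \<pi> 1) = 0" using that app[of a 1] by simp
    moreover have "a * (1 - app \<pi> 1) \<in> J" by (intro two_sided_ideal_left[OF J] \<pi>)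
    ultimately have "a * app \<pi> 1 + a * (1 - app \<pi> 1) \<in> J" using two_sided_ideal_add[OF J] by auto
    then show ?thesis by (simp flip: distrib_left)
  qed
  moreover have "\<Psi> a = 0" if "a \<in> J" for a
    using that two_sided_ideal_right[OF J] by (intro lin_endo_eqI) (simp add: app \<pi>(2))
  moreover have "\<Psi> (a + b) = \<Psi> a + \<Psi> b" for a b
    by (rule lin_endo_eqI) (simp add: app distrib_right)
  moreover have "\<Psi> (scal c * a) = scalar c * \<Psi> a" for a c
    by (rule lin_endo_eqI) (simp add: app scal_mult smul_mult)
  ultimately show thesis using that mult by blast
qed

section \<open>Idempotent ideals of Leavitt path algebras of graphs with finitely many vertices\<close>

primrec gen_degree :: "('p, 'e) leavitt_gen \<Rightarrow> int" where
  "gen_degree (Proj v) = 0"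
| "gen_degree (Edge e) = 1"
| "gen_degree (Ghost e) = - 1"

interpretation graded: scalar_hom "\<lambda>c. sgl (0::int) (scal c :: ('x, 'k::field) falg)"
proof
  fix a and x :: "int \<Rightarrow>\<^sub>0 ('x, 'k) falg"
  show "sgl 0 (scal a) * x = x * sgl 0 (scal a)"
  proof (induction x rule: poly_mapping_single_induct)
    case (single k c)
    then show ?case using scal_commute[of a c] by (simp add: mult_single)
  qed (simp add: distrib_left distrib_right)
qed (simp_all add: scal_simps single_add mult_single)

text \<open>The values are Laurent polynomials over the free algebra. Each letter is multiplied by
  the variable to the power of its degree, so the coefficients of \<open>grading a\<close> are the
  homogeneous components of \<open>a\<close>.\<close>

definition grading :: "('p, 'e, 'k::field) leavitt_falg \<Rightarrow> int \<Rightarrow>\<^sub>0 ('p, 'e, 'k) leavitt_falg"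
  where "grading = lift (\<lambda>c. sgl 0 (scal c)) (\<lambda>x. sgl (gen_degree x) (gen x))"

lemmas grading_simps = graded.lift_simps[where \<phi> = "\<lambda>x. sgl (gen_degree x) (gen x)",
  folded grading_def]

text \<open>As \<open>grading\<close> is multiplicative, multiples of an element with all components
  in the ideal inherit this property; homogeneous generators start the induction.\<close>

lemma grading_ideal_gen:
  assumes "\<And>x. x \<in> S \<Longrightarrow> \<exists>d. grading x = sgl d x" "a \<in> ideal_gen S"
  shows "coef (grading a) n \<in> ideal_gen S"
proof -
  let ?J = "ideal_gen S"
  note J = two_sided_ideal_gen[of S]
  have mult: "coef (x * y) n \<in> ?J"
    if "(\<forall>n. coef x n \<in> ?J) \<or> (\<forall>n. coef y n \<in> ?J)" for x y n
  proof -
    have "x * y = (\<Sum>k\<in>supp x. \<Sum>m\<in>supp y.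
      sgl (k + m) (coef x k * coef y m))"
      by (subst poly_mapping_sum_single[of x], subst poly_mapping_sum_single[of y])
        (simp add: sum_product mult_single)
    then have "coef (x * y) n = (\<Sum>k\<in>supp x. \<Sum>m\<in>supp y.
      if k + m = n then coef x k * coef y m else 0)"
      by (simp add: lookup_sum lookup_single when_def)
    also have "\<dots> \<in> ?J"
      using that J by (intro two_sided_ideal_sum[OF J])
        (auto intro: two_sided_ideal_zero two_sided_ideal_left two_sided_ideal_right)
    finally show ?thesis .
  qed
  show ?thesis using assms(2)
  proof (induction arbitrary: n rule: ideal_gen.induct)
    case (base x)
    then obtain d where "grading x = sgl d x" using assms(1) by blast
    then show ?case using base by (auto simp: lookup_single when_def intro: ideal_gen.intros)
  qed (auto simp: grading_simps lookup_add intro: ideal_gen.intros mult)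
qed

definition lpa_letters :: "('v, 'e) pre_digraph \<Rightarrow> ('v, 'e) leavitt_gen set" where
  "lpa_letters E = Proj ` verts E \<union> Edge ` arcs E \<union> Ghost ` arcs E"

text \<open>They turn the non-unital presentation into a unital one over the full type of letters:
  letters foreign to \<open>E\<close> become zero, and the vertices in \<open>W\<close> sum to
  one.\<close>

definition lpa_relators :: "('v, 'e) pre_digraph \<Rightarrow> 'v set \<Rightarrow> ('v, 'e, 'k::field) leavitt_falg set"
  where "lpa_relators E W =
    {a - b | a b. digraph_rel E a b} \<union> gen ` (- lpa_letters E) \<union> {1 - (\<Sum>w\<in>W. pj w)}"

definition surviving_arcs :: "('v, 'e) pre_digraph \<Rightarrow> 'v set \<Rightarrow> 'v \<Rightarrow> 'e set" where
  "surviving_arcs E V v = {e \<in> out_arcs E v. head E e \<in> V}"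

definition vertex_cut :: "'v \<Rightarrow> 'e set \<Rightarrow> ('v, 'e, 'k::field) leavitt_falg" where
  "vertex_cut v F = pj v - (\<Sum>e\<in>F. ed e * gh e)"

definition graded_gens ::
    "('v, 'e) pre_digraph \<Rightarrow> 'v set \<Rightarrow> 'v set \<Rightarrow> 'v set \<Rightarrow> ('v, 'e, 'k::field) leavitt_falg set"
  where "graded_gens E W H S =
    lpa_relators E W \<union> pj ` H \<union> (\<lambda>v. vertex_cut v (surviving_arcs E (W - H) v)) ` S"

lemma grading_ed_gh: "grading (\<Sum>e\<in>F. ed e * gh e) = sgl 0 (\<Sum>e\<in>F. ed e * gh e)"
  by (induction F rule: infinite_finite_induct) (simp_all add: grading_simps mult_single single_add)

lemma grading_sum_pj: "grading (\<Sum>w\<in>W. pj w) = sgl 0 (\<Sum>w\<in>W. pj w)"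
  by (induction W rule: infinite_finite_induct) (simp_all add: grading_simps mult_single single_add)

lemma graded_gens_homogeneous:
  fixes x :: "('v, 'e, 'k::field) leavitt_falg"
  assumes "x \<in> graded_gens E W H S"
  shows "\<exists>d. grading x = sgl d x"
proof -
  have rel: "\<exists>d. grading (a - b) = sgl d (a - b)" if "digraph_rel E a b"
    for a b :: "('v, 'e, 'k::field) leavitt_falg" and E :: "('v, 'e) pre_digraph"
    using that
  proof -
    from that have "\<exists>d. grading a = sgl d a \<and> grading b = sgl d b"
      by cases (auto simp: grading_simps(1-5,7-9) mult_single grading_ed_gh)
    then show ?thesis by (auto simp: grading_simps(5) single_diff)
  qed
  have cut: "grading (vertex_cut v F) = sgl 0 (vertex_cut v F :: ('v, 'e, 'k::field) leavitt_falg)"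
    for v :: 'v and F :: "'e set"
    by (simp add: vertex_cut_def grading_simps(1-5,7-9) grading_ed_gh single_diff)
  have one: "grading (1 - (\<Sum>w\<in>W. pj w)) = sgl 0 (1 - (\<Sum>w\<in>W. pj w))"
    by (simp add: grading_simps(1-5,7-9) grading_sum_pj single_diff)
  from assms show ?thesis
    unfolding graded_gens_def lpa_relators_def using rel cut one by (auto simp: grading_simps)
qed

text \<open>Modulo the right-hand side, the image of \<open>I\<close> satisfies the assumptions of
  \<open>idempotent_leavitt_ideal\<close> for the graph that is left on \<open>W - H\<close>, so it
  vanishes by \<open>ideal_eq_zero\<close>.\<close>

lemma idempotent_ideal_eq:
  fixes I :: "('v, 'e, 'k::field) leavitt_falg set"
  assumes E: "wf_digraph E" and W: "finite W" "W \<subseteq> verts E"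
    and I: "two_sided_ideal I" "lpa_relators E W \<subseteq> I"
    and idem: "I \<subseteq> prod_sum (ideal_gen (lpa_relators E W)) I"
  defines "H \<equiv> {v \<in> W. pj v \<in> I}"
  defines "S \<equiv> {v \<in> W - H. finite (surviving_arcs E (W - H) v) \<and>
    vertex_cut v (surviving_arcs E (W - H) v) \<in> I}"
  shows "I = ideal_gen (graded_gens E W H S)"
proof
  interpret wf_digraph E by fact
  define V where "V = W - H"
  define J :: "('v, 'e, 'k) leavitt_falg set" where "J = ideal_gen (graded_gens E W H S)"
  have J: "two_sided_ideal J" unfolding J_def by (rule two_sided_ideal_gen)
  have gens_I: "graded_gens E W H S \<subseteq> I"
    using I(2) by (auto simp: graded_gens_def H_def S_def)
  then show JI: "ideal_gen (graded_gens E W H S) \<subseteq> I" by (rule ideal_gen_least[OF I(1)])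
  have gens_J: "graded_gens E W H S \<subseteq> J" by (auto simp: J_def intro: ideal_gen.base)
  obtain \<Psi> :: "('v, 'e, 'k) leavitt_falg \<Rightarrow> (('v, 'e) leavitt_gen fword, 'k) lin_endo" where
    add: "\<And>a b. \<Psi> (a + b) = \<Psi> a + \<Psi> b" and mult: "\<And>a b. \<Psi> (a * b) = \<Psi> a * \<Psi> b" and
    scale: "\<And>c a. \<Psi> (scal c * a) = scalar c * \<Psi> a" and ker: "\<And>a. \<Psi> a = 0 \<longleftrightarrow> a \<in> J"
    using quotient_representation[OF J] by blast
  have zero: "\<Psi> 0 = 0" using add[of 0 0] by simp
  have diff: "\<Psi> (a - b) = \<Psi> a - \<Psi> b" for a b using add[of "a - b" b] by simp
  have sum: "\<Psi> (sum f M) = (\<Sum>i\<in>M. \<Psi> (f i))" for f :: "'z \<Rightarrow> _" and M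
    by (induction M rule: infinite_finite_induct) (simp_all add: zero add)
  have eqI: "\<Psi> a = \<Psi> b" if "a - b \<in> J" for a b using that ker[of "a - b"] by (simp add: diff)
  have rel: "\<Psi> a = \<Psi> b" if "digraph_rel E a b" for a b
    using that gens_J by (intro eqI) (auto simp: graded_gens_def lpa_relators_def)
  define p s t where "p v = \<Psi> (pj v)" and "s e = \<Psi> (ed e)" and "t e = \<Psi> (gh e)" for v e
  have letter0: "\<Psi> (gen x) = 0" if "x \<notin> lpa_letters E" for x
    using that gens_J ker by (auto simp: graded_gens_def lpa_relators_def)
  have unit: "\<Psi> 1 = (\<Sum>w\<in>W. p w)"
    unfolding p_def sum[symmetric] using gens_J
    by (intro eqI) (auto simp: graded_gens_def lpa_relators_def)
  have one_mult: "\<Psi> a = (\<Sum>w\<in>W. p w) * \<Psi> a" for a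
    using mult[of 1 a] unit by simp
  have pp: "p v * p w = (if v = w then p v else 0)" if "v \<in> verts E" "w \<in> verts E" for v w
    using rel[OF digraph_rel.vertices[OF that]] by (simp add: p_def mult zero split: if_splits)
  have ps: "p (tail E e) * s e = s e" "s e * p (head E e) = s e" "p (head E e) * t e = t e"
    "t e * p (tail E e) = t e" if "e \<in> arcs E" for e
    using rel[OF digraph_rel.source_edge[OF that]] rel[OF digraph_rel.edge_range[OF that]]
      rel[OF digraph_rel.range_ghost[OF that]] rel[OF digraph_rel.ghost_source[OF that]]
    by (simp_all add: p_def s_def t_def mult)
  have ts: "t e * s f = (if e = f then p (head E e) else 0)" if "e \<in> arcs E" "f \<in> arcs E" for e f
    using rel[OF digraph_rel.ghost_edge[OF that]]
    by (simp add: p_def s_def t_def mult zero split: if_splits)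
  have p0: "p v = 0" if "v \<notin> V" for v
  proof (cases "v \<in> verts E")
    case True
    show ?thesis
    proof (cases "v \<in> H")
      case True
      then show ?thesis using gens_J ker by (auto simp: p_def graded_gens_def)
    next
      case False
      then have "v \<notin> W" using that by (simp add: V_def)
      then have "(\<Sum>w\<in>W. p w) * p v = 0"
        using pp[OF _ True] W(2) by (auto simp: sum_distrib_right intro!: sum.neutral)
      then show ?thesis using one_mult[of "pj v"] by (simp add: p_def)
    qed
  next
    case False
    then show ?thesis using letter0[of "Proj v"] by (auto simp: p_def lpa_letters_def)
  qed
  have VW: "V \<subseteq> verts E" "finite V" using W by (auto simp: V_def)
  have mem_I: "\<Psi> a \<in> \<Psi> ` I \<longleftrightarrow> a \<in> I" for a
  proof
    assume "\<Psi> a \<in> \<Psi> ` I"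
    then obtain b where b: "b \<in> I" "\<Psi> a = \<Psi> b" by auto
    then have "a - b \<in> I" using ker[of "a - b"] JI by (auto simp: diff J_def)
    then show "a \<in> I" using two_sided_ideal_add[OF I(1) _ b(1)] by fastforce
  qed simp
  have p_nin: "p v \<notin> \<Psi> ` I" if "v \<in> V" for v
    unfolding p_def mem_I using that by (auto simp: V_def H_def)
  have p_nz: "p v \<noteq> 0" if "v \<in> V" for v
    using p_nin[OF that] zero two_sided_ideal_zero[OF I(1)] by (metis imageI)
  \<comment> \<open>An edge whose tail vanishes is zero, and then its head vanishes as well. So the
    edges with head in \<open>V\<close> form a graph on \<open>V\<close>.\<close>
  have tail_V: "tail E e \<in> V" if "e \<in> arcs E" "head E e \<in> V" for e
  proof (rule ccontr)
    assume "tail E e \<notin> V"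
    then have "s e = 0" using p0 ps(1)[OF that(1)] by simp
    then show False using ts[OF that(1) that(1)] p_nz[OF that(2)] by simp
  qed
  have s0: "s e = 0" "t e = 0" if "e \<in> arcs E" "head E e \<notin> V" for e
    using ps[OF that(1)] p0[OF that(2)] by simp_all
  have s0': "s e = 0" "t e = 0" if "e \<notin> arcs E" for e
    unfolding s_def t_def using that by (auto intro!: letter0 simp: lpa_letters_def)
  define E' where "E' = \<lparr>verts = V, arcs = {e \<in> arcs E. head E e \<in> V}, tail = tail E, head = head E\<rparr>"
  have E'_simps [simp]: "verts E' = V" "arcs E' = {e \<in> arcs E. head E e \<in> V}"
    "tail E' = tail E" "head E' = head E" by (simp_all add: E'_def)
  have out: "out_arcs E' v = surviving_arcs E V v" for v
    by (auto simp: surviving_arcs_def out_arcs_def)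
  interpret Q: leavitt_quotient E' scalar p s t
    by unfold_locales
      (use VW tail_V in \<open>auto simp: scalar_simps(1-3) pp ps ts subset_iff intro: scalar_simps(4)\<close>)
  have alg: "\<Psi> a \<in> Q.alg" for a
  proof (induction a rule: falg_induct)
    case one
    have "(\<Sum>w\<in>W. p w) \<in> Q.alg"
    proof (rule Q.alg_sum)
      show "p w \<in> Q.alg" for w using p0[of w] Q.alg_p[of w] by (cases "w \<in> V") auto
    qed
    then show ?case by (simp add: unit)
  next
    case (gen x a)
    have "\<Psi> (gen x) \<in> Q.alg"
    proof (cases x)
      case (Proj v)
      then show ?thesis using p0[of v] Q.alg_p[of v] by (cases "v \<in> V") (auto simp: p_def)
    next
      case (Edge e)
      then show ?thesis using s0[of e] s0'[of e] Q.alg_s[of e]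
        by (cases "e \<in> arcs E"; cases "head E e \<in> V") (auto simp: s_def)
    next
      case (Ghost e)
      then show ?thesis using s0[of e] s0'[of e] Q.alg_t[of e]
        by (cases "e \<in> arcs E"; cases "head E e \<in> V") (auto simp: t_def)
    qed
    then show ?case using gen by (auto simp: mult)
  qed (auto simp: add scale)
  have range: "\<exists>a. x = \<Psi> a" if "x \<in> Q.alg" for x
    using that
  proof (induction rule: Q.alg.induct)
    case alg_zero
    show ?case using zero by metis
  next
    case (alg_add x y)
    then show ?case by (metis add)
  next
    case (alg_mult x y)
    then show ?case by (metis mult)
  next
    case (alg_scale x a)
    then show ?case by (metis scale)
  qed (auto simp: p_def s_def t_def)
  have cut: "Q.cut v F = \<Psi> (vertex_cut v F)" for v F
    by (simp add: Q.cut_def vertex_cut_def diff sum mult p_def s_def t_def)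
  interpret Q: leavitt_ideal E' scalar p s t "\<Psi> ` I"
  proof
    show "\<Psi> ` I \<subseteq> Q.alg" using alg by auto
    show "x + y \<in> \<Psi> ` I" if "x \<in> \<Psi> ` I" "y \<in> \<Psi> ` I" for x y
      using that two_sided_ideal_add[OF I(1)] by (auto simp flip: add)
    show "x * y \<in> \<Psi> ` I" if "x \<in> Q.alg" "y \<in> \<Psi> ` I" for x y
      using range[OF that(1)] that(2) two_sided_ideal_left[OF I(1)] by (auto simp flip: mult)
    show "x * y \<in> \<Psi> ` I" if "x \<in> \<Psi> ` I" "y \<in> Q.alg" for x y
      using range[OF that(2)] that(1) two_sided_ideal_right[OF I(1)] by (auto simp flip: mult)
    show "p v \<notin> \<Psi> ` I" if "v \<in> verts E'" for v using that p_nin by simp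
  next
    fix v assume v: "v \<in> verts E'"
    show "finite (out_arcs E' v) \<and> Q.cut v (out_arcs E' v) = 0 \<or>
      (\<forall>F. finite F \<longrightarrow> F \<subseteq> out_arcs E' v \<longrightarrow> Q.cut v F \<notin> \<Psi> ` I)"
    proof (rule disjCI)
      assume "\<not> (\<forall>F. finite F \<longrightarrow> F \<subseteq> out_arcs E' v \<longrightarrow> Q.cut v F \<notin> \<Psi> ` I)"
      then obtain F where F: "finite F" "F \<subseteq> out_arcs E' v" "vertex_cut v F \<in> I"
        unfolding cut mem_I by blast
      \<comment> \<open>If a surviving edge \<open>e\<close> were missing from \<open>F\<close>,
        multiplying the cut by \<open>t e\<close> and \<open>s e\<close> would put the vertex
        \<open>p (head E e)\<close> into \<open>I\<close>. So a cut in \<open>I\<close> uses all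
        surviving edges, and \<open>v \<in> S\<close>.\<close>
      have "e \<in> F" if e: "e \<in> out_arcs E' v" for e
      proof (rule ccontr)
        assume "e \<notin> F"
        then have "(\<Sum>f\<in>F. s f * t f) * s e = 0"
          using ts[of _ e] e F(2) by (auto simp: sum_distrib_right mult.assoc out_arcs_def intro!: sum.neutral)
        then have "t e * Q.cut v F * s e = p (head E e)"
          using e ps[of e] ts[of e e] by (auto simp: Q.cut_def right_diff_distrib left_diff_distrib mult.assoc)
        moreover have "t e * Q.cut v F * s e = \<Psi> (gh e * vertex_cut v F * ed e)"
          by (simp add: cut mult s_def t_def)
        moreover have "gh e * vertex_cut v F * ed e \<in> I"
          using F(3) by (intro two_sided_ideal_left[OF I(1)] two_sided_ideal_right[OF I(1)])
        ultimately have "p (head E e) \<in> \<Psi> ` I" by (metis mem_I)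
        then show False using p_nin[of "head E e"] e by auto
      qed
      then have F_eq: "F = surviving_arcs E V v" using F(2) out by auto
      then have "v \<in> S" using F v by (auto simp: S_def V_def)
      then have "vertex_cut v F \<in> J" using gens_J F_eq by (auto simp: graded_gens_def V_def)
      then show "finite (out_arcs E' v) \<and> Q.cut v (out_arcs E' v) = 0"
        using F(1) F_eq out ker cut by simp
    qed
  qed
  interpret Q: idempotent_leavitt_ideal E' scalar p s t "\<Psi> ` I"
  proof
    have "\<Psi> a \<in> prod_sum {0} (\<Psi> ` I)" if "a \<in> prod_sum (ideal_gen (lpa_relators E W)) I" for a
      using that
    proof (induction rule: prod_sum.induct)
      case (base x)
      have "ideal_gen (lpa_relators E W) \<subseteq> J"
        using gens_J by (intro ideal_gen_least[OF J]) (auto simp: graded_gens_def)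
      then show ?case using base ker by (auto intro: prod_sum.base)
    qed (auto simp: mult add intro: prod_sum.intros)
    then show "\<Psi> ` I \<subseteq> prod_sum {0} (\<Psi> ` I)" using idem by auto
  next
    fix c v g assume c: "c \<in> Q.closed_walks v" and 0: "Q.eval v (Q.path c v) g = 0"
    have cw: "pre_digraph.awalk E' v c v" "c \<noteq> []" using c by (auto simp: Q.closed_walks_def)
    have v: "v \<in> V" using Q.awalk_hd_in_verts[OF cw(1)] by simp
    \<comment> \<open>A lift of the cycle to a homogeneous element of degree
      \<open>length c\<close>.\<close>
    define C :: "('v, 'e, 'k) leavitt_falg" where "C = prod_list (map ed c) * pj v"
    have "Q.path \<alpha> w = \<Psi> (prod_list (map ed \<alpha>) * pj w)" for \<alpha> w
      by (induction \<alpha>) (simp_all add: mult mult.assoc flip: p_def s_def)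
    then have pathC: "Q.path c v = \<Psi> C" by (simp add: C_def)
    have power: "Q.path c v ^ i * p v = \<Psi> (C ^ i * pj v)" for i
      by (induction i) (simp_all add: pathC mult mult.assoc flip: p_def)
    define a where "a = (\<Sum>i\<le>degree g. scal (coeff g i) * (C ^ i * pj v))"
    have "\<Psi> a = 0"
      using 0 by (simp add: Q.eval_eq_sum a_def sum scale power)
    then have "a \<in> J" by (simp add: ker)
    have grC: "grading C = sgl (int (length c)) C"
    proof -
      have "grading (prod_list (map ed \<alpha>)) =
        sgl (int (length \<alpha>)) (prod_list (map ed \<alpha>) :: ('v, 'e, 'k) leavitt_falg)"
        for \<alpha> :: "'e list"
        by (induction \<alpha>) (simp_all add: grading_simps mult_single)
      then show ?thesis by (simp add: C_def grading_simps mult_single)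
    qed
    have "grading (C ^ i) = sgl (int i * int (length c)) (C ^ i)" for i
      by (induction i) (simp_all add: grading_simps grC mult_single algebra_simps)
    then have gr: "grading (scal k * (C ^ i * pj v)) =
      sgl (int i * int (length c)) (scal k * (C ^ i * pj v))" for i k
      by (simp add: grading_simps mult_single)
    \<comment> \<open>As \<open>c\<close> is not empty, distinct powers have distinct degrees, so
      each term of the relation lies in \<open>J\<close> separately. A non-zero coefficient would
      make a power of the cycle zero, and its ghost would then give \<open>p v = 0\<close>.\<close>
    have coeff0: "coeff g i = 0" if "i \<le> degree g" for i
    proof (rule ccontr)
      assume nz: "coeff g i \<noteq> 0"
      have "coef (grading a) (int i * int (length c)) =
        (\<Sum>j\<le>degree g. if j = i then scal (coeff g j) * (C ^ j * pj v) else 0)"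
        using cw(2) by (simp add: a_def grading_simps(6) gr lookup_sum lookup_single when_def)
      also have "\<dots> = scal (coeff g i) * (C ^ i * pj v)" using that by simp
      finally have "scal (coeff g i) * (C ^ i * pj v) \<in> J"
        using grading_ideal_gen[OF graded_gens_homogeneous \<open>a \<in> J\<close>[unfolded J_def],
            where n = "int i * int (length c)"]
        by (simp only: J_def)
      then have "scalar (coeff g i) * (Q.path c v ^ i * p v) = 0"
        unfolding power scale[symmetric] ker .
      then have "Q.path (walk_power i c) v = 0"
        using Q.path_power[OF cw(1)] Q.kappa_inverse[OF nz] by (metis mult_zero_right)
      then have "p v = 0"
        using Q.ghost_path_self[OF Q.awalk_concat_replicate[OF cw(1)]] by (metis mult_zero_right)
      then show False using p_nz v by simp
    qed
    show "g = 0"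
      using coeff0 by (metis leading_coeff_0_iff order_refl)
  qed
  have "\<Psi> ` I \<subseteq> {0}" by (rule Q.ideal_eq_zero)
  then show "I \<subseteq> ideal_gen (graded_gens E W H S)" using ker by (auto simp: J_def)
qed

section \<open>Ideals of non-unital free algebras\<close>

definition free_unital :: "'x set \<Rightarrow> ('x, 'k::field) falg set" where
  "free_unital X = {a. \<forall>w\<in>supp a. set (letters w) \<subseteq> X}"

lemma free_nu_subset_unital: "free_nu X \<subseteq> free_unital X"
  by (auto simp: free_nu_def free_unital_def)

lemma free_nu_zero [simp]: "0 \<in> free_nu X"
  by (simp add: free_nu_def)

lemma free_nu_gen [simp]: "gen x \<in> free_nu X \<longleftrightarrow> x \<in> X"
  by (simp add: free_nu_def gen_def)

lemma free_nu_add: "a \<in> free_nu X \<Longrightarrow> b \<in> free_nu X \<Longrightarrow> a + b \<in> free_nu X"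
  using keys_add[of a b] by (auto simp: free_nu_def)

lemma free_unital_add: "a \<in> free_unital X \<Longrightarrow> b \<in> free_unital X \<Longrightarrow> a + b \<in> free_unital X"
  using keys_add[of a b] by (auto simp: free_unital_def)

lemma free_unital_mult: "a \<in> free_unital X \<Longrightarrow> b \<in> free_unital X \<Longrightarrow> a * b \<in> free_unital X"
  using keys_mult[of a b] by (fastforce simp: free_unital_def plus_fword_def)

lemma free_nu_mult_left: "a \<in> free_unital X \<Longrightarrow> b \<in> free_nu X \<Longrightarrow> a * b \<in> free_nu X"
  using keys_mult[of a b] by (fastforce simp: free_unital_def free_nu_def plus_fword_def)

lemma free_nu_mult: "a \<in> free_nu X \<Longrightarrow> b \<in> free_nu X \<Longrightarrow> a * b \<in> free_nu X"
  using free_nu_mult_left free_nu_subset_unital by blast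

lemma free_unital_scal [simp]: "scal c \<in> free_unital X"
  by (simp add: free_unital_def scal_def zero_fword_def)

lemma free_unital_one [simp]: "1 \<in> free_unital X"
  using free_unital_scal[of 1] by (simp add: scal_simps)

lemma free_nu_fscale: "a \<in> free_nu X \<Longrightarrow> fscale c a \<in> free_nu X"
  by (simp add: fscale_eq free_nu_mult_left)

lemma free_nu_uminus: "a \<in> free_nu X \<Longrightarrow> - a \<in> free_nu X"
  by (simp add: free_nu_def)

lemma free_nu_diff: "a \<in> free_nu X \<Longrightarrow> b \<in> free_nu X \<Longrightarrow> a - b \<in> free_nu X"
  unfolding diff_conv_add_uminus by (intro free_nu_add free_nu_uminus)

lemma free_nu_sum: "(\<And>i. i \<in> M \<Longrightarrow> f i \<in> free_nu X) \<Longrightarrow> sum f M \<in> free_nu X"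
  by (induction M rule: infinite_finite_induct) (auto intro: free_nu_add)

lemma free_unital_decomp:
  assumes "b \<in> free_unital X"
  obtains c b' where "b = scal c + b'" "b' \<in> free_nu X"
proof -
  define b' where "b' = b - scal (coef b 0)"
  have l: "coef b' w = (if w = 0 then 0 else coef b w)" for w
    by (simp add: b'_def scal_def lookup_minus lookup_single when_def)
  have "letters w \<noteq> []" if "w \<noteq> 0" for w :: "'a fword"
    using that by (cases w) (simp add: zero_fword_def)
  then have "b' \<in> free_nu X"
    using assms by (auto simp: free_nu_def free_unital_def in_keys_iff l split: if_splits)
  then show thesis using that[of "coef b 0" b'] by (simp add: b'_def)
qed

definition nu_ideal :: "'x set \<Rightarrow> ('x, 'k::field) falg set \<Rightarrow> bool" where
  "nu_ideal X I \<longleftrightarrow> I \<subseteq> free_nu X \<and> 0 \<in> I \<and> (\<forall>a\<in>I. \<forall>b\<in>I. a + b \<in> I) \<and>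
    (\<forall>c. \<forall>a\<in>I. fscale c a \<in> I) \<and> (\<forall>a\<in>I. \<forall>b\<in>free_nu X. b * a \<in> I \<and> a * b \<in> I)"

lemma
  assumes "nu_ideal X I"
  shows nu_ideal_free: "a \<in> I \<Longrightarrow> a \<in> free_nu X"
    and nu_ideal_zero: "0 \<in> I"
    and nu_ideal_add: "a \<in> I \<Longrightarrow> b \<in> I \<Longrightarrow> a + b \<in> I"
    and nu_ideal_fscale: "a \<in> I \<Longrightarrow> fscale c a \<in> I"
    and nu_ideal_uminus: "a \<in> I \<Longrightarrow> - a \<in> I"
    and nu_ideal_diff: "a \<in> I \<Longrightarrow> b \<in> I \<Longrightarrow> a - b \<in> I"
    and nu_ideal_left: "a \<in> I \<Longrightarrow> b \<in> free_unital X \<Longrightarrow> b * a \<in> I"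
    and nu_ideal_right: "a \<in> I \<Longrightarrow> b \<in> free_unital X \<Longrightarrow> a * b \<in> I"
    and nu_ideal_left': "a \<in> I \<Longrightarrow> b \<in> free_nu X \<Longrightarrow> b * a \<in> I"
    and nu_ideal_right': "a \<in> I \<Longrightarrow> b \<in> free_nu X \<Longrightarrow> a * b \<in> I"
proof -
  show add: "a \<in> I \<Longrightarrow> b \<in> I \<Longrightarrow> a + b \<in> I" for a b using assms by (simp add: nu_ideal_def)
  show sc: "a \<in> I \<Longrightarrow> fscale c a \<in> I" for a c using assms by (simp add: nu_ideal_def)
  show l: "a \<in> I \<Longrightarrow> b \<in> free_nu X \<Longrightarrow> b * a \<in> I" for a b using assms by (simp add: nu_ideal_def)
  show r: "a \<in> I \<Longrightarrow> b \<in> free_nu X \<Longrightarrow> a * b \<in> I" for a b using assms by (simp add: nu_ideal_def)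
  show um: "a \<in> I \<Longrightarrow> - a \<in> I" for a using sc[of a "- 1"] by (simp add: fscale_eq scal_simps)
  show "a \<in> I \<Longrightarrow> b \<in> I \<Longrightarrow> a - b \<in> I" for a b using add[of a "- b"] um by simp
  show "a \<in> I \<Longrightarrow> b \<in> free_unital X \<Longrightarrow> b * a \<in> I" for a b
    using sc l add by (elim free_unital_decomp) (auto simp: distrib_right fscale_eq)
  show "a \<in> I \<Longrightarrow> b \<in> free_unital X \<Longrightarrow> a * b \<in> I" for a b
    using sc r add by (elim free_unital_decomp) (auto simp: distrib_left fscale_eq simp flip: scal_commute)
qed (use assms in \<open>auto simp: nu_ideal_def\<close>)

lemma nu_ideal_sum: "nu_ideal X I \<Longrightarrow> (\<And>i. i \<in> M \<Longrightarrow> f i \<in> I) \<Longrightarrow> sum f M \<in> I"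
  by (induction M rule: infinite_finite_induct) (auto intro: nu_ideal_zero nu_ideal_add)

lemma nu_ideal_rel_ideal:
  assumes "\<And>a b. R a b \<Longrightarrow> a \<in> free_nu X \<and> b \<in> free_nu X"
  shows "nu_ideal X (rel_ideal X R)"
proof -
  have "a \<in> free_nu X" if "a \<in> rel_ideal X R" for a
    using that
    by (induction rule: rel_ideal.induct)
      (auto simp: assms intro: free_nu_add free_nu_diff free_nu_mult free_nu_fscale)
  then show ?thesis by (auto simp: nu_ideal_def intro: rel_ideal.intros)
qed

interpretation scal: scalar_hom "scal :: 'k::field \<Rightarrow> ('x, 'k) falg"
  by unfold_locales (rule scal_simps scal_commute)+

text \<open>The retraction onto the free algebra on \<open>X\<close>; the type also contains letters
  outside \<open>X\<close>, which it kills.\<close>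

definition restrict_letters :: "'x set \<Rightarrow> ('x, 'k::field) falg \<Rightarrow> ('x, 'k) falg" where
  "restrict_letters X = lift scal (\<lambda>x. if x \<in> X then gen x else 0)"

lemmas restrict_letters_simps =
  scal.lift_simps[where \<phi> = "\<lambda>x. if x \<in> X then gen x else 0" for X, folded restrict_letters_def]

lemma restrict_letters_free: "restrict_letters X a \<in> free_unital X"
proof (induction a rule: falg_induct)
  case (gen x a)
  have "(if x \<in> X then gen x else 0) \<in> free_unital X"
    by (simp add: free_unital_def gen_def)
  from free_unital_mult[OF this gen] show ?case by (simp only: restrict_letters_simps(7,8))
qed (simp_all add: restrict_letters_simps free_unital_add free_unital_mult)

lemma restrict_letters_id:
  fixes a :: "('x, 'k::field) falg"
  assumes "a \<in> free_unital X"
  shows "restrict_letters X a = a"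
proof -
  have "restrict_letters X (sgl w c) = sgl w c"
    if "set (letters w) \<subseteq> X" for w and c :: 'k
  proof -
    have "restrict_letters X (sgl w c) =
      scal c * prod_list (map (\<lambda>x. if x \<in> X then gen x else 0) (letters w))"
      by (simp add: restrict_letters_def scal.lift_single)
    also have "map (\<lambda>x. if x \<in> X then gen x else 0) (letters w) = map gen (letters w)"
      using that by (intro map_cong) auto
    also have "scal c * prod_list \<dots> = sgl w c"
      by (simp only: word_prod_list[symmetric] single_eq_scal_word[of w c])
    finally show ?thesis .
  qed
  then have "restrict_letters X (\<Sum>w\<in>supp a. sgl w (coef a w)) =
    (\<Sum>w\<in>supp a. sgl w (coef a w))"
    using assms by (simp add: restrict_letters_simps(6) free_unital_def)
  then show ?thesis by (simp flip: poly_mapping_sum_single)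
qed

lemma digraph_rel_free:
  assumes "wf_digraph E" "digraph_rel E a b"
  shows "a \<in> free_nu (lpa_letters E) \<and> b \<in> free_nu (lpa_letters E)"
proof -
  interpret wf_digraph E by fact
  from assms(2) show ?thesis
    by cases (auto simp: lpa_letters_def out_arcs_def intro!: free_nu_mult free_nu_sum)
qed

text \<open>The vertex that is a left identity for the letter.\<close>

primrec letter_source :: "('v, 'e) pre_digraph \<Rightarrow> ('v, 'e) leavitt_gen \<Rightarrow> 'v" where
  "letter_source E (Proj v) = v"
| "letter_source E (Edge e) = tail E e"
| "letter_source E (Ghost e) = head E e"

text \<open>The vertices at which the words of \<open>u\<close> start sum to a unit
  \<open>o'\<close> modulo \<open>N\<close>. With it an ideal \<open>I\<close> extends to an ideal
  \<open>ext I\<close> of the whole free ring, from which \<open>I\<close> is recovered by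
  intersection. By \<open>idempotent_ideal_eq\<close>, two subsets of the finite set
  \<open>W\<close> determine \<open>ext I\<close>.\<close>

lemma finite_idempotent_nu_ideals:
  fixes E :: "('v, 'e) pre_digraph" and u :: "('v, 'e, 'k::field) leavitt_falg"
  defines "X \<equiv> lpa_letters E"
  defines "N \<equiv> rel_ideal X (digraph_rel E) :: ('v, 'e, 'k) leavitt_falg set"
  assumes E: "wf_digraph E" and u: "u \<in> free_nu X"
    and unit: "\<And>a. a \<in> free_nu X \<Longrightarrow> u * a - a \<in> N \<and> a * u - a \<in> N"
  shows "finite {I. nu_ideal X I \<and> N \<subseteq> I \<and> I \<subseteq> prod_sum N I}"
proof -
  interpret wf_digraph E by fact
  have N: "nu_ideal X N"
    unfolding N_def X_def by (rule nu_ideal_rel_ideal) (rule digraph_rel_free[OF E])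
  have rel: "a - b \<in> N" if "digraph_rel E a b" for a b
    using that by (simp add: N_def rel_ideal.relator)
  define W where "W = (\<lambda>w. letter_source E (hd (letters w))) ` supp u"
  have hd_X: "hd (letters w) \<in> X" if "a \<in> free_nu X" "w \<in> supp a"
    for w and a :: "('v, 'e, 'k) leavitt_falg"
    using that by (auto simp: free_nu_def intro!: subsetD[OF _ hd_in_set])
  have source_verts: "letter_source E x \<in> verts E" if "x \<in> X" for x
    using that by (auto simp: X_def lpa_letters_def)
  have W: "finite W" "W \<subseteq> verts E" using source_verts hd_X[OF u] by (auto simp: W_def)
  define o' :: "('v, 'e, 'k) leavitt_falg" where "o' = (\<Sum>w\<in>W. pj w)"
  have pjX: "(pj w :: ('v, 'e, 'k) leavitt_falg) \<in> free_nu X" if "w \<in> verts E" for w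
    using that by (simp add: X_def lpa_letters_def)
  have o': "o' \<in> free_nu X" unfolding o'_def using W(2) pjX by (auto intro!: free_nu_sum)
  have o'_gen: "o' * gen x - gen x \<in> N" if "x \<in> X" "letter_source E x \<in> W" for x
  proof -
    define v where "v = letter_source E x"
    have x: "(gen x :: ('v, 'e, 'k) leavitt_falg) \<in> free_nu X" using that by simp
    have v: "pj v * gen x - gen x \<in> N"
    proof (cases x)
      case (Proj w)
      then show ?thesis
        using rel[OF digraph_rel.vertices[of v E v]] source_verts[OF that(1)] by (simp add: v_def)
    qed (use that in \<open>auto simp: X_def lpa_letters_def v_def intro!: rel digraph_rel.intros(2,4)\<close>)
    have other: "pj w * gen x \<in> N" if "w \<in> W - {v}" for w
    proof -
      have "pj w * pj v - 0 \<in> N"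
        using rel[OF digraph_rel.vertices[of w E v]] that W(2) source_verts[OF \<open>x \<in> X\<close>]
        by (auto simp: v_def)
      then have "pj w * pj v * gen x \<in> N" using nu_ideal_right'[OF N _ x] by simp
      moreover have "pj w * (pj v * gen x - gen x) \<in> N"
        using that W(2) pjX by (intro nu_ideal_left'[OF N v]) auto
      ultimately have "pj w * pj v * gen x - pj w * (pj v * gen x - gen x) \<in> N"
        by (rule nu_ideal_diff[OF N])
      then show ?thesis by (simp add: right_diff_distrib mult.assoc)
    qed
    have "o' * gen x - gen x = (pj v * gen x - gen x) + (\<Sum>w\<in>W - {v}. pj w * gen x)"
      using W(1) that(2)
      by (simp add: o'_def sum_distrib_right distrib_right sum.remove[of W v] v_def)
    also have "\<dots> \<in> N" using v other by (intro nu_ideal_add[OF N] nu_ideal_sum[OF N])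
    finally show ?thesis .
  qed
  have o'_u: "o' * u - u \<in> N"
  proof -
    have "o' * sgl w c - sgl w c \<in> N"
      if w: "w \<in> supp u" for w c
    proof -
      obtain x xs where xs: "letters w = x # xs" "set xs \<subseteq> X" "x \<in> X"
        using u w by (cases "letters w") (auto simp: free_nu_def)
      have "sgl w c = gen x * sgl (FWord xs) c"
        using xs(1) by (cases w) (simp add: gen_def mult_single plus_fword_def)
      then have "o' * sgl w c - sgl w c =
        (o' * gen x - gen x) * sgl (FWord xs) c"
        by (simp add: left_diff_distrib mult.assoc)
      also have "\<dots> \<in> N"
      proof (rule nu_ideal_right[OF N o'_gen])
        show "letter_source E x \<in> W" using w xs(1) by (force simp: W_def)
      qed (use xs in \<open>auto simp: free_unital_def\<close>)
      finally show ?thesis .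
    qed
    then have "(\<Sum>w\<in>supp u. o' * sgl w (coef u w) -
      sgl w (coef u w)) \<in> N"
      by (intro nu_ideal_sum[OF N])
    then show ?thesis
      by (simp add: sum_subtractf flip: sum_distrib_left poly_mapping_sum_single)
  qed
  \<comment> \<open>Modulo \<open>N\<close> the chain is
    \<open>o' * a = o' * u * a = u * a = a\<close>.\<close>
  have o'_left: "o' * a - a \<in> N" if a: "a \<in> free_nu X" for a
  proof -
    have ua: "u * a - a \<in> N" using unit[OF a] by blast
    have "(o' * u - u) * a - o' * (u * a - a) + (u * a - a) \<in> N"
      by (rule nu_ideal_add[OF N nu_ideal_diff[OF N nu_ideal_right'[OF N o'_u a]
              nu_ideal_left'[OF N ua o']] ua])
    then show ?thesis by (simp add: algebra_simps)
  qed
  \<comment> \<open>Modulo \<open>N\<close> one has \<open>o' = o' * u = u\<close>, so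
    \<open>o'\<close> inherits this from \<open>u\<close>.\<close>
  have o'_right: "a * o' - a \<in> N" if a: "a \<in> free_nu X" for a
  proof -
    have "(o' * u - u) - (o' * u - o') \<in> N"
      by (rule nu_ideal_diff[OF N o'_u]) (use unit[OF o'] in blast)
    then have "a * (o' - u) \<in> N" using nu_ideal_left'[OF N _ a] by simp
    then have "a * (o' - u) + (a * u - a) \<in> N"
      using unit[OF a] by (intro nu_ideal_add[OF N]) auto
    then show ?thesis by (simp add: algebra_simps)
  qed
  define r where "r = (restrict_letters X :: ('v, 'e, 'k) leavitt_falg \<Rightarrow> _)"
  have r_simps: "r 0 = 0" "r 1 = 1" "r (a + b) = r a + r b" "r (- a) = - r a" "r (a - b) = r a - r b"
    "r (a * b) = r a * r b" "r (gen x) = (if x \<in> X then gen x else 0)" "r (scal c) = scal c"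
    for a b x c
    unfolding r_def by (rule restrict_letters_simps)+
  have r_free: "r a \<in> free_unital X" for a unfolding r_def by (rule restrict_letters_free)
  have r_id: "r a = a" if "a \<in> free_nu X" for a
    unfolding r_def using that free_nu_subset_unital by (intro restrict_letters_id) auto
  have ro': "r a * o' \<in> free_nu X" for a using free_nu_mult_left[OF r_free o'] .
  \<comment> \<open>Since \<open>r a\<close> may have a constant term, it is multiplied by
    \<open>o'\<close>; this gives an element of the non-unital algebra and changes nothing modulo
    \<open>J\<close>.\<close>
  define ext where "ext I = {a. r a * o' \<in> I}" for I
  define J where "J = ideal_gen (lpa_relators E W :: ('v, 'e, 'k) leavitt_falg set)"
  have J: "two_sided_ideal J" unfolding J_def by (rule two_sided_ideal_gen)
  have JI: "lpa_relators E W \<subseteq> J" unfolding J_def by (auto intro: ideal_gen.base)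
  have NJ: "N \<subseteq> J"
  proof
    show "x \<in> J" if "x \<in> N" for x
      using that unfolding N_def
    proof (induction rule: rel_ideal.induct)
      case (relator a b)
      then show ?case using JI by (auto simp: lpa_relators_def)
    qed (auto simp: fscale_eq intro: two_sided_ideal_zero[OF J] two_sided_ideal_add[OF J]
        two_sided_ideal_left[OF J] two_sided_ideal_right[OF J])
  qed
  have rJ: "a - r a * o' \<in> J" for a
  proof -
    have "a - r a \<in> J"
    proof (induction a rule: falg_induct)
      case one
      then show ?case by (simp add: r_simps two_sided_ideal_zero[OF J])
    next
      case (gen x a)
      have "gen x - r (gen x) \<in> J"
        using JI by (auto simp: r_simps lpa_relators_def X_def two_sided_ideal_zero[OF J])
      then have "(gen x - r (gen x)) * a + r (gen x) * (a - r a) \<in> J"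
        using gen by (intro two_sided_ideal_add[OF J] two_sided_ideal_left[OF J] two_sided_ideal_right[OF J])
      then show ?case by (simp add: r_simps(6) algebra_simps)
    next
      case (add a b)
      then have "(a - r a) + (b - r b) \<in> J" by (rule two_sided_ideal_add[OF J])
      then show ?case by (simp add: r_simps(3) algebra_simps)
    next
      case (scale c a)
      then have "scal c * (a - r a) \<in> J" by (rule two_sided_ideal_left[OF J])
      then show ?case by (simp add: r_simps(6,8) algebra_simps)
    qed
    moreover have "1 - o' \<in> J" using JI by (auto simp: lpa_relators_def o'_def)
    ultimately have "(a - r a) + r a * (1 - o') \<in> J"
      by (intro two_sided_ideal_add[OF J] two_sided_ideal_left[OF J])
    then show ?thesis by (simp add: algebra_simps)
  qed
  define hs where "hs I = {v \<in> W. pj v \<in> I}" for I :: "('v, 'e, 'k) leavitt_falg set"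
  define ss where "ss I = {v \<in> W - hs I. finite (surviving_arcs E (W - hs I) v) \<and>
    vertex_cut v (surviving_arcs E (W - hs I) v) \<in> I}" for I :: "('v, 'e, 'k) leavitt_falg set"
  have main: "I = ideal_gen (graded_gens E W (hs (ext I)) (ss (ext I))) \<inter> free_nu X"
    if I: "nu_ideal X I" "N \<subseteq> I" "I \<subseteq> prod_sum N I" for I
  proof -
    have I_free: "a \<in> free_nu X" if "a \<in> I" for a using nu_ideal_free[OF I(1) that] .
    have ext_I: "a \<in> ext I \<longleftrightarrow> a \<in> I" if a: "a \<in> free_nu X" for a
    proof -
      have "a * o' - a \<in> I" using o'_right[OF a] I(2) by auto
      then show ?thesis unfolding ext_def mem_Collect_eq r_id[OF a]
        using nu_ideal_diff[OF I(1), of "a * o'" "a * o' - a"] nu_ideal_add[OF I(1), of "a * o' - a" a]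
        by auto
    qed
    have ideal: "two_sided_ideal (ext I)"
      unfolding two_sided_ideal_def
    proof (intro conjI ballI allI)
      show "0 \<in> ext I" by (simp add: ext_def r_simps nu_ideal_zero[OF I(1)])
      show "x + y \<in> ext I" if "x \<in> ext I" "y \<in> ext I" for x y
        using that nu_ideal_add[OF I(1)] by (simp add: ext_def r_simps distrib_right)
      show "a * x \<in> ext I" if "x \<in> ext I" for x a
        using that nu_ideal_left[OF I(1) _ r_free] by (simp add: ext_def r_simps mult.assoc)
      show "x * a \<in> ext I" if x: "x \<in> ext I" for x a
      proof -
        \<comment> \<open>Inserting \<open>o'\<close> between \<open>r x\<close> and
          \<open>r a\<close> costs only an element of \<open>N\<close>.\<close>
        have "r x * (o' * (r a * o') - r a * o') \<in> I"
          using o'_left[OF ro'] I(2) by (intro nu_ideal_left[OF I(1) _ r_free]) auto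
        moreover have "r x * o' * (r a * o') \<in> I"
          using nu_ideal_right'[OF I(1) _ ro'] x by (simp add: ext_def)
        ultimately have "r x * o' * (r a * o') - r x * (o' * (r a * o') - r a * o') \<in> I"
          by (rule nu_ideal_diff[OF I(1), rotated])
        then show ?thesis by (simp add: ext_def r_simps algebra_simps)
      qed
    qed
    have "lpa_relators E W \<subseteq> ext I"
    proof -
      have "a - b \<in> ext I" if "digraph_rel E a b" for a b
        using rel[OF that] digraph_rel_free[OF E that] I(2)
        by (subst ext_I) (auto simp: X_def intro: free_nu_diff)
      moreover have "gen x \<in> ext I" if "x \<notin> X" for x
        using that by (simp add: ext_def r_simps nu_ideal_zero[OF I(1)])
      moreover have "1 - o' \<in> ext I"
      proof -
        have "- (o' * o' - o') \<in> I"
          by (rule nu_ideal_uminus[OF I(1)]) (use o'_left[OF o'] I(2) in blast)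
        then show ?thesis by (simp add: ext_def r_simps r_id[OF o'] left_diff_distrib)
      qed
      ultimately show ?thesis by (auto simp: lpa_relators_def X_def o'_def)
    qed
    moreover have "ext I \<subseteq> prod_sum J (ext I)"
    proof
      fix a assume "a \<in> ext I"
      then have "r a * o' \<in> prod_sum N I" using I(3) by (auto simp: ext_def)
      moreover have "x \<in> prod_sum J (ext I)" if "x \<in> prod_sum N I" for x
        using that
      proof (induction rule: prod_sum.induct)
        case (base x)
        then show ?case using NJ by (auto intro: prod_sum.base)
      next
        case (product x y)
        then show ?case using ext_I I_free by (auto intro: prod_sum.product)
      qed (rule prod_sum.add)
      ultimately have "(a - r a * o') + r a * o' \<in> prod_sum J (ext I)"
        by (intro prod_sum.add[OF prod_sum.base[OF rJ]])
      then show "a \<in> prod_sum J (ext I)" by simp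
    qed
    ultimately have "ext I = ideal_gen (graded_gens E W (hs (ext I)) (ss (ext I)))"
      unfolding hs_def ss_def J_def by (intro idempotent_ideal_eq[OF E W ideal])
    moreover have "I = ext I \<inter> free_nu X" using ext_I I_free by auto
    ultimately show ?thesis by simp
  qed
  have "{I. nu_ideal X I \<and> N \<subseteq> I \<and> I \<subseteq> prod_sum N I} \<subseteq>
    (\<lambda>(H, S). ideal_gen (graded_gens E W H S) \<inter> free_nu X) ` (Pow W \<times> Pow W)"
  proof
    fix I assume "I \<in> {I. nu_ideal X I \<and> N \<subseteq> I \<and> I \<subseteq> prod_sum N I}"
    then have "I = ideal_gen (graded_gens E W (hs (ext I)) (ss (ext I))) \<inter> free_nu X"
      using main by blast
    moreover have "(hs (ext I), ss (ext I)) \<in> Pow W \<times> Pow W" by (auto simp: hs_def ss_def)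
    ultimately show "I \<in> (\<lambda>(H, S). ideal_gen (graded_gens E W H S) \<inter> free_nu X) ` (Pow W \<times> Pow W)"
      by (auto simp: image_iff)
  qed
  then show ?thesis by (rule finite_subset) (use W(1) in simp)
qed

section \<open>Ideals of ultragraph algebras given by hereditary saturated sets\<close>

lemma app_sum: "app (sum f M) x = (\<Sum>i\<in>M. app (f i) x)"
  by (induction M rule: infinite_finite_induct) simp_all

definition lin_ext :: "('b \<Rightarrow> 'b \<Rightarrow>\<^sub>0 'k::field) \<Rightarrow> ('b, 'k) lin_endo" where
  "lin_ext \<phi> = Abs_lin_endo (\<lambda>x. \<Sum>k\<in>supp x. smul (coef x k) (\<phi> k))"

lemma app_lin_ext [simp]: "app (lin_ext \<phi>) (sgl k 1) = \<phi> k"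
proof -
  define f where "f x = (\<Sum>k\<in>supp x. smul (coef x k) (\<phi> k))" for x
  have eq: "f x = (\<Sum>k\<in>K. smul (coef x k) (\<phi> k))"
    if "supp x \<subseteq> K" "finite K" for x K
    unfolding f_def using that by (intro sum.mono_neutral_left) (auto simp: in_keys_iff)
  have "f (x + y) = f x + f y" for x y
  proof -
    let ?K = "supp x \<union> supp y"
    show ?thesis
      using eq[of x ?K] eq[of y ?K] eq[of "x + y" ?K] keys_add[of x y]
      by (simp add: lookup_add pm.scale_left_distrib sum.distrib)
  qed
  moreover have "f (smul c x) = smul c (f x)" for c x
  proof -
    have "supp (smul c x) \<subseteq> supp x" by (auto simp: in_keys_iff)
    then show ?thesis
      using eq[of "smul c x" "supp x"] by (simp add: f_def pm.scale_sum_right)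
  qed
  ultimately have "app (lin_ext \<phi>) = f"
    unfolding lin_ext_def f_def by (intro app_Abs)
  then show ?thesis by (simp add: f_def)
qed

interpretation scalar: scalar_hom "scalar :: 'k::field \<Rightarrow> ('b, 'k) lin_endo"
  by unfold_locales (rule scalar_simps)+

text \<open>A prime ideal above \<open>H\<close> of the Boolean ring \<open>gen_verts G\<close>,
  properness apart.\<close>

definition prime_over :: "('v, 'e) ultragraph \<Rightarrow> 'v set set \<Rightarrow> 'v set set \<Rightarrow> bool" where
  "prime_over G H M \<longleftrightarrow> H \<subseteq> M \<and> (\<forall>B\<in>M. \<forall>C\<in>M. B \<union> C \<in> M) \<and>
    (\<forall>B\<in>M. \<forall>C\<in>gen_verts G. C \<subseteq> B \<longrightarrow> C \<in> M) \<and>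
    (\<forall>B\<in>gen_verts G. \<forall>C\<in>gen_verts G. B \<inter> C \<in> M \<longrightarrow> B \<in> M \<or> C \<in> M)"

text \<open>By Zorn, take \<open>M\<close> maximal among the ideals above \<open>H\<close> that
  avoid \<open>A\<close>. If \<open>B\<close> and \<open>C\<close> are not in \<open>M\<close>,
  maximality covers \<open>A\<close> by \<open>D \<union> B\<close> and by
  \<open>D' \<union> C\<close> with \<open>D\<close>, \<open>D'\<close> in \<open>M\<close>, hence
  by \<open>D \<union> D' \<union> (B \<inter> C)\<close>. So \<open>B \<inter> C\<close> is not in
  \<open>M\<close>.\<close>

lemma prime_over_avoiding:
  assumes H: "hereditary G H" "{} \<in> H" and A: "A \<in> gen_verts G" "A \<notin> H"
  shows "\<exists>M. prime_over G H M \<and> A \<notin> M"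
proof -
  define \<I> where "\<I> = {M. H \<subseteq> M \<and> M \<subseteq> gen_verts G \<and> (\<forall>B\<in>M. \<forall>C\<in>M. B \<union> C \<in> M) \<and>
    (\<forall>B\<in>M. \<forall>C\<in>gen_verts G. C \<subseteq> B \<longrightarrow> C \<in> M) \<and> A \<notin> M}"
  have "H \<in> \<I>" using H A by (auto simp: \<I>_def hereditary_def)
  have "\<exists>M\<in>\<I>. \<forall>N\<in>\<I>. M \<subseteq> N \<longrightarrow> N = M"
  proof (rule subset_Zorn_nonempty)
    show "\<I> \<noteq> {}" using \<open>H \<in> \<I>\<close> by auto
    fix \<C> assume \<C>: "\<C> \<noteq> {}" "subset.chain \<I> \<C>"
    have sub: "\<C> \<subseteq> \<I>" and total: "\<And>M N. M \<in> \<C> \<Longrightarrow> N \<in> \<C> \<Longrightarrow> M \<subseteq> N \<or> N \<subseteq> M"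
      using \<C>(2) unfolding subset_chain_def by (meson, meson)
    have union: "B \<union> C \<in> \<Union>\<C>" if BC: "B \<in> \<Union>\<C>" "C \<in> \<Union>\<C>" for B C
    proof -
      obtain M N where MN: "B \<in> M" "M \<in> \<C>" "C \<in> N" "N \<in> \<C>" using BC by auto
      have "\<exists>L\<in>\<C>. B \<in> L \<and> C \<in> L" using total[OF MN(2,4)] MN by auto
      then obtain L where "L \<in> \<C>" "B \<in> L" "C \<in> L" by auto
      moreover have "L \<in> \<I>" using sub \<open>L \<in> \<C>\<close> by (rule subsetD)
      then have "\<forall>B\<in>L. \<forall>C\<in>L. B \<union> C \<in> L" by (simp add: \<I>_def)
      ultimately show ?thesis by auto
    qed
    obtain M where M: "M \<in> \<C>" using \<C>(1) by auto
    have "M \<in> \<I>" using sub M by (rule subsetD)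
    then have "H \<subseteq> \<Union>\<C>" using M by (auto simp: \<I>_def)
    moreover have "\<forall>B\<in>\<Union>\<C>. \<forall>C\<in>gen_verts G. C \<subseteq> B \<longrightarrow> C \<in> \<Union>\<C>"
    proof (intro ballI impI)
      fix B C assume "B \<in> \<Union>\<C>" "C \<in> gen_verts G" "C \<subseteq> B"
      then obtain N where "N \<in> \<C>" "B \<in> N" by auto
      moreover have "N \<in> \<I>" using sub \<open>N \<in> \<C>\<close> by (rule subsetD)
      then have "\<forall>B\<in>N. \<forall>C\<in>gen_verts G. C \<subseteq> B \<longrightarrow> C \<in> N" by (simp add: \<I>_def)
      ultimately show "C \<in> \<Union>\<C>" using \<open>C \<in> gen_verts G\<close> \<open>C \<subseteq> B\<close> by auto
    qed
    ultimately show "\<Union>\<C> \<in> \<I>" using sub union by (auto simp: \<I>_def)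
  qed
  then obtain M where M: "M \<in> \<I>" and max: "\<And>N. N \<in> \<I> \<Longrightarrow> M \<subseteq> N \<Longrightarrow> N = M" by blast
  have M_un: "\<And>B C. B \<in> M \<Longrightarrow> C \<in> M \<Longrightarrow> B \<union> C \<in> M"
    and M_sub: "\<And>B C. B \<in> M \<Longrightarrow> C \<in> gen_verts G \<Longrightarrow> C \<subseteq> B \<Longrightarrow> C \<in> M"
    and M_gen: "M \<subseteq> gen_verts G" "H \<subseteq> M" "A \<notin> M"
    using M by (auto simp: \<I>_def)
  have cover: "\<exists>D\<in>M. A \<subseteq> D \<union> B" if B: "B \<in> gen_verts G" "B \<notin> M" for B
  proof (rule ccontr)
    assume no: "\<not> (\<exists>D\<in>M. A \<subseteq> D \<union> B)"
    \<comment> \<open>The ideal generated by \<open>M\<close> and \<open>B\<close>.\<close>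
    define N where "N = {C \<in> gen_verts G. \<exists>D\<in>M. C \<subseteq> D \<union> B}"
    have "M \<subseteq> N" using M_gen by (auto simp: N_def)
    have "N \<in> \<I>"
      unfolding \<I>_def
    proof (intro CollectI conjI ballI impI)
      show "C \<union> C' \<in> N" if CC: "C \<in> N" "C' \<in> N" for C C'
      proof -
        obtain D D' where "D \<in> M" "C \<subseteq> D \<union> B" "D' \<in> M" "C' \<subseteq> D' \<union> B"
          using CC unfolding N_def by blast
        then have "D \<union> D' \<in> M" "C \<union> C' \<subseteq> (D \<union> D') \<union> B" using M_un by auto
        then show ?thesis using CC unfolding N_def by (blast intro: gen_verts.union)
      qed
      show "C' \<in> N" if "C \<in> N" "C' \<in> gen_verts G" "C' \<subseteq> C" for C C'
        using that unfolding N_def by blast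
      show "H \<subseteq> N" using M_gen \<open>M \<subseteq> N\<close> by auto
      show "A \<notin> N" using no by (auto simp: N_def)
    qed (auto simp: N_def)
    from max[OF this \<open>M \<subseteq> N\<close>] have "N = M" .
    moreover have "{} \<in> M" using H(2) M_gen(2) by auto
    then have "B \<in> N" using B(1) by (auto simp: N_def)
    ultimately show False using B(2) by simp
  qed
  have "B \<in> M \<or> C \<in> M" if BC: "B \<in> gen_verts G" "C \<in> gen_verts G" "B \<inter> C \<in> M" for B C
  proof (rule ccontr)
    assume "\<not> (B \<in> M \<or> C \<in> M)"
    then obtain D D' where D: "D \<in> M" "A \<subseteq> D \<union> B" "D' \<in> M" "A \<subseteq> D' \<union> C"
      using cover[OF BC(1)] cover[OF BC(2)] by blast
    have "D \<union> D' \<union> (B \<inter> C) \<in> M" using D BC(3) M_un by blast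
    moreover have "A \<subseteq> D \<union> D' \<union> (B \<inter> C)" using D by auto
    ultimately have "A \<in> M" using M_sub A(1) by blast
    then show False using M_gen(3) by contradiction
  qed
  then have "prime_over G H M"
    unfolding prime_over_def using M_gen M_un M_sub by blast
  then show ?thesis using M_gen(3) by blast
qed

text \<open>Countability keeps the set of points countable, so that all infinite pieces of it have
  the same size.\<close>

lemma countable_gen_verts:
  assumes "ultragraph G"
  shows "countable (gen_verts G)"
proof -
  interpret ultragraph G by fact
  define L0 where "L0 = insert {} ((\<lambda>v. {v}) ` uverts G \<union> urange G ` uedges G)"
  define step where "step L = L \<union> (\<lambda>(A, B). A - B) ` (L \<times> L) \<union> (\<lambda>(A, B). A \<union> B) ` (L \<times> L)
    \<union> (\<lambda>(A, B). A \<inter> B) ` (L \<times> L)" for L :: "'a set set"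
  have mono: "(step ^^ m) L0 \<subseteq> (step ^^ n) L0" if "m \<le> n" for m n
    using that by (rule lift_Suc_mono_le[of "\<lambda>n. (step ^^ n) L0", rotated]) (auto simp: step_def)
  have cnt: "countable ((step ^^ n) L0)" for n
    by (induction n) (auto simp: L0_def step_def countable_verts countable_edges)
  have step: "\<exists>n. A \<in> (step ^^ n) L0 \<and> B \<in> (step ^^ n) L0"
    if "A \<in> (\<Union>n. (step ^^ n) L0)" "B \<in> (\<Union>n. (step ^^ n) L0)" for A B
  proof -
    from that obtain m n where "A \<in> (step ^^ m) L0" "B \<in> (step ^^ n) L0" by auto
    then show ?thesis using mono[of m "max m n"] mono[of n "max m n"] by auto
  qed
  have "A \<in> (\<Union>n. (step ^^ n) L0)" if "A \<in> gen_verts G" for A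
    using that
  proof (induction rule: gen_verts.induct)
    case (diff A B)
    then obtain n where "A \<in> (step ^^ n) L0" "B \<in> (step ^^ n) L0" using step by blast
    then have "A - B \<in> (step ^^ Suc n) L0" by (force simp: step_def)
    then show ?case by blast
  next
    case (union A B)
    then obtain n where "A \<in> (step ^^ n) L0" "B \<in> (step ^^ n) L0" using step by blast
    then have "A \<union> B \<in> (step ^^ Suc n) L0" by (force simp: step_def)
    then show ?case by blast
  next
    case (inter A B)
    then obtain n where "A \<in> (step ^^ n) L0" "B \<in> (step ^^ n) L0" using step by blast
    then have "A \<inter> B \<in> (step ^^ Suc n) L0" by (force simp: step_def)
    then show ?case by blast
  qed (auto simp: L0_def intro!: exI[of _ 0])
  then have "gen_verts G \<subseteq> (\<Union>n. (step ^^ n) L0)" by blast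
  moreover have "countable (\<Union>n. (step ^^ n) L0)" using cnt by (intro countable_UN) auto
  ultimately show ?thesis by (rule countable_subset)
qed

text \<open>Identify \<open>S\<close> with pairs of natural numbers and let the first component
  enumerate \<open>D\<close>. This divides the points of a vertex among its outgoing edges,
  infinitely many for each.\<close>

lemma infinite_fibres:
  assumes "countable S" "infinite S" "countable D" "D \<noteq> {}"
  shows "\<exists>q. q ` S \<subseteq> D \<and> (\<forall>d\<in>D. infinite {y \<in> S. q y = d})"
proof -
  obtain b :: "'a \<Rightarrow> nat" where b: "bij_betw b S UNIV"
    using countableE_infinite[OF assms(1,2)] by blast
  define q where "q y = from_nat_into D (fst (prod_decode (b y)))" for y
  have "infinite {y \<in> S. q y = d}" if d: "d \<in> D" for d
  proof
    assume fin: "finite {y \<in> S. q y = d}"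
    obtain k where k: "from_nat_into D k = d" using from_nat_into_surj[OF assms(3) d] by blast
    have "range (\<lambda>n. prod_encode (k, n)) \<subseteq> b ` {y \<in> S. q y = d}"
    proof clarify
      fix n
      obtain y where "y \<in> S" "b y = prod_encode (k, n)"
        using b by (metis UNIV_I bij_betw_imp_surj_on imageE)
      then show "prod_encode (k, n) \<in> b ` {y \<in> S. q y = d}"
        using k by (intro image_eqI[of _ b y]) (auto simp: q_def)
    qed
    then have "finite (range (\<lambda>n. prod_encode (k, n)))" using fin finite_surj by blast
    moreover have "inj (\<lambda>n. prod_encode (k, n))" by (auto simp: inj_on_def prod_encode_eq)
    ultimately show False using finite_imageD by blast
  qed
  moreover have "q ` S \<subseteq> D" by (auto simp: q_def from_nat_into[OF assms(4)])
  ultimately show ?thesis by blast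
qed

text \<open>The points of \<open>Y A\<close> are prime ideals of the Boolean ring \<open>gen_verts G\<close>, each taken countably many
  times: then all non-empty \<open>Y A\<close> are equinumerous, and the bijections \<open>\<theta> e\<close> exist.\<close>

lemma branching_system:
  fixes G :: "('v, 'e) ultragraph"
  assumes G: "ultragraph G" and H: "hereditary G H" "saturated G H" "{} \<in> H"
  obtains Y :: "'v set \<Rightarrow> ('v set set \<times> nat) set" and Z :: "'e \<Rightarrow> ('v set set \<times> nat) set" and \<theta>
  where "\<And>A. A \<in> gen_verts G \<Longrightarrow> Y A = {} \<longleftrightarrow> A \<in> H"
    and "\<And>A B. A \<in> gen_verts G \<Longrightarrow> B \<in> gen_verts G \<Longrightarrow> Y (A \<inter> B) = Y A \<inter> Y B"
    and "\<And>A B. A \<in> gen_verts G \<Longrightarrow> B \<in> gen_verts G \<Longrightarrow> Y (A \<union> B) = Y A \<union> Y B"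
    and "\<And>e. e \<in> uedges G \<Longrightarrow> Z e \<subseteq> Y {usource G e}"
    and "\<And>e. e \<in> uedges G \<Longrightarrow> bij_betw (\<theta> e) (Z e) (Y (urange G e))"
    and "\<And>e f. e \<in> uedges G \<Longrightarrow> f \<in> uedges G \<Longrightarrow> e \<noteq> f \<Longrightarrow> Z e \<inter> Z f = {}"
    and "\<And>v. regular_vertex G v \<Longrightarrow> Y {v} = (\<Union>e\<in>out_edges G v. Z e)"
proof -
  interpret ultragraph G by fact
  have H_gen: "H \<subseteq> gen_verts G" using H(1) by (simp add: hereditary_def)
  \<comment> \<open>One prime ideal for each \<open>A\<close> is enough to detect membership in
    \<open>H\<close>; the set of all prime ideals could be uncountable.\<close>
  have "\<forall>A. \<exists>M. A \<in> gen_verts G - H \<longrightarrow> prime_over G H M \<and> A \<notin> M"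
    using prime_over_avoiding[OF H(1,3)] by blast
  then obtain m where m: "\<And>A. A \<in> gen_verts G - H \<Longrightarrow> prime_over G H (m A) \<and> A \<notin> m A"
    by metis
  define U where "U = m ` (gen_verts G - H)"
  have U: "prime_over G H M" if "M \<in> U" for M using that m by (auto simp: U_def)
  define Y where "Y B = {M \<in> U. B \<notin> M} \<times> (UNIV :: nat set)" for B
  have Y_iff: "(M, n) \<in> Y B \<longleftrightarrow> M \<in> U \<and> B \<notin> M" for M n B by (auto simp: Y_def)
  have Y_H: "Y A = {}" if "A \<in> H" for A
    using that U by (force simp: Y_def prime_over_def)
  have Y_inf: "infinite (Y A)" if "A \<in> gen_verts G - H" for A
  proof -
    have "{M \<in> U. A \<notin> M} \<noteq> {}" using m[OF that] that by (auto simp: U_def)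
    then show ?thesis by (auto simp: Y_def finite_cartesian_product_iff)
  qed
  have Y_cnt: "countable (Y A)" for A
  proof -
    have "countable U" using countable_gen_verts[OF G] by (auto simp: U_def)
    then have "countable {M \<in> U. A \<notin> M}" by (rule countable_subset[rotated]) auto
    then show ?thesis by (simp add: Y_def)
  qed
  have Y_lat: "Y (A \<inter> B) = Y A \<inter> Y B \<and> Y (A \<union> B) = Y A \<union> Y B"
    if AB: "A \<in> gen_verts G" "B \<in> gen_verts G" for A B
  proof -
    have "A \<inter> B \<in> M \<longleftrightarrow> A \<in> M \<or> B \<in> M" "A \<union> B \<in> M \<longleftrightarrow> A \<in> M \<and> B \<in> M" if "M \<in> U" for M
    proof -
      have M: "\<And>B C. B \<in> M \<Longrightarrow> C \<in> M \<Longrightarrow> B \<union> C \<in> M"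
        "\<And>B C. B \<in> M \<Longrightarrow> C \<in> gen_verts G \<Longrightarrow> C \<subseteq> B \<Longrightarrow> C \<in> M"
        "\<And>B C. B \<in> gen_verts G \<Longrightarrow> C \<in> gen_verts G \<Longrightarrow> B \<inter> C \<in> M \<Longrightarrow> B \<in> M \<or> C \<in> M"
        using U[OF that] unfolding prime_over_def by blast+
      show "A \<inter> B \<in> M \<longleftrightarrow> A \<in> M \<or> B \<in> M"
        using M(2)[of A "A \<inter> B"] M(2)[of B "A \<inter> B"] M(3)[of A B] AB gen_verts.inter[OF AB] by blast
      show "A \<union> B \<in> M \<longleftrightarrow> A \<in> M \<and> B \<in> M"
        using M(2)[of "A \<union> B" A] M(2)[of "A \<union> B" B] M(1)[of A B] AB by blast
    qed
    then show ?thesis by (auto simp: Y_def)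
  qed
  \<comment> \<open>Only the edges with range outside \<open>H\<close> share the points of
    \<open>v\<close>. The others get the empty set, in accordance with
    \<open>Y (urange G e) = {}\<close>.\<close>
  define D where "D v = {e \<in> out_edges G v. urange G e \<notin> H}" for v
  have D_cnt: "countable (D v)" for v
    using countable_edges by (rule countable_subset[rotated]) (auto simp: D_def out_edges_def)
  have "\<forall>v. \<exists>q. D v \<noteq> {} \<longrightarrow> q ` Y {v} \<subseteq> D v \<and> (\<forall>e\<in>D v. infinite {y \<in> Y {v}. q y = e})"
  proof (intro allI)
    fix v
    show "\<exists>q. D v \<noteq> {} \<longrightarrow> q ` Y {v} \<subseteq> D v \<and> (\<forall>e\<in>D v. infinite {y \<in> Y {v}. q y = e})"
    proof (cases "D v = {}")
      case False
      then obtain e where e: "e \<in> uedges G" "usource G e = v" "urange G e \<notin> H"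
        by (auto simp: D_def out_edges_def)
      \<comment> \<open>Heredity is used here: a vertex with an edge to a set outside
        \<open>H\<close> is itself outside \<open>H\<close>, so it has infinitely many points to
        share.\<close>
      then have "{v} \<in> gen_verts G - H"
        using H(1) source_in_verts[OF e(1)] by (auto simp: hereditary_def intro: gen_verts.vertex)
      then show ?thesis using infinite_fibres[OF Y_cnt Y_inf D_cnt False] by blast
    qed simp
  qed
  from choice[OF this] obtain q where q': "\<And>v. D v \<noteq> {} \<Longrightarrow>
    q v ` Y {v} \<subseteq> D v \<and> (\<forall>e\<in>D v. infinite {y \<in> Y {v}. q v y = e})" by auto
  have q: "q v ` Y {v} \<subseteq> D v" if "D v \<noteq> {}" for v using q'[OF that] by simp
  have q_inf: "infinite {y \<in> Y {v}. q v y = e}" if "e \<in> D v" for v e using q'[of v] that by auto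
  define Z where "Z e = (if urange G e \<in> H then {} else {y \<in> Y {usource G e}. q (usource G e) y = e})" for e
  have "\<forall>e. \<exists>\<theta>. e \<in> uedges G \<longrightarrow> bij_betw \<theta> (Z e) (Y (urange G e))"
  proof (intro allI)
    fix e
    show "\<exists>\<theta>. e \<in> uedges G \<longrightarrow> bij_betw \<theta> (Z e) (Y (urange G e))"
    proof (cases "e \<in> uedges G \<and> urange G e \<notin> H")
      case True
      then have e: "e \<in> D (usource G e)" "urange G e \<in> gen_verts G - H"
        by (auto simp: D_def out_edges_def intro: gen_verts.range)
      have Z: "Z e = {y \<in> Y {usource G e}. q (usource G e) y = e}" using True by (simp add: Z_def)
      have "infinite (Z e)" unfolding Z by (rule q_inf[OF e(1)])
      moreover have "countable (Z e)" unfolding Z by (rule countable_subset[OF _ Y_cnt]) auto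
      ultimately obtain f :: "_ \<Rightarrow> nat" where "bij_betw f (Z e) UNIV" using countableE_infinite by blast
      moreover obtain g :: "nat \<Rightarrow> _" where "bij_betw g UNIV (Y (urange G e))"
        using countable_infiniteE'[OF Y_cnt Y_inf[OF e(2)]] by blast
      ultimately show ?thesis using bij_betw_trans by blast
    next
      case False
      then show ?thesis using Y_H by (auto simp: Z_def bij_betw_def)
    qed
  qed
  then obtain \<theta> where \<theta>: "\<And>e. e \<in> uedges G \<Longrightarrow> bij_betw (\<theta> e) (Z e) (Y (urange G e))" by metis
  have disj: "Z e \<inter> Z f = {}" if "e \<in> uedges G" "f \<in> uedges G" "e \<noteq> f" for e f
  proof (cases "usource G e = usource G f")
    case True
    then show ?thesis using that by (auto simp: Z_def)
  next
    case False
    have "Y {usource G e} \<inter> Y {usource G f} = Y ({usource G e} \<inter> {usource G f})"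
      using Y_lat[of "{usource G e}" "{usource G f}"] source_in_verts that by (auto intro: gen_verts.vertex)
    also have "\<dots> = {}" using False Y_H[OF H(3)] by simp
    finally show ?thesis by (auto simp: Z_def)
  qed
  have reg: "Y {v} = (\<Union>e\<in>out_edges G v. Z e)" if v: "regular_vertex G v" for v
  proof
    show "(\<Union>e\<in>out_edges G v. Z e) \<subseteq> Y {v}" by (auto simp: Z_def out_edges_def)
    show "Y {v} \<subseteq> (\<Union>e\<in>out_edges G v. Z e)"
    proof
      fix y assume y: "y \<in> Y {v}"
      then have "{v} \<notin> H" using Y_H by auto
      \<comment> \<open>Saturation is used here: if all ranges were in \<open>H\<close>, then
        \<open>{v}\<close> would be too.\<close>
      then have "D v \<noteq> {}" using H(2) v by (auto simp: saturated_def D_def)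
      then have "q v y \<in> D v" using q y by auto
      then show "y \<in> (\<Union>e\<in>out_edges G v. Z e)" using y by (auto simp: D_def Z_def out_edges_def)
    qed
  qed
  have "Y A = {} \<longleftrightarrow> A \<in> H" if "A \<in> gen_verts G" for A
    using Y_H Y_inf that by (metis DiffI finite.emptyI)
  then show thesis
    by (rule that[of Y Z \<theta>]) (use Y_lat \<theta> disj reg in \<open>auto simp: Z_def\<close>)
qed

section \<open>The ideal of \<open>H\<close> and the representation that detects membership in
  \<open>H\<close>\<close>

definition ultragraph_letters :: "('v, 'e) ultragraph \<Rightarrow> ('v set, 'e) leavitt_gen set" where
  "ultragraph_letters G = Proj ` gen_verts G \<union> Edge ` uedges G \<union> Ghost ` uedges G"

definition ultragraph_ideal ::
    "('v, 'e) ultragraph \<Rightarrow> 'v set set \<Rightarrow> ('v set, 'e, 'k::field) leavitt_falg set" where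
  "ultragraph_ideal G H = rel_ideal (ultragraph_letters G)
    (\<lambda>a b. ultragraph_rel G a b \<or> (\<exists>A\<in>H. a = pj A \<and> b = 0))"

text \<open>Let the algebra act on the span of the points from \<open>branching_system\<close>:
  \<open>pj A\<close> projects onto \<open>Y A\<close>, an edge moves \<open>Y (urange G e)\<close>
  onto \<open>Z e\<close>, and its ghost moves it back. The ideal acts as zero, so
  \<open>Y A\<close> is empty.\<close>

lemma ultragraph_ideal_pj:
  assumes G: "ultragraph G" and H: "hereditary G H" "saturated G H" "{} \<in> H"
    and A: "A \<in> gen_verts G"
    and mem: "(pj A :: ('v set, 'e, 'k::field) leavitt_falg) \<in> ultragraph_ideal G H"
  shows "A \<in> H"
proof -
  interpret ultragraph G by fact
  obtain Y :: "'v set \<Rightarrow> ('v set set \<times> nat) set" and Z :: "'e \<Rightarrow> ('v set set \<times> nat) set" and \<theta> where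
    Y_H: "\<And>A. A \<in> gen_verts G \<Longrightarrow> Y A = {} \<longleftrightarrow> A \<in> H" and
    Y_inter: "\<And>A B. A \<in> gen_verts G \<Longrightarrow> B \<in> gen_verts G \<Longrightarrow> Y (A \<inter> B) = Y A \<inter> Y B" and
    Y_union: "\<And>A B. A \<in> gen_verts G \<Longrightarrow> B \<in> gen_verts G \<Longrightarrow> Y (A \<union> B) = Y A \<union> Y B" and
    Z_Y: "\<And>e. e \<in> uedges G \<Longrightarrow> Z e \<subseteq> Y {usource G e}" and
    \<theta>: "\<And>e. e \<in> uedges G \<Longrightarrow> bij_betw (\<theta> e) (Z e) (Y (urange G e))" and
    disj: "\<And>e f. e \<in> uedges G \<Longrightarrow> f \<in> uedges G \<Longrightarrow> e \<noteq> f \<Longrightarrow> Z e \<inter> Z f = {}" and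
    reg: "\<And>v. regular_vertex G v \<Longrightarrow> Y {v} = (\<Union>e\<in>out_edges G v. Z e)"
    using branching_system[OF G H] by blast
  define \<psi> where "\<psi> e = inv_into (Z e) (\<theta> e)" for e
  have \<psi>: "\<psi> e k \<in> Z e" "\<theta> e (\<psi> e k) = k" if "e \<in> uedges G" "k \<in> Y (urange G e)" for e k
    using \<theta>[OF that(1)] that(2) unfolding \<psi>_def
    by (auto simp: bij_betw_def f_inv_into_f inv_into_into)
  have \<theta>': "\<theta> e k \<in> Y (urange G e)" "\<psi> e (\<theta> e k) = k" if "e \<in> uedges G" "k \<in> Z e" for e k
    using \<theta>[OF that(1)] that(2) unfolding \<psi>_def by (auto simp: bij_betw_def)
  define basis :: "_ \<Rightarrow> ('v set set \<times> nat) \<Rightarrow>\<^sub>0 'k" where "basis k = sgl k 1" for k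
  define rep where "rep x = (case x of
      Proj A \<Rightarrow> lin_ext (\<lambda>k. if k \<in> Y A then basis k else 0)
    | Edge e \<Rightarrow> lin_ext (\<lambda>k. if k \<in> Y (urange G e) then basis (\<psi> e k) else 0)
    | Ghost e \<Rightarrow> lin_ext (\<lambda>k. if k \<in> Z e then basis (\<theta> e k) else 0))" for x
  have app [simp]: "app (rep (Proj A)) (basis k) = (if k \<in> Y A then basis k else 0)"
    "app (rep (Edge e)) (basis k) = (if k \<in> Y (urange G e) then basis (\<psi> e k) else 0)"
    "app (rep (Ghost e)) (basis k) = (if k \<in> Z e then basis (\<theta> e k) else 0)" for A e k
    by (simp_all add: rep_def basis_def)
  have eqI: "f = g" if "\<And>k. app f (basis k) = app g (basis k)" for f g
    using that lin_endo_eq_singleI unfolding basis_def by blast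
  define \<Phi> where "\<Phi> = lift scalar rep"
  note \<Phi>_simps = scalar.lift_simps[of rep, folded \<Phi>_def]
  have vert: "{usource G e} \<in> gen_verts G" "urange G e \<in> gen_verts G" if "e \<in> uedges G" for e
    using that source_in_verts by (auto intro: gen_verts.intros)
  have Y_empty: "Y {} = {}" using Y_H[of "{}"] H(3) by (simp add: gen_verts.empty)
  have rel: "\<Phi> a = \<Phi> b" if "ultragraph_rel G a b" for a b
    using that
  proof cases
    case empty
    then show ?thesis using Y_empty by (intro eqI) (simp add: \<Phi>_simps)
  next
    case (inter A B)
    then show ?thesis by (intro eqI) (simp add: \<Phi>_simps Y_inter)
  next
    case (union A B)
    then show ?thesis by (intro eqI) (simp add: \<Phi>_simps Y_inter Y_union)
  next
    case (source_edge e)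
    then show ?thesis using Z_Y[of e] \<psi>[of e] by (intro eqI) (auto simp: \<Phi>_simps)
  next
    case (edge_range e)
    then show ?thesis by (intro eqI) (simp add: \<Phi>_simps)
  next
    case (range_ghost e)
    then show ?thesis using \<theta>'[of e] by (intro eqI) (auto simp: \<Phi>_simps)
  next
    case (ghost_source e)
    then show ?thesis using Z_Y[of e] by (intro eqI) (auto simp: \<Phi>_simps)
  next
    case (ghost_edge e f)
    show ?thesis
    proof (cases "e = f")
      case True
      then show ?thesis using ghost_edge \<psi>[of f] by (intro eqI) (auto simp: \<Phi>_simps)
    next
      case False
      then show ?thesis using ghost_edge \<psi>(1)[of f] disj[of e f]
        by (intro eqI) (auto simp: \<Phi>_simps)
    qed
  next
    case (regular v)
    have fin: "finite (out_edges G v)" and sub: "out_edges G v \<subseteq> uedges G"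
      using regular by (auto simp: regular_vertex_def out_edges_def)
    have "app (\<Phi> b) (basis k) = (if k \<in> Y {v} then basis k else 0)" for k
    proof -
      have "app (\<Phi> b) (basis k) = (\<Sum>e\<in>out_edges G v. if k \<in> Z e then basis k else 0)"
        unfolding regular \<Phi>_simps app_sum
      proof (intro sum.cong refl)
        fix e assume "e \<in> out_edges G v"
        then have "e \<in> uedges G" using sub by auto
        then show "app (rep (Edge e) * rep (Ghost e)) (basis k) = (if k \<in> Z e then basis k else 0)"
          using \<theta>'[of e k] by simp
      qed
      \<comment> \<open>The sets \<open>Z e\<close> partition \<open>Y {v}\<close>, so exactly one
        summand is non-zero at a point of \<open>Y {v}\<close>.\<close>
      also have "\<dots> = (if k \<in> Y {v} then basis k else 0)"
      proof (cases "k \<in> Y {v}")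
        case True
        then obtain e where e: "e \<in> out_edges G v" "k \<in> Z e" using reg regular by auto
        then have "(k \<in> Z f) = (f = e)" if "f \<in> out_edges G v" for f
          using disj[of e f] that sub by auto
        then have "(\<Sum>f\<in>out_edges G v. if k \<in> Z f then basis k else 0) =
          (\<Sum>f\<in>out_edges G v. if f = e then basis k else 0)" by (intro sum.cong) auto
        then show ?thesis using e fin True by simp
      next
        case False
        then show ?thesis using reg regular by (auto intro!: sum.neutral)
      qed
      finally show ?thesis .
    qed
    then show ?thesis using regular by (intro eqI) (simp add: \<Phi>_simps)
  qed
  have "\<Phi> a = 0" if "a \<in> ultragraph_ideal G H" for a
    using that unfolding ultragraph_ideal_def
  proof (induction rule: rel_ideal.induct)
    case (relator a b)
    then show ?case
    proof
      assume "\<exists>A\<in>H. a = pj A \<and> b = 0"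
      then obtain A where A: "A \<in> H" "a = pj A" "b = 0" by blast
      then have "Y A = {}" using Y_H H(1) by (auto simp: hereditary_def)
      then have "rep (Proj A) = 0" by (intro eqI) simp
      then show ?thesis using A by (simp add: \<Phi>_simps)
    qed (simp add: rel \<Phi>_simps)
  qed (simp_all add: \<Phi>_simps fscale_eq)
  then have "rep (Proj A) = 0" using mem by (simp add: \<Phi>_simps flip: \<Phi>_simps(8))
  moreover have "basis k \<noteq> 0" for k
    unfolding basis_def by (metis keys_single keys_zero insert_not_empty zero_neq_one)
  ultimately have "k \<notin> Y A" for k
    using app(1)[of A k] by (auto split: if_splits)
  then show ?thesis using Y_H[OF A] by auto
qed

lemma prod_sum_closed:
  assumes N: "nu_ideal X N" and I: "nu_ideal X I" and x: "x \<in> prod_sum N I"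
  shows "fscale c x \<in> prod_sum N I"
    and "b \<in> free_nu X \<Longrightarrow> b * x \<in> prod_sum N I"
    and "b \<in> free_nu X \<Longrightarrow> x * b \<in> prod_sum N I"
proof -
  show "fscale c x \<in> prod_sum N I"
    using x
  proof (induction rule: prod_sum.induct)
    case (product x y)
    then have "fscale c x * y \<in> prod_sum N I"
      using nu_ideal_fscale[OF I] by (intro prod_sum.product)
    then show ?case by (simp add: fscale_eq mult.assoc)
  next
    case (add x y)
    then show ?case by (simp add: fscale_eq distrib_left prod_sum.add)
  qed (auto intro: prod_sum.base nu_ideal_fscale[OF N])
  assume b: "b \<in> free_nu X"
  show "b * x \<in> prod_sum N I"
    using x
  proof (induction rule: prod_sum.induct)
    case (product x y)
    then show ?case
      using nu_ideal_left'[OF I _ b] by (simp add: prod_sum.product flip: mult.assoc)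
  qed (auto simp: distrib_left intro: prod_sum.base prod_sum.add nu_ideal_left'[OF N _ b])
  show "x * b \<in> prod_sum N I"
    using x
  proof (induction rule: prod_sum.induct)
    case (product x y)
    then show ?case
      using nu_ideal_right'[OF I _ b] by (simp add: prod_sum.product mult.assoc)
  qed (auto simp: distrib_right intro: prod_sum.base prod_sum.add nu_ideal_right'[OF N _ b])
qed

lemma ultragraph_rel_free:
  assumes "ultragraph G" "ultragraph_rel G a b"
  shows "a \<in> free_nu (ultragraph_letters G) \<and> b \<in> free_nu (ultragraph_letters G)"
proof -
  interpret ultragraph G by fact
  have letters: "Proj A \<in> ultragraph_letters G \<longleftrightarrow> A \<in> gen_verts G"
    "Edge e \<in> ultragraph_letters G \<longleftrightarrow> e \<in> uedges G"
    "Ghost e \<in> ultragraph_letters G \<longleftrightarrow> e \<in> uedges G" for A e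
    by (auto simp: ultragraph_letters_def)
  from assms(2) show ?thesis
    by cases (auto simp: letters out_edges_def regular_vertex_def source_in_verts
        intro!: free_nu_mult free_nu_sum free_nu_add free_nu_diff gen_verts.intros)
qed

lemma nu_ideal_ultragraph:
  assumes "ultragraph G"
  shows "nu_ideal (ultragraph_letters G) (rel_ideal (ultragraph_letters G) (ultragraph_rel G))"
  by (rule nu_ideal_rel_ideal) (rule ultragraph_rel_free[OF assms])

lemma pj_mem_ultragraph_ideal:
  assumes "A \<in> H"
  shows "pj A \<in> ultragraph_ideal G H"
proof -
  have "pj A - 0 \<in> ultragraph_ideal G H"
    unfolding ultragraph_ideal_def by (rule rel_ideal.relator) (use assms in blast)
  then show ?thesis by simp
qed

text \<open>Modulo \<open>N\<close>, each new generator satisfies \<open>pj A = pj A * pj A\<close>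
  and so lies in \<open>N + I\<^sup>2\<close>, which is again an ideal by
  \<open>prod_sum_closed\<close>.\<close>

lemma ultragraph_ideal_idempotent:
  fixes G :: "('v, 'e) ultragraph"
  defines "N \<equiv> rel_ideal (ultragraph_letters G) (ultragraph_rel G) ::
    ('v set, 'e, 'k::field) leavitt_falg set"
  assumes G: "ultragraph G" and H: "H \<subseteq> gen_verts G"
  shows "nu_ideal (ultragraph_letters G) (ultragraph_ideal G H :: ('v set, 'e, 'k) leavitt_falg set)"
    and "N \<subseteq> ultragraph_ideal G H" and "ultragraph_ideal G H \<subseteq> prod_sum N (ultragraph_ideal G H)"
proof -
  let ?X = "ultragraph_letters G"
  show I: "nu_ideal ?X (ultragraph_ideal G H :: ('v set, 'e, 'k) leavitt_falg set)"
    unfolding ultragraph_ideal_def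
    by (rule nu_ideal_rel_ideal)
      (use ultragraph_rel_free[OF G] H in \<open>auto simp: ultragraph_letters_def\<close>)
  have N: "nu_ideal ?X N" unfolding N_def by (rule nu_ideal_ultragraph[OF G])
  show "N \<subseteq> ultragraph_ideal G H"
  proof
    show "x \<in> ultragraph_ideal G H" if "x \<in> N" for x
      using that unfolding N_def ultragraph_ideal_def
      by (induction rule: rel_ideal.induct) (auto intro: rel_ideal.intros)
  qed
  show "ultragraph_ideal G H \<subseteq> prod_sum N (ultragraph_ideal G H)"
  proof
    fix x :: "('v set, 'e, 'k) leavitt_falg"
    assume "x \<in> ultragraph_ideal G H"
    then show "x \<in> prod_sum N (ultragraph_ideal G H)"
      unfolding ultragraph_ideal_def[of G H]
    proof (induction rule: rel_ideal.induct)
      case zero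
      show ?case by (intro prod_sum.base) (simp add: N_def rel_ideal.zero)
    next
      case (relator a b)
      then show ?case
      proof
        assume "ultragraph_rel G a b"
        then show ?thesis by (intro prod_sum.base) (simp add: N_def rel_ideal.relator)
      next
        assume "\<exists>A\<in>H. a = pj A \<and> b = 0"
        then obtain A where A: "A \<in> H" "a = pj A" "b = 0" by blast
        have "ultragraph_rel G (pj A * pj A) (pj A :: ('v set, 'e, 'k) leavitt_falg)"
          using ultragraph_rel.inter[of A G A] A(1) H by auto
        then have "- (pj A * pj A - pj A) \<in> N"
          by (intro nu_ideal_uminus[OF N]) (simp add: N_def rel_ideal.relator)
        moreover have "pj A \<in> rel_ideal ?X (\<lambda>a b. ultragraph_rel G a b \<or> (\<exists>A\<in>H. a = pj A \<and> b = 0))"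
          using pj_mem_ultragraph_ideal[OF A(1), of G] unfolding ultragraph_ideal_def .
        ultimately have "- (pj A * pj A - pj A) + pj A * pj A \<in> prod_sum N
          (rel_ideal ?X (\<lambda>a b. ultragraph_rel G a b \<or> (\<exists>A\<in>H. a = pj A \<and> b = 0)))"
          by (intro prod_sum.add prod_sum.product) (simp_all add: prod_sum.base)
        then show ?thesis using A by simp
      qed
    next
      case (add a b)
      then show ?case by (simp only: prod_sum.add)
    next
      case (scale a c)
      then show ?case by (intro prod_sum_closed(1)[OF N I[unfolded ultragraph_ideal_def]])
    next
      case (mult_left a b)
      then show ?case by (intro prod_sum_closed(2)[OF N I[unfolded ultragraph_ideal_def]])
    next
      case (mult_right a b)
      then show ?case by (intro prod_sum_closed(3)[OF N I[unfolded ultragraph_ideal_def]])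
    qed
  qed
qed

section \<open>Transfer along isomorphisms of presented algebras\<close>

locale presentation =
  fixes X :: "'x set" and R :: "('x, 'k::field) falg \<Rightarrow> ('x, 'k) falg \<Rightarrow> bool"
  assumes relators_free: "R a b \<Longrightarrow> a \<in> free_nu X \<and> b \<in> free_nu X"
begin

definition cls :: "('x, 'k) falg \<Rightarrow> ('x, 'k) falg set" where
  "cls a = rel_cong X R `` {a}"

abbreviation "N \<equiv> rel_ideal X R"

lemma nu_ideal_N: "nu_ideal X N"
  by (rule nu_ideal_rel_ideal) (rule relators_free)

lemma mem_cls: "a \<in> free_nu X \<Longrightarrow> b \<in> cls a \<longleftrightarrow> b \<in> free_nu X \<and> a - b \<in> N"
  by (auto simp: cls_def rel_cong_def)

lemma cls_eq_iff:
  assumes "a \<in> free_nu X" "b \<in> free_nu X"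
  shows "cls a = cls b \<longleftrightarrow> a - b \<in> N"
proof
  assume "cls a = cls b"
  then have "b \<in> cls a" using mem_cls[OF assms(2), of b] assms nu_ideal_zero[OF nu_ideal_N] by simp
  then show "a - b \<in> N" using mem_cls assms by blast
next
  assume ab: "a - b \<in> N"
  have "a - c \<in> N \<longleftrightarrow> b - c \<in> N" for c
    using nu_ideal_diff[OF nu_ideal_N _ ab, of "a - c"] nu_ideal_add[OF nu_ideal_N ab, of "b - c"]
    by auto
  then show "cls a = cls b" using mem_cls assms by blast
qed

lemma cls_self: "a \<in> free_nu X \<Longrightarrow> a \<in> cls a"
  by (simp add: mem_cls nu_ideal_zero[OF nu_ideal_N])

lemma carrier: "alg_carrier (presented_algebra X R) = cls ` free_nu X"
  by (auto simp: presented_algebra_def Let_def quotient_def cls_def)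

lemma UN_cls:
  assumes "a \<in> free_nu X" "\<And>a'. a' \<in> free_nu X \<Longrightarrow> a - a' \<in> N \<Longrightarrow> F a' = F a"
  shows "(\<Union>a'\<in>cls a. F a') = F a"
  using assms cls_self[OF assms(1)] mem_cls[OF assms(1)] by blast

lemma UN_cls2:
  assumes a: "a \<in> free_nu X" and b: "b \<in> free_nu X"
    and F: "\<And>a' b'. a' \<in> free_nu X \<Longrightarrow> b' \<in> free_nu X \<Longrightarrow> a - a' \<in> N \<Longrightarrow> b - b' \<in> N \<Longrightarrow> F a' b' = F a b"
  shows "(\<Union>a'\<in>cls a. \<Union>b'\<in>cls b. F a' b') = F a b"
proof -
  have "(\<Union>a'\<in>cls a. \<Union>b'\<in>cls b. F a' b') = (\<Union>a'\<in>cls a. \<Union>b'\<in>cls b. F a b)"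
    using F by (intro SUP_cong refl) (auto simp: mem_cls a b)
  also have "\<dots> = F a b" using cls_self[OF a] cls_self[OF b] by auto
  finally show ?thesis .
qed

lemma add_cls:
  assumes a: "a \<in> free_nu X" and b: "b \<in> free_nu X"
  shows "alg_add (presented_algebra X R) (cls a) (cls b) = cls (a + b)"
proof -
  have "cls (a' + b') = cls (a + b)"
    if "a' \<in> free_nu X" "b' \<in> free_nu X" "a - a' \<in> N" "b - b' \<in> N" for a' b'
  proof -
    have "- (a - a' + (b - b')) \<in> N"
      by (intro nu_ideal_uminus[OF nu_ideal_N] nu_ideal_add[OF nu_ideal_N] that)
    then show ?thesis using that a b
      by (subst cls_eq_iff) (auto simp: free_nu_add algebra_simps)
  qed
  then have "(\<Union>a\<in>cls a. \<Union>b\<in>cls b. cls (a + b)) = cls (a + b)"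
    by (rule UN_cls2[OF a b])
  then show ?thesis by (simp add: presented_algebra_def Let_def flip: cls_def)
qed

lemma mult_cls:
  assumes a: "a \<in> free_nu X" and b: "b \<in> free_nu X"
  shows "alg_mult (presented_algebra X R) (cls a) (cls b) = cls (a * b)"
proof -
  have "cls (a' * b') = cls (a * b)"
    if "a' \<in> free_nu X" "b' \<in> free_nu X" "a - a' \<in> N" "b - b' \<in> N" for a' b'
  proof -
    have "- ((a - a') * b + a' * (b - b')) \<in> N"
      by (intro nu_ideal_uminus[OF nu_ideal_N] nu_ideal_add[OF nu_ideal_N]
          nu_ideal_right'[OF nu_ideal_N] nu_ideal_left'[OF nu_ideal_N] that b)
    then show ?thesis using that a b
      by (subst cls_eq_iff) (auto simp: free_nu_mult algebra_simps)
  qed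
  then have "(\<Union>a\<in>cls a. \<Union>b\<in>cls b. cls (a * b)) = cls (a * b)"
    by (rule UN_cls2[OF a b])
  then show ?thesis by (simp add: presented_algebra_def Let_def flip: cls_def)
qed

lemma scale_cls:
  assumes a: "a \<in> free_nu X"
  shows "alg_scale (presented_algebra X R) c (cls a) = cls (fscale c a)"
proof -
  have "cls (fscale c a') = cls (fscale c a)" if "a' \<in> free_nu X" "a - a' \<in> N" for a'
    using that a nu_ideal_uminus[OF nu_ideal_N nu_ideal_fscale[OF nu_ideal_N that(2), of c]]
    by (subst cls_eq_iff) (simp_all add: free_nu_fscale, simp add: fscale_eq algebra_simps)
  then have "(\<Union>a\<in>cls a. cls (fscale c a)) = cls (fscale c a)"
    using a by (intro UN_cls) auto
  then show ?thesis by (simp add: presented_algebra_def Let_def flip: cls_def)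
qed

end

locale presentation_iso = P: presentation X R + Q: presentation X' R'
  for X :: "'x set" and R :: "('x, 'k::field) falg \<Rightarrow> ('x, 'k) falg \<Rightarrow> bool"
    and X' :: "'y set" and R' :: "('y, 'k) falg \<Rightarrow> ('y, 'k) falg \<Rightarrow> bool" +
  fixes h
  assumes iso: "alg_iso (presented_algebra X R) (presented_algebra X' R') h"
begin

text \<open>A relation between representatives in place of a chosen lift of \<open>h\<close>: it
  respects the operations exactly, whereas a chosen lift would do so only modulo the ideals.\<close>

definition corr :: "('x, 'k) falg \<Rightarrow> ('y, 'k) falg \<Rightarrow> bool" where
  "corr a b \<longleftrightarrow> a \<in> free_nu X \<and> b \<in> free_nu X' \<and> h (P.cls a) = Q.cls b"

lemma bij: "bij_betw h (P.cls ` free_nu X) (Q.cls ` free_nu X')"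
  using iso by (simp add: alg_iso_def P.carrier Q.carrier)

lemma corr_total: "a \<in> free_nu X \<Longrightarrow> \<exists>b. corr a b"
  using bij_betw_apply[OF bij, of "P.cls a"] by (auto simp: corr_def)

lemma corr_onto:
  assumes "b \<in> free_nu X'"
  shows "\<exists>a. corr a b"
proof -
  have "Q.cls b \<in> h ` P.cls ` free_nu X"
    using bij_betw_imp_surj_on[OF bij] assms by simp
  then obtain a where "a \<in> free_nu X" "Q.cls b = h (P.cls a)" by auto
  then show ?thesis using assms by (auto simp: corr_def)
qed

lemma corr_free: "corr a b \<Longrightarrow> a \<in> free_nu X" "corr a b \<Longrightarrow> b \<in> free_nu X'"
  by (simp_all add: corr_def)

lemma corr_add: "corr a b \<Longrightarrow> corr a' b' \<Longrightarrow> corr (a + a') (b + b')"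
  using iso unfolding alg_iso_def corr_def P.carrier
  by (auto simp: free_nu_add simp flip: P.add_cls Q.add_cls)

lemma corr_mult: "corr a b \<Longrightarrow> corr a' b' \<Longrightarrow> corr (a * a') (b * b')"
  using iso unfolding alg_iso_def corr_def P.carrier
  by (auto simp: free_nu_mult simp flip: P.mult_cls Q.mult_cls)

lemma corr_scale: "corr a b \<Longrightarrow> corr (fscale c a) (fscale c b)"
  using iso unfolding alg_iso_def corr_def P.carrier
  by (auto simp: free_nu_fscale simp flip: P.scale_cls Q.scale_cls)

lemma corr_diff: "corr a b \<Longrightarrow> corr a' b' \<Longrightarrow> corr (a - a') (b - b')"
  using corr_add[of a b "fscale (- 1) a'" "fscale (- 1) b'"] corr_scale[of a' b' "- 1"]
  by (simp add: fscale_eq scal_simps)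

lemma corr_0: "corr 0 0"
  using corr_total[of 0] corr_diff by fastforce

lemma corr_ideal:
  assumes "corr a b"
  shows "a \<in> P.N \<longleftrightarrow> b \<in> Q.N"
proof -
  have "a \<in> P.N \<longleftrightarrow> P.cls a = P.cls 0" using assms by (subst P.cls_eq_iff) (auto simp: corr_def)
  also have "\<dots> \<longleftrightarrow> h (P.cls a) = h (P.cls 0)"
    using inj_on_eq_iff[OF bij_betw_imp_inj_on[OF bij], of "P.cls a" "P.cls 0"] assms
    by (simp add: corr_def)
  also have "\<dots> \<longleftrightarrow> Q.cls b = Q.cls 0" using assms corr_0 by (simp add: corr_def)
  also have "\<dots> \<longleftrightarrow> b \<in> Q.N" using assms by (subst Q.cls_eq_iff) (auto simp: corr_def)
  finally show ?thesis .
qed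

definition image_ideal :: "('x, 'k) falg set \<Rightarrow> ('y, 'k) falg set" where
  "image_ideal I = {b. \<exists>a\<in>I. corr a b}"

text \<open>Elements of \<open>X\<close>-type corresponding to the same \<open>b\<close> differ by
  an element of \<open>P.N\<close>, which \<open>I\<close> contains. It follows that
  \<open>image_ideal\<close> is injective on such ideals.\<close>

lemma mem_image_ideal:
  assumes "nu_ideal X I" "P.N \<subseteq> I" "corr a b"
  shows "b \<in> image_ideal I \<longleftrightarrow> a \<in> I"
proof
  assume "b \<in> image_ideal I"
  then obtain a' where a': "a' \<in> I" "corr a' b" by (auto simp: image_ideal_def)
  then have "a - a' \<in> P.N"
    using corr_ideal[OF corr_diff[OF assms(3) a'(2)]] nu_ideal_zero[OF Q.nu_ideal_N] by simp
  then have "a - a' + a' \<in> I" using assms a'(1) by (intro nu_ideal_add[OF assms(1)]) auto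
  then show "a \<in> I" by simp
qed (use assms in \<open>auto simp: image_ideal_def\<close>)

lemma image_ideal:
  assumes I: "nu_ideal X I" "P.N \<subseteq> I" "I \<subseteq> prod_sum P.N I"
  shows "nu_ideal X' (image_ideal I) \<and> Q.N \<subseteq> image_ideal I \<and> image_ideal I \<subseteq> prod_sum Q.N (image_ideal I)"
proof (intro conjI)
  show "nu_ideal X' (image_ideal I)"
    unfolding nu_ideal_def
  proof (intro conjI ballI allI subsetI)
    show "b \<in> free_nu X'" if "b \<in> image_ideal I" for b
      using that by (auto simp: image_ideal_def corr_def)
    show "0 \<in> image_ideal I"
      using corr_0 nu_ideal_zero[OF I(1)] by (auto simp: image_ideal_def)
    show "a + b \<in> image_ideal I" if "a \<in> image_ideal I" "b \<in> image_ideal I" for a b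
      using that corr_add nu_ideal_add[OF I(1)] unfolding image_ideal_def by blast
    show "fscale c a \<in> image_ideal I" if "a \<in> image_ideal I" for a c
      using that corr_scale nu_ideal_fscale[OF I(1)] unfolding image_ideal_def by blast
    fix a b :: "('y, 'k) falg" assume ab: "a \<in> image_ideal I" "b \<in> free_nu X'"
    then obtain a0 where "a0 \<in> I" "corr a0 a" by (auto simp: image_ideal_def)
    moreover obtain b0 where "corr b0 b" using corr_onto[OF ab(2)] by blast
    ultimately show "b * a \<in> image_ideal I" "a * b \<in> image_ideal I"
      using corr_mult nu_ideal_left'[OF I(1)] nu_ideal_right'[OF I(1)] corr_free(1)
      unfolding image_ideal_def by blast+
  qed
  show "Q.N \<subseteq> image_ideal I"
  proof
    fix b assume b: "b \<in> Q.N"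
    then obtain a where "corr a b" using corr_onto nu_ideal_free[OF Q.nu_ideal_N] by blast
    then show "b \<in> image_ideal I" using corr_ideal b I(2) by (auto simp: image_ideal_def)
  qed
  \<comment> \<open>Sums of products are transferred factor by factor. The resulting representative
    may differ from a given one by an element of \<open>Q.N\<close>, which \<open>prod_sum\<close>
    absorbs.\<close>
  have *: "\<exists>b. corr a b \<and> b \<in> prod_sum Q.N (image_ideal I)" if "a \<in> prod_sum P.N I" for a
    using that
  proof (induction rule: prod_sum.induct)
    case (base a)
    then obtain b where "corr a b" using corr_total nu_ideal_free[OF P.nu_ideal_N] by blast
    then show ?case using corr_ideal base by (auto intro: prod_sum.base)
  next
    case (product x y)
    obtain x' where x': "corr x x'" using corr_total nu_ideal_free[OF I(1) product(1)] by blast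
    obtain y' where y': "corr y y'" using corr_total nu_ideal_free[OF I(1) product(2)] by blast
    have "x' \<in> image_ideal I" "y' \<in> image_ideal I"
      using product x' y' by (auto simp: image_ideal_def)
    then show ?case using corr_mult[OF x' y'] prod_sum.product by blast
  next
    case (add x y)
    then show ?case using corr_add prod_sum.add by blast
  qed
  show "image_ideal I \<subseteq> prod_sum Q.N (image_ideal I)"
  proof
    fix b assume "b \<in> image_ideal I"
    then obtain a where a: "a \<in> I" "corr a b" by (auto simp: image_ideal_def)
    then obtain b' where b': "corr a b'" "b' \<in> prod_sum Q.N (image_ideal I)" using * I(3) by blast
    have "b - b' \<in> Q.N"
      using corr_ideal[OF corr_diff[OF a(2) b'(1)]] nu_ideal_zero[OF P.nu_ideal_N] by simp
    then have "(b - b') + b' \<in> prod_sum Q.N (image_ideal I)"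
      by (rule prod_sum.add[OF prod_sum.base b'(2)])
    then show "b \<in> prod_sum Q.N (image_ideal I)" by simp
  qed
qed

lemma finite_ideals:
  assumes "finite {J. nu_ideal X' J \<and> Q.N \<subseteq> J \<and> J \<subseteq> prod_sum Q.N J}"
  shows "finite {I. nu_ideal X I \<and> P.N \<subseteq> I \<and> I \<subseteq> prod_sum P.N I}"
proof (rule inj_on_finite[OF _ _ assms])
  show "inj_on image_ideal {I. nu_ideal X I \<and> P.N \<subseteq> I \<and> I \<subseteq> prod_sum P.N I}"
  proof (rule inj_onI)
    fix I J assume "I \<in> {I. nu_ideal X I \<and> P.N \<subseteq> I \<and> I \<subseteq> prod_sum P.N I}"
      "J \<in> {I. nu_ideal X I \<and> P.N \<subseteq> I \<and> I \<subseteq> prod_sum P.N I}" "image_ideal I = image_ideal J"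
    then have "a \<in> I \<longleftrightarrow> a \<in> J" if "a \<in> free_nu X" for a
      using corr_total[OF that] mem_image_ideal by blast
    then show "I = J" using \<open>I \<in> _\<close> \<open>J \<in> _\<close> nu_ideal_free by blast
  qed
  show "image_ideal ` {I. nu_ideal X I \<and> P.N \<subseteq> I \<and> I \<subseteq> prod_sum P.N I} \<subseteq>
    {J. nu_ideal X' J \<and> Q.N \<subseteq> J \<and> J \<subseteq> prod_sum Q.N J}"
    using image_ideal by blast
qed

lemma unit_transfer:
  assumes "unital (presented_algebra X R)"
  shows "\<exists>u\<in>free_nu X'. \<forall>a\<in>free_nu X'. u * a - a \<in> Q.N \<and> a * u - a \<in> Q.N"
proof -
  obtain u where u: "u \<in> free_nu X"
    "\<And>a. a \<in> free_nu X \<Longrightarrow> P.cls (u * a) = P.cls a \<and> P.cls (a * u) = P.cls a"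
    using assms unfolding unital_def P.carrier by (auto simp: P.mult_cls)
  obtain u' where u': "corr u u'" using corr_total[OF u(1)] by blast
  have "u' * b - b \<in> Q.N \<and> b * u' - b \<in> Q.N" if b: "b \<in> free_nu X'" for b
  proof -
    obtain a where a: "corr a b" using corr_onto[OF b] by blast
    have af: "a \<in> free_nu X" using corr_free(1)[OF a] .
    have "u * a - a \<in> P.N" "a * u - a \<in> P.N"
      using u(2)[OF af] u(1) af by (simp_all add: P.cls_eq_iff free_nu_mult)
    then show ?thesis
      using corr_ideal[OF corr_diff[OF corr_mult[OF u' a] a]]
        corr_ideal[OF corr_diff[OF corr_mult[OF a u'] a]] by blast
  qed
  then show ?thesis using corr_free(2)[OF u'] by blast
qed

end

theorem proposition2p7:
  fixes K :: "'k::field itself"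
    and G :: "('v, 'e) ultragraph"
    and E :: "('w, 'f) pre_digraph"
  assumes "ultragraph G"
    and "unital (ultragraph_lpa K G)"
    and "infinite {H. H \<subseteq> gen_verts G \<and> hereditary G H \<and> saturated G H}"
    and "wf_digraph E"
  shows "\<not> alg_isomorphic (ultragraph_lpa K G) (digraph_lpa K E)"
proof
  let ?R = "ultragraph_rel G :: ('v set, 'e, 'k) leavitt_falg \<Rightarrow> _"
  let ?R' = "digraph_rel E :: ('w, 'f, 'k) leavitt_falg \<Rightarrow> _"
  let ?I = "ultragraph_ideal G :: 'v set set \<Rightarrow> ('v set, 'e, 'k) leavitt_falg set"
  let ?X = "ultragraph_letters G" and ?X' = "lpa_letters E"
  assume "alg_isomorphic (ultragraph_lpa K G) (digraph_lpa K E)"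
  then obtain h where "alg_iso (presented_algebra ?X ?R) (presented_algebra ?X' ?R') h"
    by (auto simp: alg_isomorphic_def ultragraph_lpa_def digraph_lpa_def ultragraph_letters_def
        lpa_letters_def)
  then interpret presentation_iso ?X ?R ?X' ?R' h
    by unfold_locales (use ultragraph_rel_free[OF assms(1)] digraph_rel_free[OF assms(4)] in auto)
  have "unital (presented_algebra ?X ?R)"
    using assms(2) by (simp add: ultragraph_lpa_def ultragraph_letters_def)
  then obtain u where u: "u \<in> free_nu ?X'"
    "\<And>a. a \<in> free_nu ?X' \<Longrightarrow> u * a - a \<in> Q.N \<and> a * u - a \<in> Q.N"
    using unit_transfer by blast
  let ?S = "{I. nu_ideal ?X I \<and> P.N \<subseteq> I \<and> I \<subseteq> prod_sum P.N I}"
  let ?\<H> = "{H. H \<subseteq> gen_verts G \<and> hereditary G H \<and> saturated G H}"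
  have fin: "finite ?S"
    by (rule finite_ideals[OF finite_idempotent_nu_ideals[OF assms(4) u]])
  \<comment> \<open>The empty family is hereditary and saturated and gives the same ideal as
    \<open>{{}}\<close>, so it has to be left out for injectivity. Every other family contains the
    empty set, as \<open>ultragraph_ideal_pj\<close> requires.\<close>
  have "finite (?\<H> - {{}})"
  proof (rule inj_on_finite[OF _ _ fin])
    show "inj_on ?I (?\<H> - {{}})"
    proof (rule inj_onI)
      have mem: "A \<in> H \<longleftrightarrow> pj A \<in> ?I H"
        if H: "H \<in> ?\<H> - {{}}" and A: "A \<in> gen_verts G" for A H
      proof
        assume mem: "pj A \<in> ?I H"
        obtain B where "B \<in> H" using H by auto
        then have "{} \<in> H" using H gen_verts.empty unfolding hereditary_def by blast
        then show "A \<in> H" using ultragraph_ideal_pj[OF assms(1) _ _ _ A mem] H by blast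
      qed (rule pj_mem_ultragraph_ideal)
      fix H H' assume HH: "H \<in> ?\<H> - {{}}" "H' \<in> ?\<H> - {{}}"
        "?I H = ?I H'"
      then have "A \<in> H \<longleftrightarrow> A \<in> H'" if "A \<in> gen_verts G" for A
        using mem[OF HH(1) that] mem[OF HH(2) that] by simp
      then show "H = H'" using HH(1,2) by blast
    qed
    show "?I ` (?\<H> - {{}}) \<subseteq> ?S"
    proof (rule image_subsetI)
      fix H assume "H \<in> ?\<H> - {{}}"
      then have "H \<subseteq> gen_verts G" by simp
      from ultragraph_ideal_idempotent[OF assms(1) this] show "?I H \<in> ?S" by simp
    qed
  qed
  then have "finite ?\<H>" by simp
  then show False using assms(3) by contradiction
qed

end
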